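(* Consider the FSPG iterates $(\mathbf{w}^{(k)})$ with parameters $c>0$, $\beta>0$, $d\in(0,1)$ such that $\beta c\ge\frac{\lambda_{\max}(\bar{\mathbf{X}}^\top\bar{\mathbf{X}})}{2}$. Let $\rho\ge0$ be a weak convexity parameter of $P_{\lambda,\gamma}$ and assume there exists $K$ such that $\sigma^{(k+1)}\ge n\rho$ for all $k\ge K$. Then $(\mathbf{w}^{(k)})$ converges to a point $\mathbf{w}^*$ which is stationary for the problem $\min_{\mathbf{w}}\sum_{l=1}^L g_l(\mathbf{w})+nP_{\lambda,\gamma}(\mathbf{w})$, i.e. $$\mathbf{0}\in\sum_{l=1}^L\partial g_l(\mathbf{w}^* )+n\,\partial P_{\lambda,\gamma}(\mathbf{w}^* ).$$
   Context: Data: $L$ clients; client $l$ holds $y^{(l)}_1,\dots,y^{(l)}_{M_l}\in\mathbb{R}$ and $\bar{\mathbf{x}}^{(l)}_i=[(\mathbf{x}^{(l)}_i)^\top,1]^\top\in\mathbb{R}^{P+1}$; $n=\sum_l M_l$; $\bar{\mathbf{X}}\in\mathbb{R}^{(P+1)\times n}$ has all $\bar{\mathbf{x}}^{(l)}_i$ as columns; $\lambda_{\max}$ is the largest eigenvalue. Quantile level $\tau\in(0,1)$. Local quantile loss: $g_l(\mathbf{w})=\frac12\sum_i|y^{(l)}_i-(\bar{\mathbf{x}}^{(l)}_i)^\top\mathbf{w}|+(\tau-\frac12)\sum_i(y^{(l)}_i-(\bar{\mathbf{x}}^{(l)}_i)^\top\mathbf{w})$. Smoothing: $f(r,\mu)=|r|$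 if $|r|\ge\mu$, $f(r,\mu)=\frac{r^2}{2\mu}+\frac{\mu}{2}$ if $|r|<\mu$; $\tilde g_l(\mathbf{w},\mu)=\frac12\sum_{i} f(y^{(l)}_i-(\bar{\mathbf{x}}^{(l)}_i)^\top\mathbf{w},\mu)+(\tau-\frac12)\sum_i(y^{(l)}_i-(\bar{\mathbf{x}}^{(l)}_i)^\top\mathbf{w})$. Penalty: $\lambda>0$, $P_{\lambda,\gamma}(\mathbf{w})=\sum_{p=1}^{P}g_{\lambda,\gamma}(w_p)$ with $g_{\lambda,\gamma}$ either MCP ($\gamma\ge1$): $\lambda|t|-\frac{t^2}{2\gamma}$ for $|t|\le\gamma\lambda$, $\frac{\gamma\lambda^2}{2}$ otherwise; or SCAD ($\gamma\ge2$): $\lambda|t|$ for $|t|\le\lambda$, $-\frac{t^2-2\gamma\lambda|t|+\lambda^2}{2(\gamma-1)}$ for $\lambda<|t|\le\gamma\lambda$, $\frac{(\gamma+1)\lambda^2}{2}$ for $|t|>\gamma\lambda$. $\partial$ denotes the subdifferential (convex subdifferential for the convex $g_l$; limiting/Fréchet subdifferential for the weakly convex $P_{\lambda,\gamma}$). A weak convexity parameter of $P_{\lambda,\gamma}$ is $\rho\ge0$ such that $\mathbf{w}\mapsto P_{\lambda,\gamma}(\mathbf{w})+\frac{\rho}{2}\|\mathbf{w}\|_2^2$ is convex. FSPG algorithm: choose $\mathbf{w}^{(0)}\in\mathbb{R}^{P+1}$, $c>0$, $\beta>0$, $d\in(0,1)$; set $\sigma^{(k)}=ck^d$ and $\mu^{(k)}=\beta/k^d$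 for $k\ge1$; for $k=0,1,2,\dots$ let $\mathbf{w}^{(k+1)}$ be a minimizer over $\mathbf{w}\in\mathbb{R}^{P+1}$ of $\sum_{l=1}^L\langle\nabla_{\mathbf{w}}\tilde g_l(\mathbf{w}^{(k)},\mu^{(k+1)}),\mathbf{w}-\mathbf{w}^{(k)}\rangle+nP_{\lambda,\gamma}(\mathbf{w})+\frac{\sigma^{(k+1)}}{2}\|\mathbf{w}-\mathbf{w}^{(k)}\|_2^2$. *)

theory Defs
  imports "HOL-Analysis.Analysis"
begin

text \<open>Parameter vectors in R^(P+1) are represented as pairs (feature weights, intercept):
  the type (real^'p) \<times> real, with the product inner product and Euclidean norm.\<close>

definition xbar :: "(nat \<Rightarrow> nat \<Rightarrow> real^'p) \<Rightarrow> nat \<Rightarrow> nat \<Rightarrow> (real^'p) \<times> real" where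
  "xbar x l i = (x l i, 1)"

definition num_samples :: "nat \<Rightarrow> (nat \<Rightarrow> nat) \<Rightarrow> nat" where
  "num_samples L M = (\<Sum>l<L. M l)"

text \<open>Index set of all samples (l,i), l < L, i < M l: the columns of Xbar.\<close>
definition samples :: "nat \<Rightarrow> (nat \<Rightarrow> nat) \<Rightarrow> (nat \<times> nat) set" where
  "samples L M = {(l, i). l < L \<and> i < M l}"

definition lambda_max :: "('i \<Rightarrow> 'i \<Rightarrow> real) \<Rightarrow> 'i set \<Rightarrow> real" where
  "lambda_max A S = Max {\<mu>. \<exists>v. (\<exists>a\<in>S. v a \<noteq> 0) \<and>
                          (\<forall>a\<in>S. (\<Sum>b\<in>S. A a b * v b) = \<mu> * v a)}"

definition gram :: "(nat \<Rightarrow> nat \<Rightarrow> real^'p) \<Rightarrow> nat \<times> nat \<Rightarrow> nat \<times> nat \<Rightarrow> real" where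
  "gram x a b = inner (xbar x (fst a) (snd a)) (xbar x (fst b) (snd b))"

definition qloss :: "real \<Rightarrow> (nat \<Rightarrow> nat) \<Rightarrow> (nat \<Rightarrow> nat \<Rightarrow> real) \<Rightarrow> (nat \<Rightarrow> nat \<Rightarrow> real^'p)
     \<Rightarrow> nat \<Rightarrow> (real^'p) \<times> real \<Rightarrow> real" where
  "qloss \<tau> M y x l w =
     1/2 * (\<Sum>i<M l. \<bar>y l i - inner (xbar x l i) w\<bar>)
     + (\<tau> - 1/2) * (\<Sum>i<M l. y l i - inner (xbar x l i) w)"

definition fsmooth :: "real \<Rightarrow> real \<Rightarrow> real" where
  "fsmooth r \<mu> = (if \<bar>r\<bar> \<ge> \<mu> then \<bar>r\<bar> else r\<^sup>2 / (2 * \<mu>) + \<mu> / 2)"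

definition sqloss :: "real \<Rightarrow> (nat \<Rightarrow> nat) \<Rightarrow> (nat \<Rightarrow> nat \<Rightarrow> real) \<Rightarrow> (nat \<Rightarrow> nat \<Rightarrow> real^'p)
     \<Rightarrow> nat \<Rightarrow> (real^'p) \<times> real \<Rightarrow> real \<Rightarrow> real" where
  "sqloss \<tau> M y x l w \<mu> =
     1/2 * (\<Sum>i<M l. fsmooth (y l i - inner (xbar x l i) w) \<mu>)
     + (\<tau> - 1/2) * (\<Sum>i<M l. y l i - inner (xbar x l i) w)"

definition mcp :: "real \<Rightarrow> real \<Rightarrow> real \<Rightarrow> real" where
  "mcp lam \<gamma> t = (if \<bar>t\<bar> \<le> \<gamma> * lam then lam * \<bar>t\<bar> - t\<^sup>2 / (2 * \<gamma>) else \<gamma> * lam\<^sup>2 / 2)"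

definition scad :: "real \<Rightarrow> real \<Rightarrow> real \<Rightarrow> real" where
  "scad lam \<gamma> t =
     (if \<bar>t\<bar> \<le> lam then lam * \<bar>t\<bar>
      else if \<bar>t\<bar> \<le> \<gamma> * lam then - (t\<^sup>2 - 2 * \<gamma> * lam * \<bar>t\<bar> + lam\<^sup>2) / (2 * (\<gamma> - 1))
      else (\<gamma> + 1) * lam\<^sup>2 / 2)"

definition penalty :: "(real \<Rightarrow> real) \<Rightarrow> (real^'p) \<times> real \<Rightarrow> real" where
  "penalty g w = (\<Sum>p\<in>UNIV. g (fst w $ p))"

definition convex_subdiff :: "('a::real_inner \<Rightarrow> real) \<Rightarrow> 'a \<Rightarrow> 'a set" where
  "convex_subdiff f w = {v. \<forall>z. f z \<ge> f w + inner v (z - w)}"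

definition frechet_subdiff :: "('a::real_inner \<Rightarrow> real) \<Rightarrow> 'a \<Rightarrow> 'a set" where
  "frechet_subdiff f w = {v. \<forall>\<epsilon>>0. \<exists>\<delta>>0. \<forall>z. norm (z - w) < \<delta> \<longrightarrow>
        f z \<ge> f w + inner v (z - w) - \<epsilon> * norm (z - w)}"

definition limiting_subdiff :: "('a::real_inner \<Rightarrow> real) \<Rightarrow> 'a \<Rightarrow> 'a set" where
  "limiting_subdiff f w = {v. \<exists>ws vs. ws \<longlonglongrightarrow> w \<and> (\<lambda>k. f (ws k)) \<longlonglongrightarrow> f w \<and>
        (\<forall>k. vs k \<in> frechet_subdiff f (ws k)) \<and> vs \<longlonglongrightarrow> v}"

end

theory Submission
  imports Defs "HOL-Computational_Algebra.Polynomial"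
begin

text \<open>Sufficient decrease alone gives summability of \<open>\<sigma>\<^sup>(k) * \<parallel>w\<^sup>(k) - w\<^sup>(k-1)\<parallel>\<^sup>2\<close>, which for \<open>d < 1\<close> does not
  give convergence. The step lengths are summable because of a Kurdyka--Lojasiewicz inequality that
  is uniform in the smoothing parameter. The smoothed objective consists of finitely many pieces,
  each quadratic in \<open>w\<close> with Hessian \<open>A / \<mu> - B\<close> for positive semidefinite \<open>A\<close> and \<open>B\<close>; in a basis that
  diagonalizes both, every curvature is 0 for all \<open>\<mu>\<close> or bounded away from 0 as \<open>\<mu> \<rightarrow> 0\<close>. Hence on
  each piece the gradient \<open>v\<close> is bounded away from 0 or the objective differs from a critical value
  \<open>c(\<mu>)\<close>, a rational function of \<open>\<mu>\<close>, by at most \<open>C \<parallel>v\<parallel>\<^sup>2\<close>. Since \<open>1 / \<sigma>\<^sup>(k)\<close> is not summable, the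
  gradients tend to 0 along a subsequence, and the limit is stationary.\<close>

section \<open>Quadratic forms\<close>

text \<open>The classical argument follows the square root of the gap to one critical value. Here
  the critical value and the objective both move with \<open>\<mu>\<close>, and the iterates may
  switch pieces infinitely often, so no single gap can be followed. Gaps to all critical values are
  tracked at once, through a signed square root flattened at a scale \<open>m\<close>, because a gap
  may change sign. Only the matching value yields decrease; another one can spoil it only by
  drifting relative to the matching one. Differences of critical values are rational in
  \<open>\<mu>\<close> and cannot oscillate near 0, so their relative drift per step is at most a
  multiple of that of \<open>\<mu>\<close>, which is at most \<open>1 / (k + 1)\<close>. This is the
  origin of the scale \<open>m\<close>; with \<open>0 < d < 1\<close> the resulting errors are
  summable. A second obstacle is that the step condition may hold with equality. Testing minimality
  against the previous iterate then leaves no decrease; the midpoint of the two iterates is tested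
  instead.\<close>

lemma psd_form_null:
  fixes s :: "'a::real_vector \<Rightarrow> 'a \<Rightarrow> real"
  assumes bil: "bilinear s" and sym: "\<And>x y. s x y = s y x"
    and V: "subspace V" and psd: "\<And>v. v \<in> V \<Longrightarrow> 0 \<le> s v v"
    and u: "u \<in> V" "s u u = 0" and v: "v \<in> V"
  shows "s u v = 0"
proof (rule ccontr)
  assume ne: "s u v \<noteq> 0"
  \<comment> \<open>As \<open>s u u = 0\<close>, the form at \<open>t *\<^sub>R u + v\<close> is
    affine in \<open>t\<close>; this choice makes its value -1.\<close>
  define t where "t = - (s v v + 1) / (2 * s u v)"
  have "0 \<le> s (t *\<^sub>R u + v) (t *\<^sub>R u + v)"
    using V u v by (intro psd) (simp add: subspace_add subspace_scale)
  also have "\<dots> = 2 * t * s u v + s v v"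
    using u(2) sym[of v u]
    by (simp add: bilinear_ladd[OF bil] bilinear_radd[OF bil] bilinear_lmul[OF bil] bilinear_rmul[OF bil])
  also have "\<dots> = -1"
    using ne by (simp add: t_def field_simps)
  finally show False by simp
qed

text \<open>Neither form need be definite. Where \<open>a + b\<close> is definite, a maximizer of
  the quotient \<open>a / (a + b)\<close> over the sphere can be split off, as in the spectral
  theorem; a null vector of \<open>a + b\<close> is null for both forms and can be split off at
  once. Orthogonality within the basis refers to the two forms, not to the inner product.\<close>

lemma simultaneous_diagonalization:
  fixes a b :: "'a::euclidean_space \<Rightarrow> 'a \<Rightarrow> real"
  assumes bil: "bilinear a" "bilinear b"
    and sym: "\<And>x y. a x y = a y x" "\<And>x y. b x y = b y x"
    and psd: "\<And>v. 0 \<le> a v v" "\<And>v. 0 \<le> b v v"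
    and V: "subspace V"
  shows "\<exists>B. finite B \<and> B \<subseteq> V \<and> V \<subseteq> span B \<and> 0 \<notin> B \<and>
    (\<forall>u\<in>B. \<forall>v\<in>B. u \<noteq> v \<longrightarrow> a u v = 0 \<and> b u v = 0)"
  using V
proof (induction "dim V" arbitrary: V rule: less_induct)
  case less
  note ladd = bilinear_ladd[OF bil(1)] bilinear_ladd[OF bil(2)]
    and radd = bilinear_radd[OF bil(1)] bilinear_radd[OF bil(2)]
    and lmul = bilinear_lmul[OF bil(1)] bilinear_lmul[OF bil(2)]
    and rmul = bilinear_rmul[OF bil(1)] bilinear_rmul[OF bil(2)]
    and rsub = bilinear_rsub[OF bil(1)] bilinear_rsub[OF bil(2)]
    and rzero = bilinear_rzero[OF bil(1)] bilinear_rzero[OF bil(2)]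
  have V: "subspace V" by fact
  define s where "s x y = a x y + b x y" for x y
  have sbil: "bilinear s"
    using bil unfolding bilinear_def s_def by (auto intro!: linear_compose_add)
  have split: ?case
    if u: "u \<in> V" "u \<noteq> 0" and W: "subspace W" "W \<subseteq> V" "u \<notin> W"
      and dec: "\<And>v. v \<in> V \<Longrightarrow> \<exists>t. v - t *\<^sub>R u \<in> W"
      and orth: "\<And>v. v \<in> W \<Longrightarrow> a u v = 0 \<and> b u v = 0" for u W
  proof -
    have "W \<subset> V" using W u by blast
    then have "dim W < dim V"
      using W(1) V by (metis dim_psubset span_eq_iff)
    from less(1)[OF this W(1)] obtain B where B: "finite B" "B \<subseteq> W" "W \<subseteq> span B" "0 \<notin> B"
      "\<forall>u\<in>B. \<forall>v\<in>B. u \<noteq> v \<longrightarrow> a u v = 0 \<and> b u v = 0" by blast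
    have "V \<subseteq> span (insert u B)"
    proof
      fix v assume "v \<in> V"
      then obtain t where "v - t *\<^sub>R u \<in> W" using dec by blast
      then show "v \<in> span (insert u B)"
        using B(3) by (auto simp: span_insert)
    qed
    moreover have "a v u = 0 \<and> b v u = 0" "a u v = 0 \<and> b u v = 0" if "v \<in> B" for v
      using orth[of v] that B(2) sym(1)[of v u] sym(2)[of v u] by auto
    ultimately show ?thesis
      using B u W by (intro exI[of _ "insert u B"]) auto
  qed
  show ?case
  proof (cases "\<exists>u\<in>V. u \<noteq> 0 \<and> s u u = 0")
    case True
    then obtain u where u: "u \<in> V" "u \<noteq> 0" "s u u = 0" by blast
    have "a u u = 0" "b u u = 0"
      using u(3) psd[of u] by (auto simp: s_def)
    then have null: "a u v = 0" "b u v = 0" for v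
      using psd_form_null[OF bil(1) sym(1) subspace_UNIV, of u v]
        psd_form_null[OF bil(2) sym(2) subspace_UNIV, of u v] psd by auto
    \<comment> \<open>A null vector is orthogonal to everything for both forms, so any complement
      would do; the Euclidean one is taken.\<close>
    let ?W = "V \<inter> {v. u \<bullet> v = 0}"
    show ?thesis
    proof (rule split[OF u(1,2), of ?W])
      show "subspace ?W"
        using V subspace_hyperplane[of u] by (simp add: subspace_inter)
      show "\<exists>t. v - t *\<^sub>R u \<in> ?W" if "v \<in> V" for v
        using that u V
        by (intro exI[of _ "(u \<bullet> v) / (u \<bullet> u)"])
           (auto simp: subspace_diff subspace_scale inner_diff_right)
    qed (use u null in auto)
  next
    case False
    then have spos: "s u u > 0" if "u \<in> V" "u \<noteq> 0" for u
      using that psd[of u] unfolding s_def by (metis add_nonneg_nonneg less_eq_real_def)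
    show ?thesis
    proof (cases "V = {0}")
      case True
      then show ?thesis by (intro exI[of _ "{}"]) auto
    next
      case False
      then obtain z where z: "z \<in> V" "z \<noteq> 0" using V subspace_0 by blast
      let ?S = "V \<inter> sphere 0 1"
      have "compact ?S"
        using closed_subspace[OF V] by (simp add: closed_Int_compact)
      moreover have "z /\<^sub>R norm z \<in> ?S"
        using z V by (auto simp: subspace_scale)
      moreover have "continuous_on ?S (\<lambda>u. a u u / s u u)"
      proof (intro continuous_on_divide)
        show "continuous_on ?S (\<lambda>u. a u u)"
          by (rule bilinear_continuous_on_compose[OF continuous_on_id continuous_on_id bil(1)])
        show "continuous_on ?S (\<lambda>u. s u u)"
          by (rule bilinear_continuous_on_compose[OF continuous_on_id continuous_on_id sbil])
        show "\<forall>u\<in>?S. s u u \<noteq> 0" using spos by force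
      qed
      ultimately obtain u where u: "u \<in> ?S" and umax: "\<And>v. v \<in> ?S \<Longrightarrow> a v v / s v v \<le> a u u / s u u"
        using continuous_attains_sup[of ?S "\<lambda>u. a u u / s u u"] by blast
      have uV: "u \<in> V" "u \<noteq> 0" using u by auto
      define m where "m = a u u / s u u"
      \<comment> \<open>By maximality \<open>h\<close> is nonnegative on \<open>V\<close>, and it
        vanishes at \<open>u\<close>; so \<open>h u\<close> vanishes on \<open>V\<close>, which is
        the eigenvector equation relative to \<open>s\<close>.\<close>
      define h where "h x y = m * s x y - a x y" for x y
      have hbil: "bilinear h"
        using sbil bil unfolding bilinear_def h_def
        by (auto intro!: linear_compose_sub linear_compose_scale_right[where 'b=real, simplified])
      have "h u u = 0" using spos[OF uV] by (simp add: h_def m_def)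
      moreover have "0 \<le> h v v" if v: "v \<in> V" for v
      proof (cases "v = 0")
        case True
        then show ?thesis by (simp add: h_def s_def rzero)
      next
        case False
        have "a (v /\<^sub>R norm v) (v /\<^sub>R norm v) / s (v /\<^sub>R norm v) (v /\<^sub>R norm v) \<le> m"
          unfolding m_def using v V False by (intro umax) (auto simp: subspace_scale)
        moreover have "a (v /\<^sub>R norm v) (v /\<^sub>R norm v) / s (v /\<^sub>R norm v) (v /\<^sub>R norm v) = a v v / s v v"
          using False by (simp add: s_def lmul rmul flip: distrib_left)
        ultimately show ?thesis
          using spos[OF v False] by (simp add: h_def divide_le_eq)
      qed
      ultimately have "h u v = 0" if "v \<in> V" for v
        using psd_form_null[OF hbil _ V, of u v] uV that sym by (auto simp: h_def s_def)
      then have eig: "a u v = m * s u v" if "v \<in> V" for v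
        using that by (simp add: h_def)
      let ?W = "V \<inter> {v. s u v = 0}"
      show ?thesis
      proof (rule split[OF uV, of ?W])
        show "subspace ?W"
          using V unfolding subspace_def by (auto simp: s_def radd rmul rzero algebra_simps)
             (metis distrib_left mult_zero_right)+
        show "\<exists>t. v - t *\<^sub>R u \<in> ?W" if "v \<in> V" for v
          using that uV V spos[OF uV]
          by (intro exI[of _ "s u v / s u u"])
             (auto simp: subspace_diff subspace_scale bilinear_rsub[OF sbil] bilinear_rmul[OF sbil])
        show "a u v = 0 \<and> b u v = 0" if "v \<in> ?W" for v
          using eig[of v] that by (auto simp: s_def)
      qed (use spos[OF uV] in auto)
    qed
  qed
qed

lemma diagonal_form_sum:
  fixes s :: "'a::euclidean_space \<Rightarrow> 'a \<Rightarrow> real"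
  assumes bil: "bilinear s" and fin: "finite B"
    and orth: "\<And>u v. u \<in> B \<Longrightarrow> v \<in> B \<Longrightarrow> u \<noteq> v \<Longrightarrow> s u v = 0"
  shows "s (\<Sum>u\<in>B. t u *\<^sub>R u) (\<Sum>u\<in>B. r u *\<^sub>R u) = (\<Sum>u\<in>B. t u * r u * s u u)"
proof -
  have "s (\<Sum>u\<in>B. t u *\<^sub>R u) (\<Sum>u\<in>B. r u *\<^sub>R u) = (\<Sum>(u, v)\<in>B \<times> B. s (t u *\<^sub>R u) (r v *\<^sub>R v))"
    by (rule bilinear_sum[OF bil])
  also have "\<dots> = (\<Sum>u\<in>B. \<Sum>v\<in>B. t u * r v * s u v)"
    by (simp add: sum.cartesian_product bilinear_lmul[OF bil] bilinear_rmul[OF bil] mult_ac)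
  also have "\<dots> = (\<Sum>u\<in>B. \<Sum>v\<in>B. if v = u then t u * r u * s u u else 0)"
    using orth by (intro sum.cong refl) auto
  finally show ?thesis
    using fin by simp
qed

section \<open>Rayleigh bound by the largest eigenvalue of the Gram matrix\<close>

lemma bilinear_sum_of_squares:
  fixes X :: "'i \<Rightarrow> 'a::euclidean_space"
  shows "bilinear (\<lambda>g h. \<Sum>i\<in>S. \<kappa> i * (X i \<bullet> g) * (X i \<bullet> h))"
  unfolding bilinear_def
  by (auto intro!: linearI simp: sum.distrib algebra_simps sum_distrib_left)

lemma bilinear_inner: "bilinear ((\<bullet>) :: 'a::euclidean_space \<Rightarrow> 'a \<Rightarrow> real)"
  unfolding bilinear_def by (auto intro!: linearI simp: inner_add_right inner_add_left)

text \<open>The eigenvalues are those of the Gram matrix, indexed by samples, while the bound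
  concerns a form on the parameter space. Both have the same nonzero eigenvalues: an eigenvector
  \<open>v\<close> goes to the combination of the \<open>X b\<close> with coefficients
  \<open>v b\<close>, and a basis vector \<open>u\<close> goes back to the family
  \<open>X a \<bullet> u\<close>. A nonzero column guarantees a positive eigenvalue.\<close>

lemma sum_squares_le_lambda_max:
  fixes X :: "'i \<Rightarrow> 'a::euclidean_space"
  assumes S: "finite S" and nz: "i \<in> S" "X i \<noteq> 0"
  shows "(\<Sum>i\<in>S. (X i \<bullet> h)\<^sup>2) \<le> lambda_max (\<lambda>a b. X a \<bullet> X b) S * (norm h)\<^sup>2"
proof -
  define A where "A g h = (\<Sum>i\<in>S. 1 * (X i \<bullet> g) * (X i \<bullet> h))" for g h
  have A_bil: "bilinear A"
    unfolding A_def by (rule bilinear_sum_of_squares)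
  have A_sym: "A g h = A h g" for g h
    by (simp add: A_def mult.commute)
  have A_psd: "0 \<le> A h h" for h
    by (simp add: A_def sum_nonneg)
  obtain B where B: "finite B" "UNIV \<subseteq> span B" "0 \<notin> B"
    and orth: "\<And>u v. u \<in> B \<Longrightarrow> v \<in> B \<Longrightarrow> u \<noteq> v \<Longrightarrow> A u v = 0 \<and> u \<bullet> v = 0"
    using simultaneous_diagonalization[OF A_bil bilinear_inner A_sym inner_commute A_psd inner_ge_zero subspace_UNIV]
    by metis
  have expand: "\<exists>t. h = (\<Sum>u\<in>B. t u *\<^sub>R u)" for h
    using B(2) span_finite[OF B(1)] by (auto simp: image_iff)
  define m where "m u = A u u / (u \<bullet> u)" for u
  have Auu: "A u u = m u * (u \<bullet> u)" if "u \<in> B" for u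
    using that B(3) by (auto simp: m_def)
  have eig: "A u h = m u * (u \<bullet> h)" if u: "u \<in> B" for u h
  proof -
    obtain t where h: "h = (\<Sum>u\<in>B. t u *\<^sub>R u)" using expand by blast
    have "A u h = (\<Sum>v\<in>B. t v * A u v)"
      by (simp add: h linear_sum[of "A u"] bilinear_rmul[OF A_bil] A_bil[unfolded bilinear_def])
    also have "\<dots> = (\<Sum>v\<in>B. t v * (m u * (u \<bullet> v)))"
      using orth[OF u] Auu by (intro sum.cong refl) (metis mult_zero_right)
    finally show ?thesis
      by (simp add: h inner_sum_right sum_distrib_left mult_ac)
  qed
  define Eg where "Eg = {\<mu>. \<exists>v. (\<exists>a\<in>S. v a \<noteq> 0) \<and> (\<forall>a\<in>S. (\<Sum>b\<in>S. (X a \<bullet> X b) * v b) = \<mu> * v a)}"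
  \<comment> \<open>Finiteness is what gives \<open>Max Eg\<close> a meaning.\<close>
  have "Eg \<subseteq> insert 0 (m ` B)"
  proof
    fix \<mu> assume "\<mu> \<in> Eg"
    then obtain v a where v: "a \<in> S" "v a \<noteq> 0" "\<And>a. a \<in> S \<Longrightarrow> (\<Sum>b\<in>S. (X a \<bullet> X b) * v b) = \<mu> * v a"
      unfolding Eg_def by blast
    define z where "z = (\<Sum>b\<in>S. v b *\<^sub>R X b)"
    have Xz: "X a \<bullet> z = \<mu> * v a" if "a \<in> S" for a
      using v(3)[OF that] by (simp add: z_def inner_sum_right mult.commute)
    have Az: "A g z = \<mu> * (g \<bullet> z)" for g
    proof -
      have "A g z = (\<Sum>i\<in>S. (X i \<bullet> g) * (\<mu> * v i))"
        by (simp add: A_def Xz)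
      then show ?thesis
        by (simp add: z_def inner_sum_right sum_distrib_left mult_ac inner_commute[of g])
    qed
    show "\<mu> \<in> insert 0 (m ` B)"
    proof (cases "\<mu> = 0")
      case False
      then have "z \<noteq> 0" using Xz[OF v(1)] v(2) by auto
      have "\<exists>u\<in>B. u \<bullet> z \<noteq> 0"
      proof (rule ccontr)
        assume "\<not> ?thesis"
        obtain t where t: "z = (\<Sum>u\<in>B. t u *\<^sub>R u)" using expand by blast
        have "z \<bullet> z = (\<Sum>u\<in>B. t u * (u \<bullet> z))"
          by (subst (1) t) (simp add: inner_sum_left)
        with \<open>\<not> (\<exists>u\<in>B. u \<bullet> z \<noteq> 0)\<close> have "z \<bullet> z = 0" by simp
        with \<open>z \<noteq> 0\<close> show False by simp
      qed
      then obtain u where u: "u \<in> B" "u \<bullet> z \<noteq> 0" by blast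
      then have "m u = \<mu>" using eig[OF u(1), of z] Az[of u] by simp
      then show ?thesis using u by blast
    qed simp
  qed
  then have fin: "finite Eg"
    using B(1) by (meson finite_imageI finite_insert finite_subset)
  have m_Eg: "m u \<in> Eg" if u: "u \<in> B" and mu: "m u \<noteq> 0" for u
  proof -
    have "\<exists>a\<in>S. X a \<bullet> u \<noteq> 0"
      by (rule ccontr) (use mu in \<open>simp add: m_def A_def\<close>)
    moreover have "(\<Sum>b\<in>S. (X a \<bullet> X b) * (X b \<bullet> u)) = m u * (X a \<bullet> u)" for a
      using eig[OF u, of "X a"] by (simp add: A_def inner_commute mult.commute)
    ultimately show ?thesis
      unfolding Eg_def mem_Collect_eq by (intro exI[of _ "\<lambda>a. X a \<bullet> u"]) simp
  qed
  have "\<exists>u\<in>B. m u \<noteq> 0"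
  proof (rule ccontr)
    assume "\<not> ?thesis"
    then have "A u u = 0" if "u \<in> B" for u using Auu[OF that] that by simp
    moreover obtain t where t: "X i = (\<Sum>u\<in>B. t u *\<^sub>R u)" using expand by blast
    ultimately have "A (X i) (X i) = 0"
      unfolding t using diagonal_form_sum[OF A_bil B(1), of t t] orth by simp
    then have "(X i \<bullet> X i) * (X i \<bullet> X i) = 0"
      unfolding A_def using S nz by (subst (asm) sum_nonneg_eq_0_iff) auto
    then show False using nz by simp
  qed
  then obtain u where u: "u \<in> B" "m u \<noteq> 0" by blast
  have m_nonneg: "0 \<le> m u" for u
    using A_psd by (simp add: m_def)
  \<comment> \<open>Zero need not be an eigenvalue of the Gram matrix, for instance with independent
    columns; a vanishing \<open>m v\<close> is compared with the positive eigenvalue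
    \<open>m u\<close> instead.\<close>
  have le: "m v \<le> Max Eg" if "v \<in> B" for v
  proof (cases "m v = 0")
    case True
    then show ?thesis using Max_ge[OF fin m_Eg[OF u]] m_nonneg[of u] by simp
  next
    case False
    then show ?thesis using Max_ge[OF fin m_Eg[OF that]] by simp
  qed
  obtain t where h: "h = (\<Sum>u\<in>B. t u *\<^sub>R u)" using expand by blast
  have "(\<Sum>i\<in>S. (X i \<bullet> h)\<^sup>2) = A h h"
    by (simp add: A_def power2_eq_square)
  also have "\<dots> = (\<Sum>u\<in>B. t u * t u * A u u)"
    using diagonal_form_sum[OF A_bil B(1)] orth h by simp
  also have "\<dots> \<le> (\<Sum>u\<in>B. t u * t u * (Max Eg * (u \<bullet> u)))"
    using le Auu by (intro sum_mono mult_left_mono) (auto intro: mult_right_mono)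
  also have "\<dots> = Max Eg * (h \<bullet> h)"
    using diagonal_form_sum[OF bilinear_inner B(1)] orth h by (simp add: sum_distrib_left mult_ac)
  finally show ?thesis
    by (simp add: lambda_max_def Eg_def power2_norm_eq_inner)
qed

section \<open>Rational functions near 0\<close>

text \<open>Germs at 0 from the right of rational functions without a pole there. With germs,
  closure under sums needs no bookkeeping of domains.\<close>

definition rational_near_0 :: "(real \<Rightarrow> real) \<Rightarrow> bool" where
  "rational_near_0 g \<longleftrightarrow>
     (\<exists>p q. poly q 0 \<noteq> 0 \<and> (\<forall>\<^sub>F \<mu> in at_right 0. g \<mu> = poly p \<mu> / poly q \<mu>))"

lemma eventually_poly_nz_at_right_0:
  fixes q :: "real poly"
  assumes "poly q 0 \<noteq> 0"
  shows "\<forall>\<^sub>F \<mu> in at_right 0. poly q \<mu> \<noteq> 0"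
proof -
  have "(poly q \<longlongrightarrow> poly q 0) (at_right 0)"
    by (intro tendsto_poly tendsto_ident_at)
  then show ?thesis
    using assms by (rule tendsto_imp_eventually_ne)
qed

lemma rational_near_0_poly: "rational_near_0 (poly p)"
  unfolding rational_near_0_def by (intro exI[of _ p] exI[of _ 1]) auto

lemma rational_near_0_quotient: "poly q 0 \<noteq> 0 \<Longrightarrow> rational_near_0 (\<lambda>\<mu>. poly p \<mu> / poly q \<mu>)"
  unfolding rational_near_0_def by (intro exI[of _ p] exI[of _ q]) auto

lemma rational_near_0_const: "rational_near_0 (\<lambda>_. c)"
proof -
  have "(\<lambda>_. c) = poly [:c:]" by auto
  then show ?thesis by (simp only: rational_near_0_poly)
qed

lemma rational_near_0_linear: "rational_near_0 (\<lambda>\<mu>. c * \<mu>)"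
proof -
  have "(\<lambda>\<mu>. c * \<mu>) = poly [:0, c:]" by auto
  then show ?thesis by (simp only: rational_near_0_poly)
qed

lemma rational_near_0_add:
  assumes "rational_near_0 f" "rational_near_0 g"
  shows "rational_near_0 (\<lambda>\<mu>. f \<mu> + g \<mu>)"
proof -
  obtain p q p' q' where *: "poly q 0 \<noteq> 0" "\<forall>\<^sub>F \<mu> in at_right 0. f \<mu> = poly p \<mu> / poly q \<mu>"
    "poly q' 0 \<noteq> 0" "\<forall>\<^sub>F \<mu> in at_right 0. g \<mu> = poly p' \<mu> / poly q' \<mu>"
    using assms unfolding rational_near_0_def by blast
  have "\<forall>\<^sub>F \<mu> in at_right 0. f \<mu> + g \<mu> = poly (p * q' + p' * q) \<mu> / poly (q * q') \<mu>"
    using *(2,4) eventually_poly_nz_at_right_0[OF *(1)] eventually_poly_nz_at_right_0[OF *(3)]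
    by eventually_elim (simp add: field_simps)
  then show ?thesis
    unfolding rational_near_0_def using * by (metis mult_eq_0_iff poly_mult)
qed

lemma rational_near_0_minus:
  assumes "rational_near_0 f"
  shows "rational_near_0 (\<lambda>\<mu>. - f \<mu>)"
proof -
  obtain p q where *: "poly q 0 \<noteq> 0" "\<forall>\<^sub>F \<mu> in at_right 0. f \<mu> = poly p \<mu> / poly q \<mu>"
    using assms unfolding rational_near_0_def by blast
  have "\<forall>\<^sub>F \<mu> in at_right 0. - f \<mu> = poly (- p) \<mu> / poly q \<mu>"
    using *(2) by eventually_elim simp
  then show ?thesis
    unfolding rational_near_0_def using * by blast
qed

lemma rational_near_0_diff:
  "rational_near_0 f \<Longrightarrow> rational_near_0 g \<Longrightarrow> rational_near_0 (\<lambda>\<mu>. f \<mu> - g \<mu>)"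
  using rational_near_0_add[of f "\<lambda>\<mu>. - g \<mu>"] rational_near_0_minus[of g] by simp

lemma rational_near_0_sum:
  assumes "finite B" "\<And>u. u \<in> B \<Longrightarrow> rational_near_0 (f u)"
  shows "rational_near_0 (\<lambda>\<mu>. \<Sum>u\<in>B. f u \<mu>)"
  using assms by (induction rule: finite_induct) (auto intro: rational_near_0_const rational_near_0_add)

lemma rational_near_0_convergent:
  assumes "rational_near_0 f"
  shows "\<exists>l. (f \<longlongrightarrow> l) (at_right 0)"
proof -
  obtain p q where *: "poly q 0 \<noteq> 0" "\<forall>\<^sub>F \<mu> in at_right 0. f \<mu> = poly p \<mu> / poly q \<mu>"
    using assms unfolding rational_near_0_def by blast
  have "((\<lambda>\<mu>. poly p \<mu> / poly q \<mu>) \<longlongrightarrow> poly p 0 / poly q 0) (at_right 0)"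
    using * by (intro tendsto_divide tendsto_poly tendsto_ident_at)
  then have "(f \<longlongrightarrow> poly p 0 / poly q 0) (at_right 0)"
    using *(2) by (subst tendsto_cong)
  then show ?thesis by blast
qed

section \<open>Relative variation of rational germs\<close>

lemma poly_bounded_on_unit:
  fixes p :: "real poly"
  shows "\<exists>C\<ge>0. \<forall>x\<in>{0..1}. \<bar>poly p x\<bar> \<le> C"
proof -
  have "compact (poly p ` {0..1})"
    by (intro compact_continuous_image continuous_intros) auto
  then obtain C where "\<forall>y\<in>poly p ` {0..1}. \<bar>y\<bar> \<le> C"
    using compact_imp_bounded bounded_real by metis
  then show ?thesis
    by (intro exI[of _ "max C 0"]) force
qed

lemma poly_lipschitz_on_unit:
  fixes p :: "real poly"
  shows "\<exists>C\<ge>0. \<forall>x\<in>{0..1}. \<forall>y\<in>{0..1}. \<bar>poly p x - poly p y\<bar> \<le> C * \<bar>x - y\<bar>"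
proof (induction p)
  case 0
  then show ?case by (intro exI[of _ 0]) simp
next
  case (pCons a p)
  obtain C where C: "C \<ge> 0" "\<forall>x\<in>{0..1}. \<forall>y\<in>{0..1}. \<bar>poly p x - poly p y\<bar> \<le> C * \<bar>x - y\<bar>"
    using pCons.IH by blast
  obtain K where K: "K \<ge> 0" "\<forall>x\<in>{0..1}. \<bar>poly p x\<bar> \<le> K"
    using poly_bounded_on_unit by blast
  have "\<bar>poly (pCons a p) x - poly (pCons a p) y\<bar> \<le> (C + K) * \<bar>x - y\<bar>"
    if x: "x \<in> {0..1}" and y: "y \<in> {0..1}" for x y
  proof -
    have "poly (pCons a p) x - poly (pCons a p) y = x * (poly p x - poly p y) + poly p y * (x - y)"
      by (simp add: algebra_simps)
    also have "\<bar>\<dots>\<bar> \<le> \<bar>x\<bar> * \<bar>poly p x - poly p y\<bar> + \<bar>poly p y\<bar> * \<bar>x - y\<bar>"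
      by (metis abs_mult abs_triangle_ineq)
    also have "\<dots> \<le> 1 * (C * \<bar>x - y\<bar>) + K * \<bar>x - y\<bar>"
      using x y C K by (intro add_mono mult_mono) auto
    finally show ?thesis by (simp add: algebra_simps)
  qed
  then show ?case
    using C K by (intro exI[of _ "C + K"]) auto
qed

lemma power_diff_le_relative:
  fixes x y :: real
  assumes "0 < y" "y \<le> x"
  shows "x ^ j - y ^ j \<le> real j * x ^ j * ((x - y) / x)"
proof (induction j)
  case (Suc j)
  have "x ^ Suc j - y ^ Suc j = x * (x ^ j - y ^ j) + y ^ j * (x - y)"
    by (simp add: algebra_simps)
  also have "\<dots> \<le> x * (real j * x ^ j * ((x - y) / x)) + x ^ j * (x - y)"
    using Suc assms by (intro add_mono mult_left_mono mult_right_mono power_mono) auto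
  also have "\<dots> = real (Suc j) * x ^ Suc j * ((x - y) / x)"
    using assms by (simp add: field_simps)
  finally show ?case .
qed simp

text \<open>The first bound compares the relative change of \<open>g\<close> with that of
  \<open>\<mu>\<close>. The second trades half a power of \<open>g\<close> for half a power of
  \<open>\<mu>\<close>: the drift of a gap of size \<open>\<bar>g\<bar>\<close> will be divided by
  \<open>sqrt \<bar>g\<bar>\<close>, and the quotient has to be summable. The range down to
  \<open>\<mu> / 2\<close> covers one update of the parameter.\<close>

definition relative_variation :: "real \<Rightarrow> (real \<Rightarrow> real) \<Rightarrow> real \<Rightarrow> bool" where
  "relative_variation C g \<mu> \<longleftrightarrow> (\<forall>\<mu>'. \<mu> / 2 \<le> \<mu>' \<and> \<mu>' \<le> \<mu> \<longrightarrow>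
     \<bar>g \<mu> - g \<mu>'\<bar> \<le> C * ((\<mu> - \<mu>') / \<mu>) * \<bar>g \<mu>\<bar> \<and>
     \<bar>g \<mu> - g \<mu>'\<bar> \<le> C * ((\<mu> - \<mu>') / sqrt \<mu>) * sqrt \<bar>g \<mu>\<bar>)"

lemma relative_variation_mono:
  assumes "relative_variation C g \<mu>" "C \<le> C'" "0 < \<mu>"
  shows "relative_variation C' g \<mu>"
  unfolding relative_variation_def
proof (intro allI impI)
  fix \<mu>' assume *: "\<mu> / 2 \<le> \<mu>' \<and> \<mu>' \<le> \<mu>"
  have "C * ((\<mu> - \<mu>') / \<mu>) * \<bar>g \<mu>\<bar> \<le> C' * ((\<mu> - \<mu>') / \<mu>) * \<bar>g \<mu>\<bar>"
    "C * ((\<mu> - \<mu>') / sqrt \<mu>) * sqrt \<bar>g \<mu>\<bar> \<le> C' * ((\<mu> - \<mu>') / sqrt \<mu>) * sqrt \<bar>g \<mu>\<bar>"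
    by (intro mult_right_mono; use * assms in simp)+
  with * assms(1) show "\<bar>g \<mu> - g \<mu>'\<bar> \<le> C' * ((\<mu> - \<mu>') / \<mu>) * \<bar>g \<mu>\<bar> \<and>
     \<bar>g \<mu> - g \<mu>'\<bar> \<le> C' * ((\<mu> - \<mu>') / sqrt \<mu>) * sqrt \<bar>g \<mu>\<bar>"
    unfolding relative_variation_def by (meson order_trans)
qed

text \<open>Near 0 a nonzero rational function behaves like \<open>h \<mu> ^ j\<close> with \<open>j \<ge> 0\<close> and \<open>h \<noteq> 0\<close>,
  so its relative variation is at most a multiple of the relative variation of \<open>\<mu>\<close>.\<close>

lemma rational_near_0_relative_variation:
  assumes "rational_near_0 g"
  obtains C where "C \<ge> 0"
    "\<forall>\<^sub>F \<mu> in at_right 0. relative_variation C g \<mu>"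
proof -
  obtain p q where q: "poly q 0 \<noteq> 0" and pq: "\<forall>\<^sub>F \<mu> in at_right 0. g \<mu> = poly p \<mu> / poly q \<mu>"
    using assms unfolding rational_near_0_def by blast
  obtain b where b: "b > 0" "\<And>\<mu>. 0 < \<mu> \<Longrightarrow> \<mu> < b \<Longrightarrow> g \<mu> = poly p \<mu> / poly q \<mu>"
    using pq unfolding eventually_at_right_field by auto
  show thesis
  proof (cases "p = 0")
    \<comment> \<open>A germ that vanishes identically has no order at 0 and satisfies both bounds
      trivially.\<close>
    case True
    have "\<forall>\<^sub>F \<mu> in at_right 0. 0 < \<mu> \<and> \<mu> < b"
      using b(1) by (auto simp: eventually_at_right_field)
    then have "\<forall>\<^sub>F \<mu> in at_right 0. relative_variation 0 g \<mu>"
      by eventually_elim (simp add: b(2) True relative_variation_def)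
    then show thesis
      using that[of 0] by simp
  next
    case False
    obtain r where r: "p = [:- 0, 1:] ^ order 0 p * r" "\<not> [:- 0, 1:] dvd r"
      using order_decomp[OF False] by blast
    define j where "j = order 0 p"
    have r0: "poly r 0 \<noteq> 0"
      using r(2) poly_eq_0_iff_dvd[of r 0] by simp
    have pj: "poly p \<mu> = \<mu> ^ j * poly r \<mu>" for \<mu>
      using arg_cong[OF r(1), of "\<lambda>p. poly p \<mu>"] by (simp add: j_def)
    define h0 where "h0 = \<bar>poly r 0 / poly q 0\<bar> / 2"
    have h0: "h0 > 0" using r0 q by (simp add: h0_def)
    have lim: "((\<lambda>\<mu>. \<bar>poly r \<mu> / poly q \<mu>\<bar>) \<longlongrightarrow> 2 * h0) (at_right 0)"
      unfolding h0_def using q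
      by (auto intro!: tendsto_eq_intros)
    have "\<forall>\<^sub>F \<mu> in at_right 0. h0 < \<bar>poly r \<mu> / poly q \<mu>\<bar> \<and> \<bar>poly r \<mu> / poly q \<mu>\<bar> < 4 * h0"
      using order_tendstoD[OF lim, of h0] order_tendstoD(2)[OF lim, of "4 * h0"] h0
      by (auto intro: eventually_conj)
    moreover have "\<forall>\<^sub>F \<mu> in at_right 0. \<bar>poly q 0\<bar> / 2 < \<bar>poly q \<mu>\<bar>"
      using q by (intro order_tendstoD(1)[of _ "\<bar>poly q 0\<bar>"]) (auto intro!: tendsto_intros)
    ultimately have "\<forall>\<^sub>F \<mu> in at_right 0. h0 < \<bar>poly r \<mu> / poly q \<mu>\<bar> \<and> \<bar>poly r \<mu> / poly q \<mu>\<bar> < 4 * h0 \<and>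
        \<bar>poly q 0\<bar> / 2 < \<bar>poly q \<mu>\<bar>"
      by eventually_elim auto
    then obtain b' where b': "b' > 0" "\<And>\<mu>. 0 < \<mu> \<Longrightarrow> \<mu> < b' \<Longrightarrow> h0 < \<bar>poly r \<mu> / poly q \<mu>\<bar> \<and>
         \<bar>poly r \<mu> / poly q \<mu>\<bar> < 4 * h0 \<and> \<bar>poly q 0\<bar> / 2 < \<bar>poly q \<mu>\<bar>"
      unfolding eventually_at_right_field by auto
    define h where "h \<mu> = poly r \<mu> / poly q \<mu>" for \<mu>
    obtain Cr where Cr: "Cr \<ge> 0" "\<forall>x\<in>{0..1}. \<forall>y\<in>{0..1}. \<bar>poly r x - poly r y\<bar> \<le> Cr * \<bar>x - y\<bar>"
      using poly_lipschitz_on_unit by blast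
    obtain Cq where Cq: "Cq \<ge> 0" "\<forall>x\<in>{0..1}. \<forall>y\<in>{0..1}. \<bar>poly q x - poly q y\<bar> \<le> Cq * \<bar>x - y\<bar>"
      using poly_lipschitz_on_unit by blast
    define q0 where "q0 = \<bar>poly q 0\<bar> / 2"
    have q0: "q0 > 0" using q by (simp add: q0_def)
    define Lh where "Lh = Cr / q0 + 4 * h0 * Cq / q0"
    have Lh: "Lh \<ge> 0" unfolding Lh_def using Cr Cq h0 q0 by auto
    define b'' where "b'' = min b (min b' 1)"
    have b'': "b'' > 0" using b b' by (simp add: b''_def)
    have h_lip: "\<bar>h x - h y\<bar> \<le> Lh * \<bar>x - y\<bar>" if "0 < x" "x < b''" "0 < y" "y < b''" for x y
    proof -
      have qx: "q0 < \<bar>poly q x\<bar>" "\<bar>h y\<bar> < 4 * h0" "poly q y \<noteq> 0"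
        using b'(2)[of x] b'(2)[of y] that q0 by (auto simp: b''_def q0_def h_def)
      have "h x - h y = ((poly r x - poly r y) - h y * (poly q x - poly q y)) / poly q x"
        using qx q0 by (auto simp: h_def field_simps)
      also have "\<bar>\<dots>\<bar> \<le> (Cr * \<bar>x - y\<bar> + 4 * h0 * (Cq * \<bar>x - y\<bar>)) / q0"
        unfolding abs_divide
      proof (rule frac_le)
        have "\<bar>poly r x - poly r y - h y * (poly q x - poly q y)\<bar>
            \<le> \<bar>poly r x - poly r y\<bar> + \<bar>h y\<bar> * \<bar>poly q x - poly q y\<bar>"
          by (metis abs_mult abs_triangle_ineq4)
        also have "\<dots> \<le> Cr * \<bar>x - y\<bar> + 4 * h0 * (Cq * \<bar>x - y\<bar>)"
          using Cr Cq that qx by (intro add_mono mult_mono) (auto simp: b''_def)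
        finally show "\<bar>poly r x - poly r y - h y * (poly q x - poly q y)\<bar>
          \<le> Cr * \<bar>x - y\<bar> + 4 * h0 * (Cq * \<bar>x - y\<bar>)" .
      qed (use q0 qx Cr Cq h0 in auto)
      finally show ?thesis by (simp add: Lh_def field_simps add_divide_distrib)
    qed
    \<comment> \<open>\<open>C1\<close> serves the first bound. For the second, \<open>C\<close>
      must also dominate \<open>Lh / sqrt h0\<close>, for \<open>j = 0\<close>, and
      \<open>C1 * sqrt (4 * h0)\<close>, for \<open>j > 0\<close>.\<close>
    define C1 where "C1 = 4 * real j + Lh / h0"
    define C where "C = C1 * (1 + sqrt (4 * h0)) + Lh / sqrt h0"
    have C1: "C1 \<ge> 0" unfolding C1_def using Lh h0 by simp
    have C: "C \<ge> 0" "C1 \<le> C" "C1 * sqrt (4 * h0) \<le> C" "Lh / sqrt h0 \<le> C"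
      unfolding C_def using C1 Lh h0 by (auto simp: algebra_simps)
    have main: "\<bar>g \<mu> - g \<mu>'\<bar> \<le> C * ((\<mu> - \<mu>') / \<mu>) * \<bar>g \<mu>\<bar> \<and>
       \<bar>g \<mu> - g \<mu>'\<bar> \<le> C * ((\<mu> - \<mu>') / sqrt \<mu>) * sqrt \<bar>g \<mu>\<bar>"
      if \<mu>: "0 < \<mu>" "\<mu> < b''" "\<mu> / 2 \<le> \<mu>'" "\<mu>' \<le> \<mu>" for \<mu> \<mu>'
    proof -
      have hb: "h0 < \<bar>h \<mu>\<bar>" "\<bar>h \<mu>\<bar> < 4 * h0"
        using b'(2)[of \<mu>] \<mu> by (auto simp: b''_def h_def)
      have g: "g \<mu> = \<mu> ^ j * h \<mu>" "g \<mu>' = \<mu>' ^ j * h \<mu>'"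
        using b(2)[of \<mu>] b(2)[of \<mu>'] \<mu> by (auto simp: b''_def h_def pj)
      have "g \<mu> - g \<mu>' = (\<mu> ^ j - \<mu>' ^ j) * h \<mu> + \<mu>' ^ j * (h \<mu> - h \<mu>')"
        by (simp add: g algebra_simps)
      also have "\<bar>\<dots>\<bar> \<le> \<bar>\<mu> ^ j - \<mu>' ^ j\<bar> * \<bar>h \<mu>\<bar> + \<mu>' ^ j * \<bar>h \<mu> - h \<mu>'\<bar>"
        by (rule order_trans[OF abs_triangle_ineq]) (use \<mu> in \<open>simp add: abs_mult\<close>)
      also have "\<dots> \<le> (real j * \<mu> ^ j * ((\<mu> - \<mu>') / \<mu>)) * \<bar>h \<mu>\<bar> + \<mu> ^ j * (Lh * (\<mu> - \<mu>'))"
      proof (intro add_mono mult_mono)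
        have "\<mu>' ^ j \<le> \<mu> ^ j" using \<mu> by (intro power_mono) auto
        then show "\<bar>\<mu> ^ j - \<mu>' ^ j\<bar> \<le> real j * \<mu> ^ j * ((\<mu> - \<mu>') / \<mu>)"
          using power_diff_le_relative[of \<mu>' \<mu> j] \<mu> by simp
        show "\<bar>h \<mu> - h \<mu>'\<bar> \<le> Lh * (\<mu> - \<mu>')"
          using h_lip[of \<mu> \<mu>'] \<mu> by simp
      qed (use \<mu> Lh in \<open>auto intro: power_mono\<close>)
      finally have d: "\<bar>g \<mu> - g \<mu>'\<bar> \<le> (real j * \<mu> ^ j * ((\<mu> - \<mu>') / \<mu>)) * \<bar>h \<mu>\<bar> + \<mu> ^ j * (Lh * (\<mu> - \<mu>'))" .
      have gabs: "\<bar>g \<mu>\<bar> = \<mu> ^ j * \<bar>h \<mu>\<bar>" using \<mu> by (simp add: g abs_mult)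
      have \<mu>1: "\<mu> < 1" using \<mu> by (simp add: b''_def)
      have "\<mu> ^ j * (Lh * (\<mu> - \<mu>')) \<le> \<mu> ^ j * (Lh * ((\<mu> - \<mu>') / \<mu>) * (\<bar>h \<mu>\<bar> / h0))"
      proof (intro mult_left_mono)
        have "(\<mu> - \<mu>') * 1 \<le> ((\<mu> - \<mu>') / \<mu>) * (\<bar>h \<mu>\<bar> / h0)"
        proof (intro mult_mono)
          show "\<mu> - \<mu>' \<le> (\<mu> - \<mu>') / \<mu>"
            using \<mu> \<mu>1 mult_left_le[of \<mu> "\<mu> - \<mu>'"] by (simp add: pos_le_divide_eq)
        qed (use \<mu> hb h0 in auto)
        from mult_left_mono[OF this Lh] show "Lh * (\<mu> - \<mu>') \<le> Lh * ((\<mu> - \<mu>') / \<mu>) * (\<bar>h \<mu>\<bar> / h0)"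
          by (simp add: mult_ac)
      qed (use \<mu> in auto)
      moreover have "real j * \<mu> ^ j * r * \<bar>h \<mu>\<bar> + \<mu> ^ j * (Lh * r * (\<bar>h \<mu>\<bar> / h0))
          = (real j + Lh / h0) * r * (\<mu> ^ j * \<bar>h \<mu>\<bar>)" for r
        by (simp add: algebra_simps)
      ultimately have "\<bar>g \<mu> - g \<mu>'\<bar> \<le> (real j + Lh / h0) * ((\<mu> - \<mu>') / \<mu>) * \<bar>g \<mu>\<bar>"
        unfolding gabs using d by (smt (verit))
      also have "\<dots> \<le> C1 * ((\<mu> - \<mu>') / \<mu>) * \<bar>g \<mu>\<bar>"
        unfolding C1_def using \<mu> by (intro mult_right_mono) auto
      finally have 1: "\<bar>g \<mu> - g \<mu>'\<bar> \<le> C1 * ((\<mu> - \<mu>') / \<mu>) * \<bar>g \<mu>\<bar>" .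
      also have "\<dots> \<le> C * ((\<mu> - \<mu>') / \<mu>) * \<bar>g \<mu>\<bar>"
        using C \<mu> by (intro mult_right_mono) auto
      finally have first: "\<bar>g \<mu> - g \<mu>'\<bar> \<le> C * ((\<mu> - \<mu>') / \<mu>) * \<bar>g \<mu>\<bar>" .
      have "\<bar>g \<mu> - g \<mu>'\<bar> \<le> C * ((\<mu> - \<mu>') / sqrt \<mu>) * sqrt \<bar>g \<mu>\<bar>"
      \<comment> \<open>For \<open>j = 0\<close> the modulus of \<open>g\<close> stays above
        \<open>h0\<close> and the Lipschitz bound of \<open>h\<close> suffices. For
        \<open>j > 0\<close> it is at most \<open>\<mu> * (4 * h0)\<close>, so one factor
        \<open>sqrt \<bar>g \<mu>\<bar>\<close> can be replaced by a multiple of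
        \<open>sqrt \<mu>\<close>.\<close>
      proof (cases "j = 0")
        case True
        have "\<bar>g \<mu> - g \<mu>'\<bar> \<le> Lh * (\<mu> - \<mu>')" using d True by simp
        also have "\<dots> \<le> (Lh / sqrt h0) * ((\<mu> - \<mu>') / sqrt \<mu>) * sqrt \<bar>g \<mu>\<bar>"
        proof -
          have "(\<mu> - \<mu>') * 1 \<le> ((\<mu> - \<mu>') / sqrt \<mu>) * (sqrt \<bar>g \<mu>\<bar> / sqrt h0)"
          proof (intro mult_mono)
            show "\<mu> - \<mu>' \<le> (\<mu> - \<mu>') / sqrt \<mu>"
              using \<mu> \<mu>1 mult_left_le[of "sqrt \<mu>" "\<mu> - \<mu>'"] by (simp add: pos_le_divide_eq)
            show "1 \<le> sqrt \<bar>g \<mu>\<bar> / sqrt h0"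
              using True hb h0 by (simp add: gabs)
          qed (use \<mu> in auto)
          from mult_left_mono[OF this Lh] show ?thesis by (simp add: mult_ac)
        qed
        also have "\<dots> \<le> C * ((\<mu> - \<mu>') / sqrt \<mu>) * sqrt \<bar>g \<mu>\<bar>"
          using C \<mu> by (intro mult_right_mono) auto
        finally show ?thesis .
      next
        case False
        have "\<mu> ^ j \<le> \<mu> ^ 1"
          using False \<mu> \<mu>1 by (intro power_decreasing) auto
        then have "\<bar>g \<mu>\<bar> \<le> \<mu> * (4 * h0)"
          unfolding gabs using hb \<mu> by (intro mult_mono) auto
        then have "sqrt \<bar>g \<mu>\<bar> \<le> sqrt \<mu> * sqrt (4 * h0)"
          by (metis real_sqrt_le_iff real_sqrt_mult)
        then have "\<bar>g \<mu>\<bar> \<le> (sqrt \<mu> * sqrt (4 * h0)) * sqrt \<bar>g \<mu>\<bar>"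
          by (metis abs_ge_zero mult_right_mono real_sqrt_ge_zero real_sqrt_mult_self abs_of_nonneg)
        then have "C1 * ((\<mu> - \<mu>') / \<mu>) * \<bar>g \<mu>\<bar> \<le> C1 * ((\<mu> - \<mu>') / \<mu>) * ((sqrt \<mu> * sqrt (4 * h0)) * sqrt \<bar>g \<mu>\<bar>)"
          using C1 \<mu> by (intro mult_left_mono) auto
        also have "\<dots> = (C1 * sqrt (4 * h0)) * ((\<mu> - \<mu>') * (sqrt \<mu> / \<mu>)) * sqrt \<bar>g \<mu>\<bar>"
          by (simp add: mult_ac)
        also have "sqrt \<mu> / \<mu> = 1 / sqrt \<mu>"
          using \<mu> by (simp add: field_simps)
        also have "(C1 * sqrt (4 * h0)) * ((\<mu> - \<mu>') * (1 / sqrt \<mu>)) * sqrt \<bar>g \<mu>\<bar> \<le> C * ((\<mu> - \<mu>') * (1 / sqrt \<mu>)) * sqrt \<bar>g \<mu>\<bar>"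
          using C \<mu> by (intro mult_right_mono) auto
        finally show ?thesis using 1 by simp
      qed
      with first show ?thesis by blast
    qed
    have "\<forall>\<^sub>F \<mu> in at_right 0. 0 < \<mu> \<and> \<mu> < b''"
      using b'' by (auto simp: eventually_at_right_field)
    then have "\<forall>\<^sub>F \<mu> in at_right 0. relative_variation C g \<mu>"
      by eventually_elim (use main in \<open>auto simp: relative_variation_def\<close>)
    then show thesis
      using that C by blast
  qed
qed

section \<open>Finite length of descent sequences with moving critical values\<close>

text \<open>If gaps are bounded by squared gradients, the desingularizing function is the square
  root. It is made odd, since the gap to a moving critical value may turn negative, and flattened at
  scale \<open>m\<close>: the slope \<open>1 / (2 * sqrt (\<bar>e\<bar> + m\<^sup>2))\<close> never
  exceeds \<open>1 / (2 * m)\<close>, so an error of order \<open>m\<^sup>2 / a\<close> costs only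
  \<open>m / a\<close>.\<close>

definition kl_rate :: "real \<Rightarrow> real \<Rightarrow> real" where
  "kl_rate m e = sgn e * (sqrt (\<bar>e\<bar> + m\<^sup>2) - m)"

lemma kl_rate_nonneg_eq: "0 \<le> m \<Longrightarrow> 0 \<le> e \<Longrightarrow> kl_rate m e = sqrt (e + m\<^sup>2) - m"
  by (cases "e = 0") (auto simp: kl_rate_def)

lemma kl_rate_minus: "kl_rate m (- e) = - kl_rate m e"
  by (simp add: kl_rate_def sgn_minus)

lemma sqrt_diff_bounds:
  fixes x y G Y :: real
  assumes "0 < G" "G \<le> x" "x \<le> y" "y \<le> Y"
  shows "sqrt y - sqrt x \<le> (y - x) / (2 * sqrt G)" "(y - x) / (2 * sqrt Y) \<le> sqrt y - sqrt x"
proof -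
  have pos: "sqrt x > 0" "sqrt y > 0" using assms by auto
  have "(sqrt y - sqrt x) * (sqrt x + sqrt y) = y - x"
    using assms by (simp add: algebra_simps)
  then have eq: "sqrt y - sqrt x = (y - x) / (sqrt x + sqrt y)"
    using pos by (intro eq_divide_imp) auto
  have "2 * sqrt G \<le> sqrt x + sqrt y" "sqrt x + sqrt y \<le> 2 * sqrt Y"
    using real_sqrt_le_mono[OF assms(2)] real_sqrt_le_mono[OF assms(3)]
      real_sqrt_le_mono[OF assms(4)] by linarith+
  then show "sqrt y - sqrt x \<le> (y - x) / (2 * sqrt G)" "(y - x) / (2 * sqrt Y) \<le> sqrt y - sqrt x"
    unfolding eq using assms pos by (auto intro!: divide_left_mono mult_pos_pos add_pos_pos)
qed

text \<open>Mean value estimates: the slope decreases with the distance from 0, so over the interval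
  it is bounded above in terms of \<open>G\<close> and below in terms of \<open>Y\<close>. An
  interval around 0 forces \<open>G = 0\<close> and is cut at 0.\<close>

lemma kl_rate_diff_bounds:
  assumes m: "0 < m" and G: "0 \<le> G" and le: "e \<le> e'" and Y: "\<bar>e\<bar> \<le> Y" "\<bar>e'\<bar> \<le> Y"
    and away: "\<And>\<xi>. e \<le> \<xi> \<Longrightarrow> \<xi> \<le> e' \<Longrightarrow> G \<le> \<bar>\<xi>\<bar>"
  shows "kl_rate m e' - kl_rate m e \<le> (e' - e) / (2 * sqrt (G + m\<^sup>2))"
    and "(e' - e) / (2 * sqrt (Y + m\<^sup>2)) \<le> kl_rate m e' - kl_rate m e"
proof -
  have m2: "0 < m\<^sup>2" using m by simp
  have pos: "kl_rate m e' - kl_rate m e \<le> (e' - e) / (2 * sqrt (G + m\<^sup>2)) \<and>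
      (e' - e) / (2 * sqrt (Y + m\<^sup>2)) \<le> kl_rate m e' - kl_rate m e"
    if "0 \<le> e" "e \<le> e'" "G \<le> e" "e' \<le> Y" for e e'
    using that sqrt_diff_bounds[of "G + m\<^sup>2" "e + m\<^sup>2" "e' + m\<^sup>2" "Y + m\<^sup>2"] G m m2
    by (auto simp: kl_rate_nonneg_eq)
  have "kl_rate m e' - kl_rate m e \<le> (e' - e) / (2 * sqrt (G + m\<^sup>2)) \<and>
      (e' - e) / (2 * sqrt (Y + m\<^sup>2)) \<le> kl_rate m e' - kl_rate m e"
  proof -
    consider "0 \<le> e" | "e' \<le> 0" | "e < 0" "0 < e'" by linarith
    then show ?thesis
    proof cases
      case 1
      then show ?thesis using pos[of e e'] le Y away[of e] by auto
    next
      case 2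
      then show ?thesis using pos[of "- e'" "- e"] le Y away[of e'] by (auto simp: kl_rate_minus)
    next
      case 3
      then have "G = 0" using away[of 0] G by auto
      then have "kl_rate m e' - kl_rate m 0 \<le> (e' - 0) / (2 * sqrt (G + m\<^sup>2))"
        "(e' - 0) / (2 * sqrt (Y + m\<^sup>2)) \<le> kl_rate m e' - kl_rate m 0"
        "kl_rate m (- e) - kl_rate m 0 \<le> (- e - 0) / (2 * sqrt (G + m\<^sup>2))"
        "(- e - 0) / (2 * sqrt (Y + m\<^sup>2)) \<le> kl_rate m (- e) - kl_rate m 0"
        using pos[of 0 e'] pos[of 0 "- e"] 3 Y by auto
      moreover have "kl_rate m 0 = 0" by (simp add: kl_rate_def)
      ultimately show ?thesis by (simp add: kl_rate_minus diff_divide_distrib)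
    qed
  qed
  then show "kl_rate m e' - kl_rate m e \<le> (e' - e) / (2 * sqrt (G + m\<^sup>2))"
    and "(e' - e) / (2 * sqrt (Y + m\<^sup>2)) \<le> kl_rate m e' - kl_rate m e" by auto
qed

lemma kl_rate_mono:
  assumes "0 < m" "e \<le> e'"
  shows "kl_rate m e \<le> kl_rate m e'"
proof -
  have "0 \<le> (e' - e) / (2 * sqrt (max \<bar>e\<bar> \<bar>e'\<bar> + m\<^sup>2))"
    using assms by (intro divide_nonneg_nonneg) auto
  also have "\<dots> \<le> kl_rate m e' - kl_rate m e"
    by (rule kl_rate_diff_bounds(2)[of m 0]) (use assms in auto)
  finally show ?thesis by simp
qed

lemma kl_rate_lipschitz:
  assumes "0 < m" "0 \<le> \<eta>"
  shows "kl_rate m (e + \<eta>) \<le> kl_rate m e + \<eta> / (2 * m)"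
  using kl_rate_diff_bounds(1)[of m 0 e "e + \<eta>" "max \<bar>e\<bar> \<bar>e + \<eta>\<bar>"] assms by auto

lemma abs_kl_rate_le: "0 \<le> m \<Longrightarrow> \<bar>kl_rate m e\<bar> \<le> sqrt \<bar>e\<bar>"
proof -
  assume m: "0 \<le> m"
  have "m \<le> sqrt (\<bar>e\<bar> + m\<^sup>2)" by (rule real_le_rsqrt) simp
  moreover have "sqrt (\<bar>e\<bar> + m\<^sup>2) \<le> sqrt \<bar>e\<bar> + m"
    using sqrt_add_le_add_sqrt[of "\<bar>e\<bar>" "m\<^sup>2"] m by simp
  ultimately show ?thesis
    by (cases "e = 0") (auto simp: kl_rate_def abs_mult)
qed

lemma kl_rate_diff_scale:
  assumes "0 \<le> m'" "m' \<le> m"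
  shows "\<bar>kl_rate m' e - kl_rate m e\<bar> \<le> m - m'"
proof -
  have "sqrt (\<bar>e\<bar> + m'\<^sup>2) \<le> sqrt (\<bar>e\<bar> + m\<^sup>2)"
    using assms by (simp add: power_mono)
  moreover have "sqrt (\<bar>e\<bar> + m\<^sup>2) \<le> sqrt (\<bar>e\<bar> + m'\<^sup>2) + (m - m')"
  proof (rule real_le_lsqrt)
    have "m' \<le> sqrt (\<bar>e\<bar> + m'\<^sup>2)" by (rule real_le_rsqrt) simp
    then have "2 * m' * (m - m') \<le> 2 * sqrt (\<bar>e\<bar> + m'\<^sup>2) * (m - m')"
      using assms by (intro mult_right_mono) auto
    then show "\<bar>e\<bar> + m\<^sup>2 \<le> (sqrt (\<bar>e\<bar> + m'\<^sup>2) + (m - m'))\<^sup>2"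
      by (simp add: power2_sum power2_diff algebra_simps power2_eq_square)
  qed (use assms in auto)
  ultimately show ?thesis
    using assms by (cases "e = 0") (auto simp: kl_rate_def sgn_if)
qed

text \<open>\<open>e0\<close> and \<open>e1\<close> are the gaps before and after a step,
  \<open>em\<close> the gap after the move but before the change of the smoothing parameter. Half of
  the decrease survives that change. It happens at gaps of order at most \<open>u\<^sup>2\<close>,
  where the slope is at least of order \<open>1 / (u + m)\<close>; the gain is thus of order
  \<open>u\<^sup>2 / (u + m) / a\<close>, that is \<open>u / a\<close> up to an error
  \<open>m / a\<close>.\<close>

lemma kl_rate_step_matching:
  assumes a: "0 < a0" "a0 \<le> a" and m: "0 < m" and u: "0 \<le> u"
    and const: "0 \<le> C" "0 < \<delta>" "0 \<le> C2"
    and em: "\<bar>em\<bar> \<le> C * u\<^sup>2"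
    and e0: "em + \<delta> * u\<^sup>2 / a \<le> e0"
    and e1: "e1 \<le> em + \<delta> * u\<^sup>2 / a / 2 + C2 * m\<^sup>2 / a"
  defines "q \<equiv> sqrt (C + \<delta> / a0) + 1"
  shows "kl_rate m e1 - kl_rate m e0 \<le> - (\<delta> / (4 * q)) * (u / a) + (\<delta> / (4 * q) + C2 / 2) * (m / a)"
proof -
  define Dd where "Dd = \<delta> * u\<^sup>2 / a"
  define A where "A = C + \<delta> / a0"
  have A: "0 \<le> A" using const a by (simp add: A_def)
  have q: "1 \<le> q" unfolding q_def using A by (simp add: A_def)
  have Dd: "0 \<le> Dd" using const a by (simp add: Dd_def)
  have "Dd \<le> \<delta> * u\<^sup>2 / a0"
    unfolding Dd_def using a const by (intro divide_left_mono) auto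
  then have Y: "\<bar>em\<bar> + Dd \<le> A * u\<^sup>2"
    using em by (simp add: A_def algebra_simps)
  have "kl_rate m e1 \<le> kl_rate m (em + Dd / 2 + C2 * m\<^sup>2 / a)"
    using e1 m by (intro kl_rate_mono) (auto simp: Dd_def)
  also have "\<dots> \<le> kl_rate m (em + Dd / 2) + (C2 * m\<^sup>2 / a) / (2 * m)"
    using m a const by (intro kl_rate_lipschitz) auto
  finally have 1: "kl_rate m e1 \<le> kl_rate m (em + Dd / 2) + C2 / 2 * (m / a)"
    using m by (simp add: power2_eq_square)
  have 2: "kl_rate m (em + Dd) \<le> kl_rate m e0"
    using e0 m by (intro kl_rate_mono) (auto simp: Dd_def)
  have 3: "(em + Dd - (em + Dd / 2)) / (2 * sqrt (A * u\<^sup>2 + m\<^sup>2)) \<le> kl_rate m (em + Dd) - kl_rate m (em + Dd / 2)"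
    using Dd Y m by (intro kl_rate_diff_bounds(2)[of m 0]) auto
  have "sqrt (A * u\<^sup>2 + m\<^sup>2) \<le> sqrt (A * u\<^sup>2) + sqrt (m\<^sup>2)"
    using A by (intro sqrt_add_le_add_sqrt) auto
  also have "\<dots> = sqrt A * u + m"
    using u m by (simp add: real_sqrt_mult)
  also have "\<dots> \<le> q * (u + m)"
    using u m A by (simp add: q_def A_def algebra_simps)
  finally have s: "sqrt (A * u\<^sup>2 + m\<^sup>2) \<le> q * (u + m)" .
  have "0 < sqrt (A * u\<^sup>2 + m\<^sup>2)"
    using A m by (simp add: add_nonneg_pos)
  then have 4: "Dd / 2 / (2 * (q * (u + m))) \<le> (em + Dd - (em + Dd / 2)) / (2 * sqrt (A * u\<^sup>2 + m\<^sup>2))"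
    using s Dd u m q by (simp add: frac_le)
  \<comment> \<open>This linearizes the gain without a case distinction on which of \<open>u\<close>
    and \<open>m\<close> is larger.\<close>
  have "(u - m) * (u + m) \<le> u\<^sup>2"
    by (simp add: algebra_simps power2_eq_square)
  then have "u - m \<le> u\<^sup>2 / (u + m)"
    using u m by (simp add: pos_le_divide_eq)
  then have "(\<delta> / (4 * q * a)) * (u - m) \<le> (\<delta> / (4 * q * a)) * (u\<^sup>2 / (u + m))"
    using const q a by (intro mult_left_mono) auto
  also have "\<dots> = Dd / 2 / (2 * (q * (u + m)))"
    by (simp add: Dd_def mult_ac)
  finally have "(\<delta> / (4 * q * a)) * (u - m) \<le> kl_rate m (em + Dd) - kl_rate m (em + Dd / 2)"
    using 3 4 by linarith
  moreover have "(\<delta> / (4 * q * a)) * (u - m) = (\<delta> / (4 * q)) * (u / a) - (\<delta> / (4 * q)) * (m / a)"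
    by (simp add: right_diff_distrib diff_divide_distrib)
  ultimately show ?thesis
    using 1 2 unfolding distrib_right by linarith
qed

lemma kl_rate_step_near:
  assumes "0 < a" "0 < m" "0 \<le> C2" and e: "e1 \<le> e0 + C2 * m\<^sup>2 / a"
  shows "kl_rate m e1 - kl_rate m e0 \<le> C2 / 2 * (m / a)"
proof -
  have "kl_rate m e1 \<le> kl_rate m (e0 + C2 * m\<^sup>2 / a)"
    using assms by (intro kl_rate_mono) auto
  also have "\<dots> \<le> kl_rate m e0 + (C2 * m\<^sup>2 / a) / (2 * m)"
    using assms by (intro kl_rate_lipschitz) auto
  finally show ?thesis
    using assms by (simp add: power2_eq_square)
qed

text \<open>While the gap increases by \<open>h\<close>, it stays at distance at least
  \<open>G / 4\<close> from 0, so the slope is at most \<open>1 / sqrt G\<close>, whatever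
  \<open>m\<close> is.\<close>

lemma kl_rate_step_far:
  assumes "0 < a" "0 < m" "0 \<le> C2" "0 < G" "0 \<le> h" "0 \<le> Dd"
    and em: "G / 2 \<le> \<bar>em\<bar>" and Dd: "Dd \<le> G / 8" and h: "h \<le> G / 8"
    and e0: "em + Dd \<le> e0" and e1: "e1 \<le> em + Dd / 2 + h + C2 * m\<^sup>2 / a"
  shows "kl_rate m e1 - kl_rate m e0 \<le> C2 / 2 * (m / a) + h / sqrt G"
proof -
  have 1: "kl_rate m e1 - kl_rate m (em + Dd / 2 + h) \<le> C2 / 2 * (m / a)"
    using assms by (intro kl_rate_step_near) auto
  have "kl_rate m (em + Dd / 2 + h) - kl_rate m (em + Dd / 2)
      \<le> (em + Dd / 2 + h - (em + Dd / 2)) / (2 * sqrt (G / 4 + m\<^sup>2))"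
    using assms by (intro kl_rate_diff_bounds(1)[of _ _ _ _ "max \<bar>em + Dd / 2\<bar> \<bar>em + Dd / 2 + h\<bar>"]) auto
  also have "\<dots> \<le> h / (2 * sqrt (G / 4))"
    using assms by (auto intro!: divide_left_mono mult_pos_pos add_pos_nonneg)
  also have "\<dots> = h / sqrt G"
    by (simp add: real_sqrt_divide)
  finally have 2: "kl_rate m (em + Dd / 2 + h) - kl_rate m (em + Dd / 2) \<le> h / sqrt G" .
  have "kl_rate m (em + Dd / 2) \<le> kl_rate m e0"
    using assms by (intro kl_rate_mono) auto
  with 1 2 show ?thesis by linarith
qed

lemma summable_of_descent:
  fixes \<Phi> x t :: "nat \<Rightarrow> real"
  assumes x: "\<And>k. 0 \<le> x k" and \<kappa>: "0 < \<kappa>"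
    and desc: "\<forall>\<^sub>F k in sequentially. \<Phi> (Suc k) \<le> \<Phi> k - \<kappa> * x k + t k"
    and t: "summable t" and lower: "\<And>k. B \<le> \<Phi> k"
  shows "summable x"
proof -
  obtain N where N: "\<And>k. k \<ge> N \<Longrightarrow> \<Phi> (Suc k) \<le> \<Phi> k - \<kappa> * x k + t k"
    using desc unfolding eventually_sequentially by blast
  have sum_le: "\<kappa> * (\<Sum>k<n. x (k + N)) \<le> \<Phi> N - \<Phi> (n + N) + (\<Sum>k<n. t (k + N))" for n
  proof (induction n)
    case (Suc n)
    then show ?case using N[of "n + N"] by (simp add: algebra_simps)
  qed simp
  have "summable (\<lambda>k. t (k + N))" using t by (simp add: summable_iff_shift)
  then have "convergent (\<lambda>n. \<Sum>k<n. t (k + N))"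
    by (rule summable_iff_convergent[THEN iffD1])
  then obtain T where T: "\<And>n. \<bar>\<Sum>k<n. t (k + N)\<bar> \<le> T"
    using convergent_imp_Bseq by (metis BseqE real_norm_def)
  have "(\<Sum>k\<le>n. norm (x (k + N))) \<le> (\<Phi> N - B + T) / \<kappa>" for n
  proof -
    have "\<kappa> * (\<Sum>k\<le>n. x (k + N)) \<le> \<Phi> N - B + T"
      using sum_le[of "Suc n"] lower[of "Suc n + N"] T[of "Suc n"]
      unfolding lessThan_Suc_atMost by linarith
    then show ?thesis
      using \<kappa> x by (simp add: pos_le_divide_eq mult.commute)
  qed
  then have "summable (\<lambda>k. norm (x (k + N)))"
    by (rule bounded_imp_summable[rotated]) auto
  then show ?thesis
    using x by (simp add: summable_iff_shift)
qed

lemma rational_near_0_relative_variation_family: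
  assumes "finite F" "\<And>i. i \<in> F \<Longrightarrow> rational_near_0 (g i)"
  shows "\<exists>C\<ge>0. \<forall>\<^sub>F \<mu> in at_right 0. \<forall>i\<in>F. relative_variation C (g i) \<mu>"
  using assms
proof (induction rule: finite_induct)
  case empty
  then show ?case by auto
next
  case (insert i F)
  obtain C where C: "C \<ge> 0" "\<forall>\<^sub>F \<mu> in at_right 0. \<forall>i\<in>F. relative_variation C (g i) \<mu>"
    using insert.IH insert.prems by blast
  obtain C' where C': "C' \<ge> 0" "\<forall>\<^sub>F \<mu> in at_right 0. relative_variation C' (g i) \<mu>"
    using rational_near_0_relative_variation[of "g i"] insert.prems by blast
  have pos: "\<forall>\<^sub>F \<mu> in at_right (0::real). 0 < \<mu>"
    by (auto simp: eventually_at_right_field intro: exI[of _ 1])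
  have "\<forall>\<^sub>F \<mu> in at_right 0. \<forall>i\<in>insert i F. relative_variation (max C C') (g i) \<mu>"
    using C(2) C'(2) pos by eventually_elim (auto intro: relative_variation_mono[of C] relative_variation_mono[of C'])
  then show ?case using C by (intro exI[of _ "max C C'"]) auto
qed

text \<open>Here \<open>g\<close> is the difference between the matching critical value and the
  tracked one, taken with the sign that turns the matching gap into the tracked gap, and
  \<open>h\<close> bounds its drift. If \<open>\<bar>g\<bar>\<close> is at most a multiple of
  \<open>u\<^sup>2\<close>, the first relative bound hides \<open>h\<close> in the remaining half of
  the decrease. Otherwise \<open>\<bar>g\<bar>\<close> dominates the matching gap and the decrease,
  the tracked gap is far from 0, and the slope \<open>1 / sqrt \<bar>g\<bar>\<close> is cancelled by
  the second relative bound.\<close>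

lemma kl_rate_change_of_index:
  assumes a: "0 < a0" "a0 \<le> a" and m: "0 < m" and u: "0 \<le> u"
    and const: "0 \<le> C" "0 < \<delta>" "0 \<le> C2" "0 \<le> CG" and \<mu>: "0 < \<mu>"
    and \<Gamma>: "\<Gamma> = 2 * C + 8 * \<delta> / a0"
    and em: "\<bar>em\<bar> \<le> C * u\<^sup>2"
    and e0: "em + g + \<delta> * u\<^sup>2 / a \<le> e0"
    and e1: "e1 \<le> em + g + \<delta> * u\<^sup>2 / a / 2 + C2 * m\<^sup>2 / a + h"
    and h: "0 \<le> h" "h \<le> CG * m * \<bar>g\<bar>" "h \<le> CG * (m * sqrt \<mu>) * sqrt \<bar>g\<bar>"
    and small: "CG * m \<le> 1 / 8" "CG * \<Gamma> * (m * a) \<le> \<delta> / 2"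
  shows "kl_rate m e1 - kl_rate m e0 \<le> C2 / 2 * (m / a) + CG * (m * sqrt \<mu>)"
proof (cases "\<bar>g\<bar> \<le> \<Gamma> * u\<^sup>2")
  case True
  have "h \<le> CG * m * (\<Gamma> * u\<^sup>2)"
    using h True const m by (meson less_imp_le mult_left_mono mult_nonneg_nonneg order_trans)
  also have "\<dots> = (CG * \<Gamma> * (m * a)) * (u\<^sup>2 / a)"
    using a by simp
  also have "\<dots> \<le> \<delta> / 2 * (u\<^sup>2 / a)"
    using small a by (intro mult_right_mono) auto
  finally have "e1 \<le> e0 + C2 * m\<^sup>2 / a"
    using e0 e1 by (simp add: field_simps)
  then have "kl_rate m e1 - kl_rate m e0 \<le> C2 / 2 * (m / a)"
    using a m const by (intro kl_rate_step_near) auto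
  then show ?thesis
    using const m \<mu> by (smt (verit) mult_nonneg_nonneg real_sqrt_ge_zero)
next
  case False
  have \<Gamma>0: "0 \<le> \<Gamma>" using \<Gamma> const a by simp
  have "0 \<le> \<Gamma> * u\<^sup>2" using \<Gamma>0 by simp
  with False have g: "0 < \<bar>g\<bar>" by linarith
  \<comment> \<open>The two summands of \<open>\<Gamma>\<close> are made for
    \<open>kl_rate_step_far\<close>: they give a matching gap of at most
    \<open>\<bar>g\<bar> / 2\<close> and a decrease of at most
    \<open>\<bar>g\<bar> / 8\<close>.\<close>
  have "\<delta> * u\<^sup>2 / a \<le> \<delta> * u\<^sup>2 / a0"
    using a const by (intro divide_left_mono) auto
  moreover have \<Gamma>u: "\<Gamma> * u\<^sup>2 = 2 * (C * u\<^sup>2) + 8 * (\<delta> * u\<^sup>2 / a0)"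
    by (simp add: \<Gamma> algebra_simps)
  moreover have "0 \<le> C * u\<^sup>2" "0 \<le> \<delta> * u\<^sup>2 / a0" using const a by auto
  ultimately have Dd: "\<delta> * u\<^sup>2 / a \<le> \<bar>g\<bar> / 8" and Cu: "C * u\<^sup>2 \<le> \<bar>g\<bar> / 2"
    using False by linarith+
  have "h \<le> (1 / 8) * \<bar>g\<bar>"
    using h(2) mult_right_mono[OF small(1), of "\<bar>g\<bar>"] by linarith
  moreover have "\<bar>g\<bar> / 2 \<le> \<bar>em + g\<bar>"
    using em Cu by linarith
  ultimately have "kl_rate m e1 - kl_rate m e0 \<le> C2 / 2 * (m / a) + h / sqrt \<bar>g\<bar>"
    using a m const g h Dd Cu em e0 e1
    by (intro kl_rate_step_far[of _ _ _ _ _ "\<delta> * u\<^sup>2 / a" "em + g"]) auto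
  moreover have "h / sqrt \<bar>g\<bar> \<le> CG * (m * sqrt \<mu>)"
    using h(3) g by (simp add: pos_divide_le_eq)
  ultimately show ?thesis by linarith
qed

text \<open>The step lengths are \<open>x k\<close>, and \<open>a k * x k\<close> is of the size of the gradient. The Lyapunov
  function is a multiple of \<open>D\<close> plus the sum of \<open>kl_rate (m k) (D k - c j (\<mu> k))\<close> over \<open>j\<close>; the
  terms whose critical value does not match the current piece are controlled by the relative
  variation of the differences of the critical values.\<close>

lemma finite_length:
  fixes D Mid x a \<mu> m :: "nat \<Rightarrow> real" and c :: "'j \<Rightarrow> real \<Rightarrow> real"
  assumes J: "finite J" and rat: "\<And>j. j \<in> J \<Longrightarrow> rational_near_0 (c j)"
    and a0: "0 < a0" "\<And>k. a0 \<le> a k" and a\<mu>: "\<And>k. a k * \<mu> k = \<Theta>"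
    and \<mu>: "\<And>k. 0 < \<mu> k" "\<And>k. \<mu> (Suc k) \<le> \<mu> k" "\<And>k. \<mu> k / 2 \<le> \<mu> (Suc k)" "\<mu> \<longlonglongrightarrow> 0"
    and m: "\<And>k. 0 < m k" "\<And>k. m (Suc k) \<le> m k" "\<And>k. \<mu> k - \<mu> (Suc k) \<le> m k * \<mu> k"
      "summable (\<lambda>k. m k / a k)" "summable (\<lambda>k. m k * sqrt (\<mu> k))" "(\<lambda>k. m k * a k) \<longlonglongrightarrow> 0"
    and x: "\<And>k. 0 \<le> x k" and D: "\<And>k. 0 \<le> D k" "\<And>k. D (Suc k) \<le> Mid k"
    and \<delta>: "0 < \<delta>" and desc: "\<forall>\<^sub>F k in sequentially. Mid k \<le> D k - \<delta> * (a k * x k)\<^sup>2 / a k"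
    and \<epsilon>: "0 < \<epsilon>" and C: "0 \<le> C"
    and KL: "\<forall>\<^sub>F k in sequentially. \<epsilon> \<le> a k * x k \<or>
      (\<exists>j\<in>J. \<bar>Mid k - c j (\<mu> k)\<bar> \<le> C * (a k * x k)\<^sup>2 \<and>
        D (Suc k) - Mid k - (c j (\<mu> (Suc k)) - c j (\<mu> k))
          \<le> C * (a k * x k * (\<mu> k - \<mu> (Suc k)) + (\<mu> k - \<mu> (Suc k))\<^sup>2 / \<mu> k))"
  shows "summable x"
proof -
  have apos: "0 < a k" for k using a0 less_le_trans by blast
  have \<Theta>: "0 < \<Theta>" using a\<mu>[of 0] apos[of 0] \<mu>(1)[of 0] by (metis mult_pos_pos)
  have \<mu>_filter: "filterlim \<mu> (at_right 0) sequentially"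
    using \<mu> by (intro tendsto_imp_filterlim_at_right) auto
  \<comment> \<open>Since the drop of \<open>\<mu>\<close> is at most \<open>m * \<mu>\<close> and
    \<open>\<mu> = \<Theta> / a\<close>, the perturbation in \<open>KL\<close> is at most
    \<open>(K * u * m + K * m\<^sup>2) / a\<close>. Young's inequality absorbs its first term into
    half of the decrease, at a cost that is part of \<open>C2\<close>.\<close>
  define K where "K = C * \<Theta>"
  define C2 where "C2 = K\<^sup>2 / (2 * \<delta>) + K"
  have K: "0 \<le> K" using C \<Theta> by (simp add: K_def)
  have C2: "0 \<le> C2" using K \<delta> by (simp add: C2_def)
  define \<Gamma> where "\<Gamma> = 2 * C + 8 * \<delta> / a0"
  define q where "q = sqrt (C + \<delta> / a0) + 1"
  have q: "1 \<le> q" using C \<delta> a0 by (simp add: q_def)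
  have ma: "m k \<le> m k * a k / a0" for k
    using m(1)[of k] a0(2)[of k] a0(1) by (simp add: field_simps)
  have m0: "m \<longlonglongrightarrow> 0"
  proof (rule tendsto_sandwich[where f = "\<lambda>_. 0"])
    show "(\<lambda>k. m k * a k / a0) \<longlonglongrightarrow> 0"
      using tendsto_divide[OF m(6) tendsto_const[of a0]] a0 by simp
  qed (use ma m(1) in \<open>auto simp: less_imp_le\<close>)
  obtain CG where CG: "CG \<ge> 0" "\<forall>\<^sub>F \<mu> in at_right 0. \<forall>p\<in>J \<times> J.
      relative_variation CG (\<lambda>\<mu>. c (fst p) \<mu> - c (snd p) \<mu>) \<mu>"
  proof -
    have rat': "rational_near_0 (\<lambda>\<mu>. c (fst p) \<mu> - c (snd p) \<mu>)" if "p \<in> J \<times> J" for p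
      using that rat by (intro rational_near_0_diff) auto
    note family = rational_near_0_relative_variation_family[where F = "J \<times> J"
        and g = "\<lambda>p \<mu>. c (fst p) \<mu> - c (snd p) \<mu>", OF finite_cartesian_product[OF J J]]
    show thesis
      by (rule exE[OF family], erule rat', elim conjE, rule that)
  qed
  obtain CB where CB: "CB \<ge> 0" "\<forall>\<^sub>F \<mu> in at_right 0. \<forall>i\<in>J. relative_variation CB (c i) \<mu>"
    by (rule exE[OF rational_near_0_relative_variation_family[where g = c, OF J]], erule rat, elim conjE, rule that)
  have "\<exists>B. \<forall>k. \<bar>c i (\<mu> k)\<bar> \<le> B" if i: "i \<in> J" for i
  proof -
    obtain l where "(c i \<longlongrightarrow> l) (at_right 0)"
      using rational_near_0_convergent[OF rat[OF i]] by blast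
    then have "(\<lambda>k. c i (\<mu> k)) \<longlonglongrightarrow> l"
      by (rule filterlim_compose[OF _ \<mu>_filter])
    then have "Bseq (\<lambda>k. c i (\<mu> k))"
      using convergentI convergent_imp_Bseq by blast
    then show ?thesis by (metis BseqE real_norm_def)
  qed
  then obtain Bf where Bf: "\<And>i k. i \<in> J \<Longrightarrow> \<bar>c i (\<mu> k)\<bar> \<le> Bf i" by metis
  define B where "B = (\<Sum>i\<in>J. \<bar>Bf i\<bar>)"
  have B: "\<bar>c i (\<mu> k)\<bar> \<le> B" if "i \<in> J" for i k
    using Bf[OF that, of k] member_le_sum[of i J "\<lambda>i. \<bar>Bf i\<bar>"] that J by (auto simp: B_def)
  have B0: "0 \<le> B" by (simp add: B_def sum_nonneg)
  define s where "s k = (\<delta> / (4 * q) + C2) * (m k / a k) + CG * (m k * sqrt (\<mu> k))" for k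
  have s0: "0 \<le> s k" for k
    unfolding s_def using \<delta> q C2 CG m(1)[of k] apos[of k] \<mu>(1)[of k]
    by (intro add_nonneg_nonneg mult_nonneg_nonneg divide_nonneg_nonneg) auto
  define \<kappa> where "\<kappa> = min 1 (\<delta> / (4 * q))"
  have \<kappa>: "0 < \<kappa>" "\<kappa> \<le> 1" "\<kappa> \<le> \<delta> / (4 * q)" using \<delta> q by (auto simp: \<kappa>_def)
  \<comment> \<open>For \<open>u \<ge> \<epsilon>\<close> the decrease
    \<open>\<delta> * u\<^sup>2 / a\<close> is at least \<open>\<epsilon> * \<delta> * x\<close>;
    the weight \<open>W\<close> scales it to at least \<open>x\<close>.\<close>
  define W where "W = 1 / (\<epsilon> * \<delta>)"
  have W: "0 < W" using \<epsilon> \<delta> by (simp add: W_def)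
  define \<psi> where "\<psi> i k = kl_rate (m k) (D k - c i (\<mu> k))" for i k
  \<comment> \<open>The new gap at the old scale; passing to the new scale costs
    \<open>m k - m (Suc k)\<close>, which telescopes.\<close>
  define \<psi>' where "\<psi>' i k = kl_rate (m k) (D (Suc k) - c i (\<mu> (Suc k)))" for i k
  have \<psi>\<psi>': "\<psi> i (Suc k) \<le> \<psi>' i k + (m k - m (Suc k))" for i k
    using kl_rate_diff_scale[of "m (Suc k)" "m k" "D (Suc k) - c i (\<mu> (Suc k))"] m(1)[of "Suc k"] m(2)[of k]
    by (auto simp: \<psi>_def \<psi>'_def)
  define \<Phi> where "\<Phi> k = W * D k + (\<Sum>i\<in>J. \<psi> i k)" for k
  define t where "t k = card J * s k + card J * (m k - m (Suc k))" for k
  have ev_small: "\<forall>\<^sub>F k in sequentially. CG * m k < 1 / 8"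
    "\<forall>\<^sub>F k in sequentially. CG * \<Gamma> * (m k * a k) < \<delta> / 2"
    "\<forall>\<^sub>F k in sequentially. CB * B * (m k * a k) < \<delta> * \<epsilon>\<^sup>2"
    using order_tendstoD(2)[OF tendsto_mult_right_zero[OF m0, of CG], of "1/8"]
      order_tendstoD(2)[OF tendsto_mult_right_zero[OF m(6), of "CG * \<Gamma>"], of "\<delta> / 2"]
      order_tendstoD(2)[OF tendsto_mult_right_zero[OF m(6), of "CB * B"], of "\<delta> * \<epsilon>\<^sup>2"]
      \<delta> \<epsilon> by auto
  have rel: "(\<mu> k - \<mu> (Suc k)) / \<mu> k \<le> m k" "(\<mu> k - \<mu> (Suc k)) / sqrt (\<mu> k) \<le> m k * sqrt (\<mu> k)" for k
  proof -
    show "(\<mu> k - \<mu> (Suc k)) / \<mu> k \<le> m k"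
      using m(3)[of k] \<mu>(1)[of k] by (simp add: pos_divide_le_eq)
    have "\<mu> k - \<mu> (Suc k) \<le> m k * sqrt (\<mu> k) * sqrt (\<mu> k)"
      using m(3)[of k] \<mu>(1)[of k] by (simp add: mult.assoc)
    then show "(\<mu> k - \<mu> (Suc k)) / sqrt (\<mu> k) \<le> m k * sqrt (\<mu> k)"
      using \<mu>(1)[of k] by (simp add: pos_divide_le_eq)
  qed
  have "\<forall>\<^sub>F k in sequentially. \<Phi> (Suc k) \<le> \<Phi> k - \<kappa> * x k + t k"
    using desc KL ev_small
      eventually_compose_filterlim[OF CG(2) \<mu>_filter] eventually_compose_filterlim[OF CB(2) \<mu>_filter]
  proof eventually_elim
    case (elim k)
    define u where "u = a k * x k"
    define \<Delta> where "\<Delta> = \<mu> k - \<mu> (Suc k)"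
    have u: "0 \<le> u" using apos[of k] x[of k] by (simp add: u_def)
    have xu: "x k = u / a k" using apos[of k] by (simp add: u_def)
    have \<Delta>: "0 \<le> \<Delta>" "\<Delta> \<le> m k * \<mu> k" using \<mu>(2)[of k] m(3)[of k] by (auto simp: \<Delta>_def)
    have \<mu>a: "\<mu> k = \<Theta> / a k" using a\<mu>[of k] apos[of k] by (simp add: field_simps)
    have descD: "Mid k \<le> D k - \<delta> * u\<^sup>2 / a k" using elim(1) by (simp add: u_def)
    have Dle: "D (Suc k) \<le> D k - \<delta> * u\<^sup>2 / a k" using descD D(2)[of k] by linarith
    have main: "(W * (D (Suc k) - D k) \<le> - x k \<and> (\<forall>i\<in>J. \<psi>' i k - \<psi> i k \<le> s k)) \<or>
      (\<exists>j\<in>J. \<psi>' j k - \<psi> j k \<le> s k - \<kappa> * x k \<and> (\<forall>i\<in>J. \<psi>' i k - \<psi> i k \<le> s k))"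
    proof (cases "\<epsilon> \<le> u")
      case True
      have "\<epsilon> * u \<le> u * u" using True u by (intro mult_right_mono)
      then have "\<epsilon> * \<delta> * x k \<le> \<delta> * u\<^sup>2 / a k"
        using \<delta> apos[of k] by (simp add: xu power2_eq_square divide_right_mono mult.left_commute mult_left_mono)
      then have "\<epsilon> * \<delta> * x k \<le> D k - D (Suc k)" using Dle by linarith
      then have "W * (D (Suc k) - D k) \<le> - x k"
        using \<epsilon> \<delta> by (simp add: W_def field_simps)
      \<comment> \<open>With a large gradient the drift of every critical value is at most the
        decrease, so no gap grows.\<close>
      moreover have "\<psi>' i k - \<psi> i k \<le> s k" if i: "i \<in> J" for i
      proof -
        have "\<bar>c i (\<mu> k) - c i (\<mu> (Suc k))\<bar> \<le> CB * ((\<mu> k - \<mu> (Suc k)) / \<mu> k) * \<bar>c i (\<mu> k)\<bar>"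
          using elim(7) i \<mu>(2,3)[of k] unfolding relative_variation_def by blast
        also have "\<dots> \<le> CB * m k * B"
          using CB rel[of k] B[OF i, of k] m(1)[of k] \<Delta> \<mu>(1)[of k]
          by (intro mult_mono) (auto simp: \<Delta>_def)
        also have "\<dots> \<le> \<delta> * \<epsilon>\<^sup>2 / a k"
          using elim(5) apos[of k] by (simp add: pos_le_divide_eq mult_ac)
        also have "\<dots> \<le> \<delta> * u\<^sup>2 / a k"
          using True \<epsilon> \<delta> apos[of k] by (intro divide_right_mono mult_left_mono power_mono) auto
        finally have "D (Suc k) - c i (\<mu> (Suc k)) \<le> D k - c i (\<mu> k)"
          using Dle by linarith
        then have "\<psi>' i k \<le> \<psi> i k"
          unfolding \<psi>_def \<psi>'_def using m(1) by (intro kl_rate_mono) auto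
        then show ?thesis using s0[of k] by linarith
      qed
      ultimately show ?thesis by blast
    next
      case False
      then obtain j where j: "j \<in> J" "\<bar>Mid k - c j (\<mu> k)\<bar> \<le> C * u\<^sup>2"
        "D (Suc k) - Mid k - (c j (\<mu> (Suc k)) - c j (\<mu> k)) \<le> C * (u * \<Delta> + \<Delta>\<^sup>2 / \<mu> k)"
        using elim(2) by (auto simp: u_def \<Delta>_def)
      have "\<Delta>\<^sup>2 / \<mu> k \<le> (m k * \<mu> k)\<^sup>2 / \<mu> k"
        using \<Delta> \<mu>(1)[of k] by (intro divide_right_mono power_mono) auto
      also have "\<dots> = (m k)\<^sup>2 * \<mu> k"
        using \<mu>(1)[of k] by (simp add: power2_eq_square)
      finally have "u * \<Delta> + \<Delta>\<^sup>2 / \<mu> k \<le> u * (m k * \<mu> k) + (m k)\<^sup>2 * \<mu> k"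
        using \<Delta> u by (intro add_mono mult_left_mono)
      from mult_left_mono[OF this C]
      have "C * (u * \<Delta> + \<Delta>\<^sup>2 / \<mu> k) \<le> (K * u * m k + K * (m k)\<^sup>2) / a k"
        by (simp add: K_def \<mu>a algebra_simps add_divide_distrib)
      also have "\<dots> \<le> (\<delta> * u\<^sup>2 / 2 + C2 * (m k)\<^sup>2) / a k"
      proof (intro divide_right_mono)
        have "0 \<le> (\<delta> * u - K * m k)\<^sup>2 / (2 * \<delta>)"
          using \<delta> by simp
        also have "\<dots> = \<delta> * u\<^sup>2 / 2 - K * u * m k + K\<^sup>2 / (2 * \<delta>) * (m k)\<^sup>2"
          using \<delta> by (simp add: power2_eq_square field_simps)
        finally show "K * u * m k + K * (m k)\<^sup>2 \<le> \<delta> * u\<^sup>2 / 2 + C2 * (m k)\<^sup>2"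
          by (simp add: C2_def algebra_simps)
      qed (use apos[of k] in simp)
      finally have br: "D (Suc k) - Mid k - (c j (\<mu> (Suc k)) - c j (\<mu> k))
          \<le> \<delta> * u\<^sup>2 / a k / 2 + C2 * (m k)\<^sup>2 / a k"
        using j(3) by (simp add: add_divide_distrib)
      have "\<psi>' j k - \<psi> j k \<le> - (\<delta> / (4 * q)) * (u / a k) + (\<delta> / (4 * q) + C2 / 2) * (m k / a k)"
        unfolding \<psi>_def \<psi>'_def q_def
        using a0 m(1)[of k] u C \<delta> C2 j(2) descD br
        by (intro kl_rate_step_matching[where em = "Mid k - c j (\<mu> k)"]) auto
      also have "\<dots> \<le> - \<kappa> * x k + s k"
      proof (intro add_mono)
        show "- (\<delta> / (4 * q)) * (u / a k) \<le> - \<kappa> * x k"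
          using mult_right_mono[OF \<kappa>(3) x[of k]] by (simp add: xu[symmetric])
        have "(\<delta> / (4 * q) + C2 / 2) * (m k / a k) \<le> (\<delta> / (4 * q) + C2) * (m k / a k)"
          using C2 m(1)[of k] apos[of k] by (intro mult_right_mono) auto
        moreover have "0 \<le> CG * (m k * sqrt (\<mu> k))"
          using CG m(1)[of k] \<mu>(1)[of k] by simp
        ultimately show "(\<delta> / (4 * q) + C2 / 2) * (m k / a k) \<le> s k"
          unfolding s_def by linarith
      qed
      finally have match: "\<psi>' j k - \<psi> j k \<le> s k - \<kappa> * x k" by simp
      \<comment> \<open>The drift of each tracked value is measured relative to the matching value
        \<open>j\<close>, whose own motion is already accounted for in \<open>br\<close>.\<close>
      have "\<psi>' i k - \<psi> i k \<le> s k" if i: "i \<in> J" for i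
      proof -
        define g where "g = c j (\<mu> k) - c i (\<mu> k)"
        define h where "h = \<bar>g - (c j (\<mu> (Suc k)) - c i (\<mu> (Suc k)))\<bar>"
        have "(j, i) \<in> J \<times> J" "\<mu> k / 2 \<le> \<mu> (Suc k) \<and> \<mu> (Suc k) \<le> \<mu> k" using i j \<mu> by auto
        then have h12: "h \<le> CG * (\<Delta> / \<mu> k) * \<bar>g\<bar>" "h \<le> CG * (\<Delta> / sqrt (\<mu> k)) * sqrt \<bar>g\<bar>"
          using elim(6) unfolding h_def g_def \<Delta>_def relative_variation_def by fastforce+
        have h1: "h \<le> CG * m k * \<bar>g\<bar>"
          using h12(1) mult_left_mono[OF rel(1)[of k] CG(1)] by (smt (verit) \<Delta>_def abs_ge_zero mult_right_mono)
        have h2: "h \<le> CG * (m k * sqrt (\<mu> k)) * sqrt \<bar>g\<bar>"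
          using h12(2) mult_right_mono[OF mult_left_mono[OF rel(2)[of k] CG(1)], of "sqrt \<bar>g\<bar>"]
          by (simp add: \<Delta>_def)
        have "\<psi>' i k - \<psi> i k \<le> C2 / 2 * (m k / a k) + CG * (m k * sqrt (\<mu> k))"
          unfolding \<psi>_def \<psi>'_def
        proof (rule kl_rate_change_of_index[where em = "Mid k - c j (\<mu> k)" and g = g and h = h
              and \<Gamma> = \<Gamma> and ?a0.0 = a0 and C = C and \<delta> = \<delta> and u = u])
          show "D (Suc k) - c i (\<mu> (Suc k)) \<le> Mid k - c j (\<mu> k) + g + \<delta> * u\<^sup>2 / a k / 2 + C2 * (m k)\<^sup>2 / a k + h"
            using br unfolding g_def h_def by linarith
          show "Mid k - c j (\<mu> k) + g + \<delta> * u\<^sup>2 / a k \<le> D k - c i (\<mu> k)"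
            using descD by (simp add: g_def)
          show "h \<ge> 0" by (simp add: h_def)
        qed (use a0 m(1) u C \<delta> C2 CG \<mu>(1) j(2) h1 h2 elim(3,4) \<Gamma>_def in auto)
        also have "\<dots> \<le> s k"
        proof -
          have "C2 / 2 * (m k / a k) \<le> (\<delta> / (4 * q) + C2) * (m k / a k)"
            using C2 m(1)[of k] apos[of k] \<delta> q by (intro mult_right_mono) auto
          then show ?thesis by (simp add: s_def)
        qed
        finally show ?thesis .
      qed
      with match j show ?thesis by blast
    qed
    have \<kappa>x: "\<kappa> * x k \<le> x k" "0 \<le> \<kappa> * x k" using \<kappa> x[of k] by (auto simp: mult_left_le_one_le)
    have "W * (D (Suc k) - D k) + (\<Sum>i\<in>J. \<psi>' i k - \<psi> i k) \<le> - \<kappa> * x k + card J * s k"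
      using main
    proof
      assume *: "W * (D (Suc k) - D k) \<le> - x k \<and> (\<forall>i\<in>J. \<psi>' i k - \<psi> i k \<le> s k)"
      have "(\<Sum>i\<in>J. \<psi>' i k - \<psi> i k) \<le> card J * s k"
        using sum_bounded_above[of J "\<lambda>i. \<psi>' i k - \<psi> i k" "s k"] * by simp
      then show ?thesis using * \<kappa>x by linarith
    next
      assume "\<exists>j\<in>J. \<psi>' j k - \<psi> j k \<le> s k - \<kappa> * x k \<and> (\<forall>i\<in>J. \<psi>' i k - \<psi> i k \<le> s k)"
      then obtain j where j: "j \<in> J" "\<psi>' j k - \<psi> j k \<le> s k - \<kappa> * x k" "\<And>i. i \<in> J \<Longrightarrow> \<psi>' i k - \<psi> i k \<le> s k"
        by blast
      have "(\<Sum>i\<in>J. \<psi>' i k - \<psi> i k) \<le> (\<Sum>i\<in>J. s k - (if i = j then \<kappa> * x k else 0))"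
        using j by (intro sum_mono) auto
      also have "\<dots> = card J * s k - \<kappa> * x k"
        using J j(1) by (simp add: sum_subtractf)
      finally have "(\<Sum>i\<in>J. \<psi>' i k - \<psi> i k) \<le> card J * s k - \<kappa> * x k" .
      moreover have "0 \<le> \<delta> * u\<^sup>2 / a k" using \<delta> apos[of k] by simp
      then have "W * (D (Suc k) - D k) \<le> 0"
        using W Dle by (intro mult_nonneg_nonpos) auto
      ultimately show ?thesis by linarith
    qed
    moreover have "(\<Sum>i\<in>J. \<psi> i (Suc k)) \<le> (\<Sum>i\<in>J. \<psi>' i k + (m k - m (Suc k)))"
      using \<psi>\<psi>' by (intro sum_mono) auto
    ultimately show ?case
      by (simp add: \<Phi>_def t_def sum.distrib sum_subtractf algebra_simps)
  qed
  moreover have "summable t"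
  proof -
    have "summable (\<lambda>k. m k - m (Suc k))"
      using telescope_summable'[OF m0] by simp
    then show ?thesis
      unfolding t_def s_def
      by (intro summable_add summable_mult m(4,5))
  qed
  \<comment> \<open>\<open>D\<close> is eventually nonincreasing, hence bounded, and the critical
    values converge; so the \<open>kl_rate\<close> terms, though possibly negative, are bounded
    below.\<close>
  moreover have "\<exists>L. \<forall>k. L \<le> \<Phi> k"
  proof -
    obtain N where N: "\<And>k. k \<ge> N \<Longrightarrow> Mid k \<le> D k - \<delta> * (a k * x k)\<^sup>2 / a k"
      using desc unfolding eventually_sequentially by blast
    have Dmono: "D (Suc k) \<le> D k" if "k \<ge> N" for k
    proof -
      have "0 \<le> \<delta> * (a k * x k)\<^sup>2 / a k" using \<delta> apos[of k] by simp
      with N[OF that] D(2)[of k] show ?thesis by linarith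
    qed
    have "D k \<le> D N" if "k \<ge> N" for k
      using that by (induction k rule: dec_induct) (auto intro: order_trans[OF Dmono])
    then have "D k \<le> Max (D ` {..N})" for k
      by (cases "k \<le> N") (auto intro!: order_trans[OF \<open>\<And>k. k \<ge> N \<Longrightarrow> D k \<le> D N\<close> Max_ge])
    then obtain DB where DB: "\<And>k. D k \<le> DB" by blast
    have "- sqrt (DB + B) \<le> \<psi> i k" if i: "i \<in> J" for i k
    proof -
      have "\<bar>D k - c i (\<mu> k)\<bar> \<le> DB + B"
        using D(1)[of k] DB[of k] B[OF i, of k] by linarith
      then have "sqrt \<bar>D k - c i (\<mu> k)\<bar> \<le> sqrt (DB + B)" by simp
      then show ?thesis
        using abs_kl_rate_le[OF less_imp_le[OF m(1)[of k]], of "D k - c i (\<mu> k)"]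
        unfolding \<psi>_def by linarith
    qed
    then have "(\<Sum>i\<in>J. - sqrt (DB + B)) \<le> (\<Sum>i\<in>J. \<psi> i k)" for k
      by (intro sum_mono) auto
    moreover have "0 \<le> W * D k" for k using W D(1)[of k] by simp
    ultimately show ?thesis
      unfolding \<Phi>_def by (metis add.commute add_increasing2)
  qed
  ultimately show ?thesis
    using summable_of_descent[of x \<kappa> \<Phi> t] x \<kappa> by blast
qed

section \<open>Quadratic families\<close>

text \<open>\<open>f\<close> is the objective at a fixed point as a function of the smoothing parameter, \<open>g\<close> the norm of
  its gradient at the parameter \<open>\<mu>\<close>, and \<open>c\<close> the moving critical value.\<close>

definition moving_kl :: "(real \<Rightarrow> real) \<Rightarrow> (real \<Rightarrow> real) \<Rightarrow> real \<Rightarrow> real \<Rightarrow> real \<Rightarrow> bool" where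
  "moving_kl f c C \<mu> g \<longleftrightarrow> \<bar>f \<mu> - c \<mu>\<bar> \<le> C * g\<^sup>2 \<and> (\<forall>\<mu>'. \<mu> / 2 \<le> \<mu>' \<longrightarrow> \<mu>' \<le> \<mu> \<longrightarrow>
     f \<mu>' - f \<mu> - (c \<mu>' - c \<mu>) \<le> C * (g * (\<mu> - \<mu>') + (\<mu> - \<mu>')\<^sup>2 / \<mu>))"

text \<open>In the degenerate case \<open>\<alpha> = \<beta> = 0\<close>, \<open>l \<noteq> 0\<close> the slope \<open>p\<close> is bounded away from 0 and the claim is void.\<close>

lemma scalar_kl:
  fixes \<alpha> \<beta> l :: real
  assumes "0 \<le> \<alpha>" "0 \<le> \<beta>"
  shows "\<exists>c \<epsilon> C. rational_near_0 c \<and> 0 < \<epsilon> \<and> 0 \<le> C \<and>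
    (\<forall>\<mu> t p. 0 < \<mu> \<longrightarrow> \<mu> < \<epsilon> \<longrightarrow> p = (\<alpha> / \<mu> - \<beta>) * t + l \<longrightarrow> \<bar>p\<bar> \<le> \<epsilon> \<longrightarrow>
      moving_kl (\<lambda>\<nu>. (\<alpha> / \<nu> - \<beta>) * t\<^sup>2 / 2 + l * t) c C \<mu> \<bar>p\<bar>)"
proof -
  consider "\<alpha> > 0" | "\<alpha> = 0" "\<beta> > 0" | "\<alpha> = 0" "\<beta> = 0" "l = 0" | "\<alpha> = 0" "\<beta> = 0" "l \<noteq> 0"
    using assms by linarith
  then show ?thesis
  proof cases
    case 1
    \<comment> \<open>The critical value
      \<open>- l\<^sup>2 / (2 * (\<alpha> / \<mu> - \<beta>))\<close>, with the inner fraction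
      cleared so that the denominator is \<open>2 * \<alpha>\<close> at 0.\<close>
    define c where "c \<mu> = poly [:0, - l\<^sup>2:] \<mu> / poly [:2 * \<alpha>, - 2 * \<beta>:] \<mu>" for \<mu>
    have rat: "rational_near_0 c"
      unfolding c_def using 1 by (intro rational_near_0_quotient) auto
    \<comment> \<open>Below \<open>\<epsilon>\<close> the curvature is at least half of
      \<open>\<alpha> / \<mu>\<close>. The summand \<open>\<alpha> / 2\<close> keeps the divisor
      positive for \<open>\<beta> = 0\<close>, and the bound by 1 limits both \<open>\<mu>\<close>
      and the slope \<open>p\<close>.\<close>
    define \<epsilon> where "\<epsilon> = min 1 (\<alpha> / (2 * (\<beta> + \<alpha> / 2)))"
    define C where "C = 1 / \<alpha> + (16 / \<alpha>) * (1 + \<bar>l\<bar>)\<^sup>2"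
    have C: "1 / \<alpha> \<le> C" "(16 / \<alpha>) * (1 + \<bar>l\<bar>)\<^sup>2 \<le> C" "0 \<le> C" using 1 by (auto simp: C_def)
    have main: "moving_kl (\<lambda>\<nu>. (\<alpha> / \<nu> - \<beta>) * t\<^sup>2 / 2 + l * t) c C \<mu> \<bar>p\<bar>"
      if \<mu>: "0 < \<mu>" "\<mu> < \<epsilon>" and p: "p = (\<alpha> / \<mu> - \<beta>) * t + l" "\<bar>p\<bar> \<le> \<epsilon>" for \<mu> t p
    proof -
      define h where "h \<mu> = \<alpha> / \<mu> - \<beta>" for \<mu>
      have h_ge: "\<alpha> / (2 * \<nu>) \<le> h \<nu>" "\<alpha> / 2 \<le> h \<nu>" if "0 < \<nu>" "\<nu> < \<epsilon>" for \<nu>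
      proof -
        have "\<nu> < 1" "\<nu> < \<alpha> / (2 * (\<beta> + \<alpha> / 2))"
          using that unfolding \<epsilon>_def min_less_iff_conj by blast+
        moreover have "0 < 2 * (\<beta> + \<alpha> / 2)" using 1 assms by simp
        ultimately have "\<nu> * (2 * (\<beta> + \<alpha> / 2)) \<le> \<alpha>" by (simp only: pos_less_divide_eq less_imp_le)
        then have "\<beta> * (2 * \<nu>) \<le> \<alpha>" using that 1 by (simp add: algebra_simps) (smt (verit) mult_pos_pos)
        then show 1: "\<alpha> / (2 * \<nu>) \<le> h \<nu>"
          using that by (simp add: h_def field_simps)
        have "\<alpha> / 2 \<le> \<alpha> / (2 * \<nu>)"
          using \<open>0 < \<alpha>\<close> that \<open>\<nu> < 1\<close> by (intro divide_left_mono) auto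
        with 1 show "\<alpha> / 2 \<le> h \<nu>" by linarith
      qed
      have c_eq: "c \<nu> = - l\<^sup>2 / (2 * h \<nu>)" if "0 < \<nu>" "\<nu> < \<epsilon>" for \<nu>
        using that h_ge[OF that] 1 by (simp add: c_def h_def field_simps)
      have hpos: "0 < h \<mu>" using h_ge[OF \<mu>] 1 by linarith
      have t: "t = (p - l) / h \<mu>"
        using hpos p(1) by (simp add: h_def)
      have sq: "h \<nu> * t\<^sup>2 / 2 + l * t - c \<nu> = (h \<nu> * t + l)\<^sup>2 / (2 * h \<nu>)" if "0 < \<nu>" "\<nu> < \<epsilon>" for \<nu>
      proof -
        have "0 < h \<nu>" using h_ge[OF that] 1 by linarith
        then show ?thesis by (simp add: c_eq[OF that] field_simps power2_eq_square)
      qed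
      have "\<bar>h \<mu> * t\<^sup>2 / 2 + l * t - c \<mu>\<bar> = p\<^sup>2 / (2 * h \<mu>)"
        using sq[OF \<mu>] hpos p(1) by (simp add: h_def[of \<mu>])
      also have "\<dots> \<le> p\<^sup>2 / \<alpha>"
        using h_ge[OF \<mu>] 1 by (intro divide_left_mono) auto
      also have "\<dots> \<le> C * p\<^sup>2"
        using mult_right_mono[OF C(1), of "p\<^sup>2"] by simp
      finally have first: "\<bar>h \<mu> * t\<^sup>2 / 2 + l * t - c \<mu>\<bar> \<le> C * p\<^sup>2" .
      have second: "(h \<mu>' * t\<^sup>2 / 2 + l * t) - (h \<mu> * t\<^sup>2 / 2 + l * t) - (c \<mu>' - c \<mu>)
          \<le> C * (\<bar>p\<bar> * (\<mu> - \<mu>') + (\<mu> - \<mu>')\<^sup>2 / \<mu>)" if \<mu>': "\<mu> / 2 \<le> \<mu>'" "\<mu>' \<le> \<mu>" for \<mu>'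
      proof -
        have \<mu>'': "0 < \<mu>'" "\<mu>' < \<epsilon>" using \<mu> \<mu>' by auto
        have hmono: "h \<mu> \<le> h \<mu>'"
          unfolding h_def using 1 \<mu>' \<mu>'' by (intro diff_mono divide_left_mono) auto
        \<comment> \<open>The relative growth of the curvature is at most four times the relative
          drop of \<open>\<mu>\<close>. The slope at \<open>\<mu>'\<close> is
          \<open>p + e * (p - l)\<close>, so its square exceeds that of \<open>p\<close> by terms of
          order \<open>\<bar>p\<bar> * e\<close> and \<open>e\<^sup>2\<close>.\<close>
        define e where "e = (h \<mu>' - h \<mu>) / h \<mu>"
        have e0: "0 \<le> e" using hmono hpos by (simp add: e_def)
        have h': "h \<mu>' = h \<mu> * (1 + e)" using hpos by (simp add: e_def field_simps)
        define r where "r = (\<mu> - \<mu>') / \<mu>"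
        have r: "0 \<le> r" "r \<le> 1" using \<mu> \<mu>' by (auto simp: r_def field_simps)
        have "h \<mu>' - h \<mu> = \<alpha> * r / \<mu>'"
          using \<mu> \<mu>'' by (simp add: h_def r_def field_simps)
        also have "\<dots> \<le> \<alpha> * r / (\<mu> / 2)"
          using 1 r \<mu> \<mu>' \<mu>'' by (intro divide_left_mono) auto
        also have "\<dots> = (\<alpha> / (2 * \<mu>)) * (4 * r)" by simp
        also have "\<dots> \<le> h \<mu> * (4 * r)"
          using h_ge[OF \<mu>] r by (intro mult_right_mono) auto
        finally have e: "e \<le> 4 * r"
          using hpos by (simp add: e_def pos_divide_le_eq mult.commute)
        have p': "h \<mu>' * t + l = p + e * (p - l)"
          using hpos by (simp add: h' t field_simps)
        have "\<bar>p\<bar> \<le> 1" using p(2) by (simp add: \<epsilon>_def)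
        have "(h \<mu>' * t\<^sup>2 / 2 + l * t) - (h \<mu> * t\<^sup>2 / 2 + l * t) - (c \<mu>' - c \<mu>)
            = (p + e * (p - l))\<^sup>2 / (2 * h \<mu>') - p\<^sup>2 / (2 * h \<mu>)"
          using sq[OF \<mu>] sq[OF \<mu>''] p' p(1) by (simp add: h_def[of \<mu>])
        also have "\<dots> \<le> (p + e * (p - l))\<^sup>2 / (2 * h \<mu>) - p\<^sup>2 / (2 * h \<mu>)"
          using hmono hpos by (intro diff_right_mono divide_left_mono) auto
        also have "\<dots> = (2 * p * (e * (p - l)) + (e * (p - l))\<^sup>2) / (2 * h \<mu>)"
          by (simp add: power2_sum diff_divide_distrib add_divide_distrib)
        also have "\<dots> \<le> (2 * \<bar>p\<bar> * (4 * r * (1 + \<bar>l\<bar>)) + (4 * r * (1 + \<bar>l\<bar>))\<^sup>2) / (2 * h \<mu>)"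
        proof (intro divide_right_mono add_mono)
          have 2: "\<bar>e * (p - l)\<bar> \<le> 4 * r * (1 + \<bar>l\<bar>)"
            unfolding abs_mult using e e0 r \<open>\<bar>p\<bar> \<le> 1\<close> by (intro mult_mono) auto
          have "2 * p * (e * (p - l)) \<le> 2 * \<bar>p\<bar> * \<bar>e * (p - l)\<bar>"
            by (metis abs_ge_self abs_mult abs_numeral)
          also have "\<dots> \<le> 2 * \<bar>p\<bar> * (4 * r * (1 + \<bar>l\<bar>))"
            using 2 by (intro mult_left_mono) auto
          finally show "2 * p * (e * (p - l)) \<le> 2 * \<bar>p\<bar> * (4 * r * (1 + \<bar>l\<bar>))" .
          show "(e * (p - l))\<^sup>2 \<le> (4 * r * (1 + \<bar>l\<bar>))\<^sup>2"
            using 2 by (metis abs_ge_zero power2_abs power_mono)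
        qed (use hpos in simp)
        also have "\<dots> \<le> (2 * \<bar>p\<bar> * (4 * r * (1 + \<bar>l\<bar>)) + (4 * r * (1 + \<bar>l\<bar>))\<^sup>2) / (2 * (\<alpha> / (2 * \<mu>)))"
          using h_ge(1)[OF \<mu>] r 1 \<mu> hpos
          by (intro divide_left_mono add_nonneg_nonneg mult_nonneg_nonneg) auto
        also have "\<dots> = (16 / \<alpha>) * (\<bar>p\<bar> / 2 * (1 + \<bar>l\<bar>) * (r * \<mu>) + (1 + \<bar>l\<bar>)\<^sup>2 * (r\<^sup>2 * \<mu>))"
          using 1 \<mu> by (simp add: field_simps power2_eq_square)
        also have "\<dots> \<le> (16 / \<alpha>) * ((1 + \<bar>l\<bar>)\<^sup>2 * (\<bar>p\<bar> * (r * \<mu>)) + (1 + \<bar>l\<bar>)\<^sup>2 * (r\<^sup>2 * \<mu>))"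
        proof (intro mult_left_mono add_right_mono)
          have "(1 + \<bar>l\<bar>) * 1 \<le> (1 + \<bar>l\<bar>) * (1 + \<bar>l\<bar>)" by (intro mult_left_mono) auto
          then have "(1 / 2) * (1 + \<bar>l\<bar>) \<le> (1 + \<bar>l\<bar>)\<^sup>2" by (simp add: power2_eq_square)
          from mult_right_mono[OF this, of "\<bar>p\<bar> * (r * \<mu>)"]
          show "\<bar>p\<bar> / 2 * (1 + \<bar>l\<bar>) * (r * \<mu>) \<le> (1 + \<bar>l\<bar>)\<^sup>2 * (\<bar>p\<bar> * (r * \<mu>))"
            using r \<mu> by (simp add: mult_ac)
        qed (use 1 in auto)
        also have "\<dots> = ((16 / \<alpha>) * (1 + \<bar>l\<bar>)\<^sup>2) * (\<bar>p\<bar> * (r * \<mu>) + r\<^sup>2 * \<mu>)"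
          by (simp add: distrib_left)
        also have "\<dots> \<le> C * (\<bar>p\<bar> * (r * \<mu>) + r\<^sup>2 * \<mu>)"
          using C r \<mu> by (intro mult_right_mono) auto
        also have "r\<^sup>2 * \<mu> = (\<mu> - \<mu>')\<^sup>2 / \<mu>"
          using \<mu> by (auto simp: r_def power2_eq_square)
        also have "r * \<mu> = \<mu> - \<mu>'"
          using \<mu> by (auto simp: r_def)
        finally show ?thesis .
      qed
      show ?thesis
        using first second by (simp add: moving_kl_def h_def)
    qed
    have "0 < \<epsilon>" using 1 assms by (auto simp: \<epsilon>_def intro!: divide_pos_pos add_nonneg_pos)
    then show ?thesis
      using rat C(3) main by blast
  next
    case 2
    \<comment> \<open>In a concave direction neither the function nor its critical value depends on
      \<open>\<mu>\<close>, so only the first half of \<open>moving_kl\<close> has content.\<close>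
    have main: "\<bar>(\<alpha> / \<mu> - \<beta>) * t\<^sup>2 / 2 + l * t - l\<^sup>2 / (2 * \<beta>)\<bar> \<le> 1 / (2 * \<beta>) * p\<^sup>2"
      if p: "p = (\<alpha> / \<mu> - \<beta>) * t + l" for \<mu> t p
    proof -
      have "(\<alpha> / \<mu> - \<beta>) * t\<^sup>2 / 2 + l * t - l\<^sup>2 / (2 * \<beta>) = - (p\<^sup>2 / (2 * \<beta>))"
        using 2 by (simp add: p field_simps power2_eq_square)
      then show ?thesis using 2 by simp
    qed
    show ?thesis
      by (rule exI[of _ "\<lambda>_. l\<^sup>2 / (2 * \<beta>)"], rule exI[of _ 1], rule exI[of _ "1 / (2 * \<beta>)"])
         (use main 2 rational_near_0_const in \<open>auto simp: moving_kl_def\<close>)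
  next
    case 3
    show ?thesis
      by (rule exI[of _ "\<lambda>_. 0"], rule exI[of _ 1], rule exI[of _ 0])
         (use 3 rational_near_0_const in \<open>auto simp: moving_kl_def\<close>)
  next
    case 4
    show ?thesis
      by (rule exI[of _ "\<lambda>_. 0"], rule exI[of _ "\<bar>l\<bar> / 2"], rule exI[of _ 0])
         (use 4 rational_near_0_const in \<open>auto simp: moving_kl_def\<close>)
  qed
qed

text \<open>One basis, orthogonal for both forms, serves all \<open>\<mu>\<close>. In it the family
  splits into one-variable problems whose critical values add up, and the products of
  \<open>v\<close> with the basis vectors are the one-variable slopes. For these it is enough that
  \<open>v\<close> represents the derivative along \<open>V\<close>.\<close>

lemma quadratic_family_kl:
  fixes a b :: "'a::euclidean_space \<Rightarrow> 'a \<Rightarrow> real" and l :: "'a \<Rightarrow> real"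
  assumes bil: "bilinear a" "bilinear b"
    and sym: "\<And>x y. a x y = a y x" "\<And>x y. b x y = b y x"
    and psd: "\<And>v. 0 \<le> a v v" "\<And>v. 0 \<le> b v v"
    and V: "subspace V" and l: "linear l"
  defines "Q \<equiv> \<lambda>z \<mu>. (a z z / \<mu> - b z z) / 2 + l z"
  shows "\<exists>c \<epsilon> C. rational_near_0 c \<and> 0 < \<epsilon> \<and> 0 \<le> C \<and>
    (\<forall>\<mu> z v. 0 < \<mu> \<longrightarrow> \<mu> < \<epsilon> \<longrightarrow> z \<in> V \<longrightarrow> (\<forall>h\<in>V. v \<bullet> h = a z h / \<mu> - b z h + l h) \<longrightarrow> norm v \<le> \<epsilon> \<longrightarrow>
      moving_kl (Q z) c C \<mu> (norm v))"
proof -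
  obtain B where B: "finite B" "B \<subseteq> V" "V \<subseteq> span B"
    and orth: "\<And>u v. u \<in> B \<Longrightarrow> v \<in> B \<Longrightarrow> u \<noteq> v \<Longrightarrow> a u v = 0 \<and> b u v = 0"
    using simultaneous_diagonalization[OF bil sym psd V] by metis
  have "\<forall>u. \<exists>c \<epsilon> C. rational_near_0 c \<and> 0 < \<epsilon> \<and> 0 \<le> C \<and>
    (\<forall>\<mu> t p. 0 < \<mu> \<longrightarrow> \<mu> < \<epsilon> \<longrightarrow> p = (a u u / \<mu> - b u u) * t + l u \<longrightarrow> \<bar>p\<bar> \<le> \<epsilon> \<longrightarrow>
      moving_kl (\<lambda>\<nu>. (a u u / \<nu> - b u u) * t\<^sup>2 / 2 + l u * t) c C \<mu> \<bar>p\<bar>)"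
    using scalar_kl psd by blast
  then obtain c \<epsilon> C where rat: "\<And>u. rational_near_0 (c u)" and \<epsilon>: "\<And>u. 0 < \<epsilon> u" and C: "\<And>u. 0 \<le> C u"
    and kl: "\<And>u \<mu> t p. 0 < \<mu> \<Longrightarrow> \<mu> < \<epsilon> u \<Longrightarrow> p = (a u u / \<mu> - b u u) * t + l u \<Longrightarrow> \<bar>p\<bar> \<le> \<epsilon> u \<Longrightarrow>
      moving_kl (\<lambda>\<nu>. (a u u / \<nu> - b u u) * t\<^sup>2 / 2 + l u * t) (c u) (C u) \<mu> \<bar>p\<bar>"
    by metis
  \<comment> \<open>The basis vectors are not normalized, so a slope is at most
    \<open>norm v * norm u\<close>; the added 1 keeps divisors positive and factors at least
    1.\<close>
  define E where "E = Min (insert 1 ((\<lambda>u. \<epsilon> u / (1 + norm u)) ` B))"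
  have E0: "0 < E" using B(1) \<epsilon> by (auto simp: E_def add_pos_nonneg)
  have E: "E * (1 + norm u) \<le> \<epsilon> u" if "u \<in> B" for u
  proof -
    have "E \<le> \<epsilon> u / (1 + norm u)" unfolding E_def using B(1) that by (intro Min_le) auto
    then show ?thesis by (simp add: pos_le_divide_eq add_pos_nonneg)
  qed
  define C' where "C' = (\<Sum>u\<in>B. C u * (1 + norm u)\<^sup>2)"
  have main: "moving_kl (Q z) (\<lambda>\<mu>. \<Sum>u\<in>B. c u \<mu>) C' \<mu> (norm v)"
    if \<mu>: "0 < \<mu>" "\<mu> < E" and z: "z \<in> V" and v: "\<forall>h\<in>V. v \<bullet> h = a z h / \<mu> - b z h + l h"
      and vE: "norm v \<le> E" for \<mu> z v
  proof -
    obtain t where t: "z = (\<Sum>u\<in>B. t u *\<^sub>R u)"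
      using z B(3) span_finite[OF B(1)] by auto
    have az: "s z u = t u * s u u" if s: "bilinear s" "\<And>u v. u \<in> B \<Longrightarrow> v \<in> B \<Longrightarrow> u \<noteq> v \<Longrightarrow> s u v = 0"
      and u: "u \<in> B" for s :: "'a \<Rightarrow> 'a \<Rightarrow> real" and u
    proof -
      have "s z u = s (\<Sum>u\<in>B. t u *\<^sub>R u) (\<Sum>w\<in>B. (if w = u then 1 else 0) *\<^sub>R w)"
        using u B(1) by (simp add: t if_distrib[of "\<lambda>r. r *\<^sub>R _"] cong: if_cong)
      also have "\<dots> = (\<Sum>w\<in>B. t w * (if w = u then 1 else 0) * s w w)"
        by (rule diagonal_form_sum[OF s(1) B(1) s(2)])
      also have "\<dots> = t u * s u u"
        using u B(1) by (simp add: if_distrib if_distribR cong: if_cong)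
      finally show ?thesis .
    qed
    define p where "p u = (a u u / \<mu> - b u u) * t u + l u" for u
    have vu: "v \<bullet> u = p u" if u: "u \<in> B" for u
    proof -
      have "v \<bullet> u = a z u / \<mu> - b z u + l u" using v u B(2) by blast
      moreover have "a z u = t u * a u u" "b z u = t u * b u u"
        using orth by (auto intro!: az bil u)
      ultimately show ?thesis by (simp add: p_def algebra_simps)
    qed
    have pu: "\<bar>p u\<bar> \<le> norm v * (1 + norm u)" if u: "u \<in> B" for u
      using Cauchy_Schwarz_ineq2[of v u] vu[OF u] by (simp add: algebra_simps add_increasing)
    have kl': "moving_kl (\<lambda>\<nu>. (a u u / \<nu> - b u u) * (t u)\<^sup>2 / 2 + l u * t u) (c u) (C u) \<mu> \<bar>p u\<bar>"
      if u: "u \<in> B" for u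
    proof (rule kl)
      have "E \<le> E * (1 + norm u)" using E0 by (simp add: algebra_simps)
      then show "\<mu> < \<epsilon> u" using \<mu> E[OF u] by linarith
      have "norm v * (1 + norm u) \<le> E * (1 + norm u)" using vE by (intro mult_right_mono) auto
      then show "\<bar>p u\<bar> \<le> \<epsilon> u" using pu[OF u] E[OF u] by linarith
    qed (use \<mu> p_def in auto)
    have Q: "Q z \<nu> = (\<Sum>u\<in>B. (a u u / \<nu> - b u u) * (t u)\<^sup>2 / 2 + l u * t u)" for \<nu>
    proof -
      have "a z z = (\<Sum>u\<in>B. t u * t u * a u u)" "b z z = (\<Sum>u\<in>B. t u * t u * b u u)"
        using diagonal_form_sum[OF bil(1) B(1), of t t] diagonal_form_sum[OF bil(2) B(1), of t t] orth
        by (auto simp: t)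
      moreover have "l z = (\<Sum>u\<in>B. l u * t u)"
        by (simp add: t linear_sum[OF l] linear_cmul[OF l] mult.commute)
      ultimately show ?thesis
        by (simp add: Q_def sum.distrib sum_subtractf sum_divide_distrib diff_divide_distrib
            algebra_simps power2_eq_square)
    qed
    have "\<bar>Q z \<mu> - (\<Sum>u\<in>B. c u \<mu>)\<bar> \<le> (\<Sum>u\<in>B. \<bar>(a u u / \<mu> - b u u) * (t u)\<^sup>2 / 2 + l u * t u - c u \<mu>\<bar>)"
      unfolding Q sum_subtractf[symmetric] by (rule sum_abs)
    also have "\<dots> \<le> (\<Sum>u\<in>B. C u * (norm v * (1 + norm u))\<^sup>2)"
    proof (rule sum_mono)
      fix u assume u: "u \<in> B"
      have "(p u)\<^sup>2 \<le> (norm v * (1 + norm u))\<^sup>2"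
        using pu[OF u] by (metis abs_ge_zero power2_abs power_mono)
      then show "\<bar>(a u u / \<mu> - b u u) * (t u)\<^sup>2 / 2 + l u * t u - c u \<mu>\<bar> \<le> C u * (norm v * (1 + norm u))\<^sup>2"
        using kl'[OF u] C[of u] unfolding moving_kl_def power2_abs by (meson mult_left_mono order_trans)
    qed
    also have "\<dots> = C' * (norm v)\<^sup>2"
      by (simp add: C'_def sum_distrib_left power_mult_distrib mult_ac)
    finally have first: "\<bar>Q z \<mu> - (\<Sum>u\<in>B. c u \<mu>)\<bar> \<le> C' * (norm v)\<^sup>2" .
    have second: "Q z \<mu>' - Q z \<mu> - ((\<Sum>u\<in>B. c u \<mu>') - (\<Sum>u\<in>B. c u \<mu>)) \<le> C' * (norm v * (\<mu> - \<mu>') + (\<mu> - \<mu>')\<^sup>2 / \<mu>)"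
      if \<mu>': "\<mu> / 2 \<le> \<mu>'" "\<mu>' \<le> \<mu>" for \<mu>'
    proof -
      have "Q z \<mu>' - Q z \<mu> - ((\<Sum>u\<in>B. c u \<mu>') - (\<Sum>u\<in>B. c u \<mu>))
        = (\<Sum>u\<in>B. ((a u u / \<mu>' - b u u) * (t u)\<^sup>2 / 2 + l u * t u) - ((a u u / \<mu> - b u u) * (t u)\<^sup>2 / 2 + l u * t u) - (c u \<mu>' - c u \<mu>))"
        unfolding Q sum_subtractf[symmetric] ..
      also have "\<dots> \<le> (\<Sum>u\<in>B. C u * (1 + norm u)\<^sup>2 * (norm v * (\<mu> - \<mu>') + (\<mu> - \<mu>')\<^sup>2 / \<mu>))"
      proof (rule sum_mono)
        fix u assume u: "u \<in> B"
        have n1: "1 \<le> 1 + norm u" by simp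
        then have n2: "1 + norm u \<le> (1 + norm u)\<^sup>2" "1 \<le> (1 + norm u)\<^sup>2"
          using self_le_power[OF n1, of 2] one_le_power[OF n1, of 2] by auto
        have "\<bar>p u\<bar> * (\<mu> - \<mu>') \<le> norm v * (1 + norm u)\<^sup>2 * (\<mu> - \<mu>')"
          using pu[OF u] mult_left_mono[OF n2(1), of "norm v"] \<mu>' by (intro mult_right_mono) auto
        moreover have "1 * ((\<mu> - \<mu>')\<^sup>2 / \<mu>) \<le> (1 + norm u)\<^sup>2 * ((\<mu> - \<mu>')\<^sup>2 / \<mu>)"
          using n2 \<mu> by (intro mult_right_mono) auto
        ultimately have "\<bar>p u\<bar> * (\<mu> - \<mu>') + (\<mu> - \<mu>')\<^sup>2 / \<mu>
            \<le> norm v * (1 + norm u)\<^sup>2 * (\<mu> - \<mu>') + (1 + norm u)\<^sup>2 * ((\<mu> - \<mu>')\<^sup>2 / \<mu>)"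
          by linarith
        also have "\<dots> = (1 + norm u)\<^sup>2 * (norm v * (\<mu> - \<mu>') + (\<mu> - \<mu>')\<^sup>2 / \<mu>)"
          unfolding distrib_left by (simp only: mult_ac)
        finally have "C u * (\<bar>p u\<bar> * (\<mu> - \<mu>') + (\<mu> - \<mu>')\<^sup>2 / \<mu>)
            \<le> C u * (1 + norm u)\<^sup>2 * (norm v * (\<mu> - \<mu>') + (\<mu> - \<mu>')\<^sup>2 / \<mu>)"
          using C[of u] by (simp only: mult.assoc mult_left_mono)
        then show "((a u u / \<mu>' - b u u) * (t u)\<^sup>2 / 2 + l u * t u) - ((a u u / \<mu> - b u u) * (t u)\<^sup>2 / 2 + l u * t u) - (c u \<mu>' - c u \<mu>)
            \<le> C u * (1 + norm u)\<^sup>2 * (norm v * (\<mu> - \<mu>') + (\<mu> - \<mu>')\<^sup>2 / \<mu>)"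
          using kl'[OF u] \<mu>' unfolding moving_kl_def by (meson order_trans)
      qed
      also have "\<dots> = C' * (norm v * (\<mu> - \<mu>') + (\<mu> - \<mu>')\<^sup>2 / \<mu>)"
        by (simp only: C'_def sum_distrib_right)
      finally show ?thesis .
    qed
    from first second show ?thesis unfolding moving_kl_def by blast
  qed
  have rat': "rational_near_0 (\<lambda>\<mu>. \<Sum>u\<in>B. c u \<mu>)"
    using B(1) rat by (intro rational_near_0_sum)
  have C': "0 \<le> C'" unfolding C'_def using C by (intro sum_nonneg) auto
  show ?thesis
    by (rule exI[of _ "\<lambda>\<mu>. \<Sum>u\<in>B. c u \<mu>"], rule exI[of _ E], rule exI[of _ C'],
        rule conjI[OF rat' conjI[OF E0 conjI[OF C']]], intro allI impI, rule main)
qed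

text \<open>The first alternative provides a base point for the pieces on which the residuals indexed by
  \<open>S\<close> lie in the smoothing band; under the second these pieces are empty for small \<open>\<mu>\<close>.\<close>

lemma least_squares_dichotomy:
  fixes X :: "'i \<Rightarrow> 'a::euclidean_space"
  assumes S: "finite S" and V: "subspace V"
  shows "(\<exists>w0\<in>V. \<forall>i\<in>S. X i \<bullet> w0 = y i) \<or> (\<exists>\<epsilon>>0. \<forall>w\<in>V. \<exists>i\<in>S. \<epsilon> \<le> \<bar>y i - X i \<bullet> w\<bar>)"
proof -
  define A where "A g h = (\<Sum>i\<in>S. 1 * (X i \<bullet> g) * (X i \<bullet> h))" for g h
  have A_bil: "bilinear A"
    unfolding A_def by (rule bilinear_sum_of_squares)
  have A_sym: "A g h = A h g" for g h
    by (simp add: A_def mult.commute)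
  have A_psd: "0 \<le> A h h" for h
    by (simp add: A_def sum_nonneg)
  obtain B where B: "finite B" "B \<subseteq> V" "V \<subseteq> span B"
    and orth: "\<And>u v. u \<in> B \<Longrightarrow> v \<in> B \<Longrightarrow> u \<noteq> v \<Longrightarrow> A u v = 0"
    using simultaneous_diagonalization[OF A_bil bilinear_inner A_sym inner_commute A_psd inner_ge_zero V]
    by metis
  define f where "f h = (\<Sum>i\<in>S. y i * (X i \<bullet> h))" for h
  have f_lin: "linear f"
    unfolding f_def by (auto intro!: linearI simp: sum.distrib algebra_simps sum_distrib_left)
  \<comment> \<open>The solution of the normal equations in coordinates. If
    \<open>A u u = 0\<close>, the division by zero yields 0, which is consistent because
    \<open>f u\<close> vanishes too.\<close>
  define w0 where "w0 = (\<Sum>u\<in>B. (f u / A u u) *\<^sub>R u)"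
  have w0: "w0 \<in> V"
    unfolding w0_def using B V by (auto intro!: subspace_sum subspace_scale)
  have f0: "f u = 0" if "A u u = 0" for u
  proof -
    have "\<forall>i\<in>S. X i \<bullet> u = 0"
      using that S unfolding A_def by (subst (asm) sum_nonneg_eq_0_iff) auto
    then show ?thesis by (simp add: f_def)
  qed
  have normal: "A w0 h = f h" if h: "h \<in> V" for h
  proof -
    obtain t where t: "h = (\<Sum>u\<in>B. t u *\<^sub>R u)"
      using h B(3) span_finite[OF B(1)] by auto
    have "A w0 h = (\<Sum>u\<in>B. f u / A u u * t u * A u u)"
      unfolding w0_def t by (rule diagonal_form_sum[OF A_bil B(1) orth])
    also have "\<dots> = (\<Sum>u\<in>B. t u * f u)"
      using f0 by (intro sum.cong refl) auto
    also have "\<dots> = f h"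
      by (simp add: t linear_sum[OF f_lin] linear_cmul[OF f_lin])
    finally show ?thesis .
  qed
  define R where "R w = (\<Sum>i\<in>S. (y i - X i \<bullet> w)\<^sup>2)" for w
  have R_ge: "R w0 \<le> R w" if w: "w \<in> V" for w
  proof -
    have "R w = R w0 + A (w - w0) (w - w0) + 2 * (A w0 (w - w0) - f (w - w0))"
      unfolding R_def A_def f_def sum.distrib[symmetric] sum_subtractf[symmetric] sum_distrib_left
      by (intro sum.cong refl) (simp add: power2_eq_square inner_diff_right algebra_simps)
    moreover have "A w0 (w - w0) = f (w - w0)"
      using w w0 V by (intro normal) (auto simp: subspace_diff)
    ultimately show ?thesis using A_psd[of "w - w0"] by simp
  qed
  show ?thesis
  proof (cases "R w0 = 0")
    case True
    then have "\<forall>i\<in>S. X i \<bullet> w0 = y i"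
      using S unfolding R_def by (subst (asm) sum_nonneg_eq_0_iff) auto
    then show ?thesis using w0 by blast
  next
    case False
    have "0 \<le> R w0" unfolding R_def by (intro sum_nonneg) auto
    with False have R0: "0 < R w0" by simp
    \<comment> \<open>If all residuals were below \<open>\<epsilon>\<close>, their squares would sum
      to less than the minimum \<open>R w0\<close>; the added 1 makes this strict.\<close>
    define \<epsilon> where "\<epsilon> = sqrt (R w0 / (1 + card S))"
    have \<epsilon>: "0 < \<epsilon>" using R0 by (simp add: \<epsilon>_def)
    have "\<exists>i\<in>S. \<epsilon> \<le> \<bar>y i - X i \<bullet> w\<bar>" if w: "w \<in> V" for w
    proof (rule ccontr)
      assume "\<not> ?thesis"
      then have "(y i - X i \<bullet> w)\<^sup>2 \<le> \<epsilon>\<^sup>2" if "i \<in> S" for i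
        using that by (metis abs_ge_zero less_imp_le not_le power2_abs power_mono)
      then have "R w \<le> card S * \<epsilon>\<^sup>2"
        unfolding R_def by (intro sum_bounded_above) auto
      also have "\<dots> = R w0 * (card S / (1 + card S))"
        using R0 by (simp add: \<epsilon>_def)
      also have "\<dots> < R w0 * 1"
        using R0 by (intro mult_strict_left_mono) auto
      finally show False using R_ge[OF w] by simp
    qed
    with \<epsilon> show ?thesis by blast
  qed
qed

section \<open>Smoothed absolute value and folded concave penalties\<close>

text \<open>The derivative of \<open>fsmooth\<close> in its first argument.\<close>

definition clip :: "real \<Rightarrow> real \<Rightarrow> real" where
  "clip r \<mu> = max (- 1) (min 1 (r / \<mu>))"

lemma abs_clip_le_1: "\<bar>clip r \<mu>\<bar> \<le> 1"
  by (auto simp: clip_def)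

lemma clip_eq:
  assumes "0 < \<mu>"
  shows "clip r \<mu> = (if \<bar>r\<bar> < \<mu> then r / \<mu> else if 0 \<le> r then 1 else - 1)"
  using assms by (auto simp: clip_def max_def min_def field_simps)

lemma clip_lipschitz:
  assumes "0 < \<mu>"
  shows "\<bar>clip r \<mu> - clip r' \<mu>\<bar> \<le> \<bar>r - r'\<bar> / \<mu>"
proof -
  have "\<bar>clip r \<mu> - clip r' \<mu>\<bar> \<le> \<bar>r / \<mu> - r' / \<mu>\<bar>"
    by (auto simp: clip_def max_def min_def)
  also have "\<dots> = \<bar>r - r'\<bar> / \<mu>"
    using assms by (simp flip: diff_divide_distrib)
  finally show ?thesis .
qed

lemma fsmooth_eq_clip:
  assumes "0 < \<mu>"
  shows "fsmooth r \<mu> = clip r \<mu> * r + \<mu> * (1 - (clip r \<mu>)\<^sup>2) / 2"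
  using assms by (auto simp: fsmooth_def clip_eq field_simps power2_eq_square)

text \<open>\<open>fsmooth r \<mu>\<close> is the maximum of \<open>s r + \<mu> (1 - s\<^sup>2) / 2\<close> over \<open>\<bar>s\<bar> \<le> 1\<close>, attained at
  \<open>s = clip r \<mu>\<close>; the last summand is the strong concavity gap.\<close>

lemma fsmooth_ge_dual:
  assumes \<mu>: "0 < \<mu>" and s: "\<bar>s\<bar> \<le> 1"
  shows "s * r + \<mu> * (1 - s\<^sup>2) / 2 + \<mu> * (clip r \<mu> - s)\<^sup>2 / 2 \<le> fsmooth r \<mu>"
proof -
  define \<theta> where "\<theta> = clip r \<mu>"
  have "0 \<le> (\<theta> - s) * (r - \<mu> * \<theta>)"
  proof -
    consider "\<bar>r\<bar> < \<mu>" | "\<mu> \<le> r" | "r \<le> - \<mu>" by linarith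
    then show ?thesis
    proof cases
      case 1
      then show ?thesis using \<mu> by (simp add: \<theta>_def clip_eq)
    next
      case 2
      then have "\<theta> = 1" using \<mu> by (simp add: \<theta>_def clip_eq)
      then show ?thesis using 2 s by simp
    next
      case 3
      then have "\<theta> = - 1" using \<mu> by (simp add: \<theta>_def clip_eq)
      then show ?thesis using 3 s by (intro mult_nonpos_nonpos) auto
    qed
  qed
  also have "(\<theta> - s) * (r - \<mu> * \<theta>) = fsmooth r \<mu> - (s * r + \<mu> * (1 - s\<^sup>2) / 2 + \<mu> * (\<theta> - s)\<^sup>2 / 2)"
    using \<mu> by (simp add: fsmooth_eq_clip \<theta>_def field_simps power2_eq_square)
  finally show ?thesis by (simp add: \<theta>_def)
qed

text \<open>With the dual variable frozen at its maximizer for \<open>r\<close>, the dual expression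
  is an affine minorant that touches at \<open>r\<close>.\<close>

lemma fsmooth_tangent_le:
  assumes "0 < \<mu>"
  shows "fsmooth r \<mu> + clip r \<mu> * (r' - r) \<le> fsmooth r' \<mu>"
proof -
  have "0 \<le> \<mu> * (clip r' \<mu> - clip r \<mu>)\<^sup>2 / 2" using assms by simp
  then show ?thesis
    using fsmooth_ge_dual[OF assms abs_clip_le_1, of r \<mu> r'] fsmooth_eq_clip[OF assms, of r]
    by (simp add: right_diff_distrib)
qed

text \<open>The dual variable is frozen at its maximizer for \<open>r'\<close> instead. Replacing
  its slope by \<open>clip r \<mu>\<close> leaves the product of the changes of \<open>clip\<close>
  and of the argument; the strong concavity gap bounds it by completing the square.\<close>

lemma fsmooth_le_quadratic:
  assumes "0 < \<mu>"
  shows "fsmooth r' \<mu> \<le> fsmooth r \<mu> + clip r \<mu> * (r' - r) + (r' - r)\<^sup>2 / (2 * \<mu>)"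
proof -
  have "0 \<le> (\<mu> * (clip r' \<mu> - clip r \<mu>) - (r' - r))\<^sup>2 / (2 * \<mu>)" using assms by simp
  also have "\<dots> = \<mu> * (clip r' \<mu> - clip r \<mu>)\<^sup>2 / 2 - (clip r' \<mu> - clip r \<mu>) * (r' - r) + (r' - r)\<^sup>2 / (2 * \<mu>)"
    using assms by (simp add: field_simps power2_eq_square)
  finally show ?thesis
    using fsmooth_ge_dual[OF assms abs_clip_le_1, of r' \<mu> r] fsmooth_eq_clip[OF assms, of r']
      power2_commute[of "clip r \<mu>" "clip r' \<mu>"]
    by (simp add: algebra_simps)
qed

text \<open>For each fixed \<open>s\<close> with \<open>\<bar>s\<bar> \<le> 1\<close> the dual
  expression is nondecreasing in \<open>\<mu>\<close>.\<close>

lemma fsmooth_mono: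
  assumes "0 < \<mu>'" "\<mu>' \<le> \<mu>"
  shows "fsmooth r \<mu>' \<le> fsmooth r \<mu>"
proof -
  define s where "s = clip r \<mu>'"
  have "s\<^sup>2 \<le> 1" using abs_clip_le_1[of r \<mu>'] by (simp add: s_def abs_square_le_1)
  then have "\<mu>' * (1 - s\<^sup>2) / 2 \<le> \<mu> * (1 - s\<^sup>2) / 2"
    using assms by (intro divide_right_mono mult_right_mono) auto
  moreover have "0 \<le> \<mu> * (clip r \<mu> - s)\<^sup>2 / 2" using assms by simp
  ultimately show ?thesis
    using fsmooth_ge_dual[of \<mu> s r] fsmooth_eq_clip[of \<mu>' r] abs_clip_le_1[of r \<mu>'] assms
    unfolding s_def by linarith
qed

lemma abs_le_square_smoothing:
  fixes r :: real
  assumes "0 < \<mu>"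
  shows "\<bar>r\<bar> \<le> r\<^sup>2 / (2 * \<mu>) + \<mu> / 2"
proof -
  have "0 \<le> (\<bar>r\<bar> - \<mu>)\<^sup>2 / (2 * \<mu>)" using assms by simp
  also have "\<dots> = r\<^sup>2 / (2 * \<mu>) + \<mu> / 2 - \<bar>r\<bar>"
    using assms by (simp add: power2_diff field_simps power2_eq_square)
  finally show ?thesis by simp
qed

lemma abs_le_fsmooth: "0 < \<mu> \<Longrightarrow> \<bar>r\<bar> \<le> fsmooth r \<mu>"
  using abs_le_square_smoothing[of \<mu> r] by (simp add: fsmooth_def)

lemma fsmooth_le_square: "0 < \<mu> \<Longrightarrow> fsmooth r \<mu> \<le> r\<^sup>2 / (2 * \<mu>) + \<mu> / 2"
  using abs_le_square_smoothing[of \<mu> r] by (simp add: fsmooth_def)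

lemma fsmooth_le_abs: "0 < \<mu> \<Longrightarrow> fsmooth r \<mu> \<le> \<bar>r\<bar> + \<mu> / 2"
proof -
  assume \<mu>: "0 < \<mu>"
  have "clip r \<mu> * r \<le> \<bar>clip r \<mu>\<bar> * \<bar>r\<bar>" by (metis abs_ge_self abs_mult)
  also have "\<dots> \<le> 1 * \<bar>r\<bar>" by (intro mult_right_mono abs_clip_le_1) auto
  finally have "clip r \<mu> * r \<le> \<bar>r\<bar>" by simp
  moreover have "\<mu> * (1 - (clip r \<mu>)\<^sup>2) / 2 \<le> \<mu> * 1 / 2"
    using \<mu> by (intro divide_right_mono mult_left_mono) auto
  ultimately show ?thesis using fsmooth_eq_clip[OF \<mu>, of r] by simp
qed

lemma has_derivative_of_quadratic_bound:
  fixes g :: "'a::real_inner \<Rightarrow> real"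
  assumes "\<And>v. \<bar>g v - g w - G \<bullet> (v - w)\<bar> \<le> K * (norm (v - w))\<^sup>2"
  shows "(g has_derivative (\<lambda>h. G \<bullet> h)) (at w)"
proof (rule has_derivativeI_sandwich[where e = 1 and H = "\<lambda>v. K * norm (v - w)"])
  show "bounded_linear (\<lambda>h. G \<bullet> h)" by (rule bounded_linear_inner_right)
  show "norm (g v - g w - G \<bullet> (v - w)) / norm (v - w) \<le> K * norm (v - w)" if "v \<noteq> w" for v
    using assms[of v] that by (simp add: pos_divide_le_eq power2_eq_square)
  have "((\<lambda>v. K * norm (v - w)) \<longlongrightarrow> K * norm (w - w)) (at w)"
    by (intro tendsto_intros)
  then show "((\<lambda>v. K * norm (v - w)) \<longlongrightarrow> 0) (at w)" by simp
qed simp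

text \<open>The quadratic has to agree with \<open>g\<close> only at \<open>t\<close>, and its slope
  has to be a local supergradient. That is enough for the optimality condition of a minimizer, and
  it covers the knots, where no neighbourhood carries a single formula. The sign of
  \<open>k2\<close> makes the penalty contribute a negative semidefinite term to the Hessian of a
  piece.\<close>

definition piece_at :: "(real \<Rightarrow> real) \<Rightarrow> real \<Rightarrow> real \<times> real \<times> real \<Rightarrow> bool" where
  "piece_at g t = (\<lambda>(k0, k1, k2). k2 \<le> 0 \<and> g t = k0 + k1 * t + k2 * t\<^sup>2 / 2 \<and>
     (\<exists>\<delta>>0. \<forall>s. \<bar>s - t\<bar> < \<delta> \<longrightarrow> g s \<le> g t + (k1 + k2 * t) * (s - t)))"

lemma piece_at_pos:
  assumes "0 < t" "k2 \<le> 0" "g t = k0 + k1 * t + k2 * t\<^sup>2 / 2"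
    and "\<And>s. 0 \<le> s \<Longrightarrow> g s \<le> g t + (k1 + k2 * t) * (s - t)"
  shows "piece_at g t (k0, k1, k2)"
  unfolding piece_at_def using assms by (auto intro!: exI[of _ t])

lemma piece_at_even:
  assumes even: "\<And>t. g (- t) = g t" and "piece_at g t (k0, k1, k2)"
  shows "piece_at g (- t) (k0, - k1, k2)"
proof -
  obtain \<delta> where *: "k2 \<le> 0" "g t = k0 + k1 * t + k2 * t\<^sup>2 / 2" "\<delta> > 0"
    "\<And>s. \<bar>s - t\<bar> < \<delta> \<Longrightarrow> g s \<le> g t + (k1 + k2 * t) * (s - t)"
    using assms(2) by (auto simp: piece_at_def)
  have "g s \<le> g (- t) + (- k1 + k2 * - t) * (s - - t)" if "\<bar>s - - t\<bar> < \<delta>" for s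
    using *(4)[of "- s"] that even[of s] even[of t] by (simp add: algebra_simps)
  then show ?thesis
    using * even[of t] by (auto simp: piece_at_def)
qed

text \<open>On the positive half line the penalty is concave, so its tangents majorize it there;
  negative arguments will follow by evenness.\<close>

lemma mcp_pieces:
  assumes lam: "0 < lam" and \<gamma>: "1 \<le> \<gamma>" and t: "0 < t"
  shows "piece_at (mcp lam \<gamma>) t (0, lam, - 1 / \<gamma>) \<or> piece_at (mcp lam \<gamma>) t (\<gamma> * lam\<^sup>2 / 2, 0, 0)"
proof -
  have top: "mcp lam \<gamma> s \<le> \<gamma> * lam\<^sup>2 / 2" for s
  proof -
    have "0 \<le> (\<bar>s\<bar> - \<gamma> * lam)\<^sup>2 / (2 * \<gamma>)" using \<gamma> by simp
    also have "\<dots> = \<gamma> * lam\<^sup>2 / 2 - (lam * \<bar>s\<bar> - s\<^sup>2 / (2 * \<gamma>))"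
      using \<gamma> by (simp add: power2_diff field_simps power2_eq_square)
    finally show ?thesis by (simp add: mcp_def)
  qed
  show ?thesis
  proof (cases "t \<le> \<gamma> * lam")
    case True
    have "mcp lam \<gamma> s \<le> mcp lam \<gamma> t + (lam + - 1 / \<gamma> * t) * (s - t)" if s: "0 \<le> s" for s
    proof (cases "s \<le> \<gamma> * lam")
      case s': True
      have "0 \<le> (s - t)\<^sup>2 / (2 * \<gamma>)" using \<gamma> by simp
      also have "\<dots> = (lam * t - t\<^sup>2 / (2 * \<gamma>)) + (lam + - 1 / \<gamma> * t) * (s - t) - (lam * s - s\<^sup>2 / (2 * \<gamma>))"
        using \<gamma> by (simp add: field_simps power2_eq_square)
      finally show ?thesis using True s' s t by (simp add: mcp_def)
    next
      case False
      have "0 \<le> (\<gamma> * lam - t) * (2 * s - \<gamma> * lam - t) / (2 * \<gamma>)"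
        using True False \<gamma> t by (intro divide_nonneg_nonneg mult_nonneg_nonneg) auto
      also have "\<dots> = (lam * t - t\<^sup>2 / (2 * \<gamma>)) + (lam + - 1 / \<gamma> * t) * (s - t) - \<gamma> * lam\<^sup>2 / 2"
        using \<gamma> by (simp add: field_simps power2_eq_square)
      finally show ?thesis using True False s t by (simp add: mcp_def)
    qed
    then have "piece_at (mcp lam \<gamma>) t (0, lam, - 1 / \<gamma>)"
      using True t \<gamma> by (intro piece_at_pos) (auto simp: mcp_def)
    then show ?thesis ..
  next
    case False
    then have t_top: "mcp lam \<gamma> t = \<gamma> * lam\<^sup>2 / 2"
      using t by (simp add: mcp_def)
    have "mcp lam \<gamma> s \<le> mcp lam \<gamma> t + (0 + 0 * t) * (s - t)" for s
      using top[of s] t_top by simp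
    with t_top have "piece_at (mcp lam \<gamma>) t (\<gamma> * lam\<^sup>2 / 2, 0, 0)"
      using t by (intro piece_at_pos) auto
    then show ?thesis ..
  qed
qed

lemma scad_pieces:
  assumes lam: "0 < lam" and \<gamma>: "2 \<le> \<gamma>" and t: "0 < t"
  shows "piece_at (scad lam \<gamma>) t (0, lam, 0) \<or>
    piece_at (scad lam \<gamma>) t (- lam\<^sup>2 / (2 * (\<gamma> - 1)), \<gamma> * lam / (\<gamma> - 1), - 1 / (\<gamma> - 1)) \<or>
    piece_at (scad lam \<gamma>) t ((\<gamma> + 1) * lam\<^sup>2 / 2, 0, 0)"
proof -
  define q where "q s = - (s\<^sup>2 - 2 * \<gamma> * lam * s + lam\<^sup>2) / (2 * (\<gamma> - 1))" for s
  have g1: "0 < \<gamma> - 1" using \<gamma> by simp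
  have lg: "lam \<le> \<gamma> * lam" using \<gamma> lam by simp
  \<comment> \<open>The middle quadratic is tangent to the line at \<open>lam\<close> and to the
    constant at \<open>\<gamma> * lam\<close>; this makes the penalty concave across both
    knots.\<close>
  have q_lin: "lam * s - q s = (s - lam)\<^sup>2 / (2 * (\<gamma> - 1))" for s
    using g1 by (simp add: q_def field_simps power2_eq_square)
  have q_top: "(\<gamma> + 1) * lam\<^sup>2 / 2 - q s = (s - \<gamma> * lam)\<^sup>2 / (2 * (\<gamma> - 1))" for s
    using g1 by (simp add: q_def field_simps power2_eq_square)
  have q_tan: "q t' + (\<gamma> * lam / (\<gamma> - 1) + - 1 / (\<gamma> - 1) * t') * (s - t') - q s = (s - t')\<^sup>2 / (2 * (\<gamma> - 1))" for s t'
  proof -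
    define e where "e = \<gamma> - 1"
    have "e \<noteq> 0" using g1 by (simp add: e_def)
    then show ?thesis
      unfolding q_def e_def[symmetric] by (simp add: field_simps power2_eq_square)
  qed
  have scad: "scad lam \<gamma> s = (if s \<le> lam then lam * s else if s \<le> \<gamma> * lam then q s else (\<gamma> + 1) * lam\<^sup>2 / 2)"
    if "0 \<le> s" for s
    using that by (simp add: scad_def q_def)
  have top: "scad lam \<gamma> s \<le> (\<gamma> + 1) * lam\<^sup>2 / 2" if s: "0 \<le> s" for s
  proof (cases "s \<le> lam")
    case True
    have "lam * s \<le> lam * lam" using True lam by (intro mult_left_mono) auto
    also have "\<dots> \<le> (\<gamma> + 1) * lam\<^sup>2 / 2"
      using mult_right_mono[of 2 "\<gamma> + 1" "lam\<^sup>2"] \<gamma> by (simp add: power2_eq_square)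
    finally show ?thesis using True s by (simp add: scad)
  next
    case False
    have "0 \<le> (s - \<gamma> * lam)\<^sup>2 / (2 * (\<gamma> - 1))" using g1 by simp
    then show ?thesis using q_top[of s] False s by (simp add: scad)
  qed
  have lin: "scad lam \<gamma> s \<le> lam * s" if s: "0 \<le> s" for s
  proof (cases "s \<le> \<gamma> * lam")
    case True
    have "0 \<le> (s - lam)\<^sup>2 / (2 * (\<gamma> - 1))" using g1 by simp
    then show ?thesis using q_lin[of s] True s by (simp add: scad)
  next
    case False
    have "0 \<le> (\<gamma> * lam - lam)\<^sup>2 / (2 * (\<gamma> - 1))" using g1 by simp
    then have "(\<gamma> + 1) * lam\<^sup>2 / 2 \<le> lam * (\<gamma> * lam)"
      using q_lin[of "\<gamma> * lam"] q_top[of "\<gamma> * lam"] by simp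
    also have "\<dots> \<le> lam * s" using False lam by (intro mult_left_mono) auto
    finally show ?thesis using False s lg by (simp add: scad)
  qed
  consider "t \<le> lam" | "lam < t" "t \<le> \<gamma> * lam" | "\<gamma> * lam < t" by linarith
  then show ?thesis
  proof cases
    case 1
    have "scad lam \<gamma> s \<le> scad lam \<gamma> t + (lam + 0 * t) * (s - t)" if "0 \<le> s" for s
      using lin[OF that] 1 t by (simp add: scad algebra_simps)
    then have "piece_at (scad lam \<gamma>) t (0, lam, 0)"
      using 1 t by (intro piece_at_pos) (auto simp: scad)
    then show ?thesis by blast
  next
    case 2
    define slope where "slope = \<gamma> * lam / (\<gamma> - 1) + - 1 / (\<gamma> - 1) * t"
    have slope: "0 \<le> slope" "slope \<le> lam"
    proof -
      have slope_eq: "slope = (\<gamma> * lam - t) / (\<gamma> - 1)" by (simp add: slope_def diff_divide_distrib)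
      then show "0 \<le> slope" using 2 g1 by simp
      have "\<gamma> * lam - t \<le> lam * (\<gamma> - 1)" using 2 by (simp add: algebra_simps)
      with slope_eq show "slope \<le> lam" using g1 by (simp add: pos_divide_le_eq)
    qed
    have tan: "q s \<le> q t + slope * (s - t)" for s
    proof -
      have "0 \<le> (s - t)\<^sup>2 / (2 * (\<gamma> - 1))" using g1 by simp
      then show ?thesis using q_tan[of t s] by (simp add: slope_def)
    qed
    have "scad lam \<gamma> s \<le> scad lam \<gamma> t + slope * (s - t)" if s: "0 \<le> s" for s
    proof -
      have st: "scad lam \<gamma> t = q t" using 2 t by (simp add: scad)
      consider "s \<le> lam" | "lam < s" "s \<le> \<gamma> * lam" | "\<gamma> * lam < s" by linarith
      then show ?thesis
      proof cases
        case 1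
        have "lam * s = q lam + lam * (s - lam)"
          using q_lin[of lam] by (simp add: algebra_simps)
        also have "\<dots> \<le> q lam + slope * (s - lam)"
          using 1 slope by (simp add: mult_right_mono_neg)
        also have "\<dots> \<le> q t + slope * (s - t)"
          using tan[of lam] by (simp add: algebra_simps)
        finally show ?thesis using 1 s st by (simp add: scad)
      next
        case 2
        then show ?thesis using tan[of s] s st by (simp add: scad)
      next
        case 3
        have "(\<gamma> + 1) * lam\<^sup>2 / 2 = q (\<gamma> * lam)" using q_top[of "\<gamma> * lam"] by simp
        also have "\<dots> \<le> q t + slope * (\<gamma> * lam - t)" by (rule tan)
        also have "\<dots> \<le> q t + slope * (s - t)"
          using slope 3 by (intro add_left_mono mult_left_mono) auto
        finally show ?thesis using 3 s st lg by (simp add: scad)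
      qed
    qed
    moreover have "scad lam \<gamma> t = - lam\<^sup>2 / (2 * (\<gamma> - 1)) + \<gamma> * lam / (\<gamma> - 1) * t + - 1 / (\<gamma> - 1) * t\<^sup>2 / 2"
    proof -
      define e where "e = \<gamma> - 1"
      have "e \<noteq> 0" using g1 by (simp add: e_def)
      then have "q t = - lam\<^sup>2 / (2 * e) + \<gamma> * lam / e * t + - 1 / e * t\<^sup>2 / 2"
        unfolding q_def e_def[symmetric] by (simp add: field_simps)
      then show ?thesis using 2 t by (simp add: scad e_def)
    qed
    ultimately have "piece_at (scad lam \<gamma>) t (- lam\<^sup>2 / (2 * (\<gamma> - 1)), \<gamma> * lam / (\<gamma> - 1), - 1 / (\<gamma> - 1))"
      using t g1 by (intro piece_at_pos) (auto simp: slope_def)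
    then show ?thesis by blast
  next
    case 3
    then have "piece_at (scad lam \<gamma>) t ((\<gamma> + 1) * lam\<^sup>2 / 2, 0, 0)"
      using t top lg by (intro piece_at_pos) (auto simp: scad)
    then show ?thesis by blast
  qed
qed

text \<open>The point 0 is left out because the kink there is convex and admits no supergradient;
  coordinates at 0 will be held fixed instead.\<close>

lemma penalty_finite_pieces:
  assumes "0 < lam" and pen: "(\<gamma> \<ge> 1 \<and> pen = mcp lam \<gamma>) \<or> (\<gamma> \<ge> 2 \<and> pen = scad lam \<gamma>)"
  shows "\<exists>Q. finite Q \<and> (\<forall>t. t \<noteq> 0 \<longrightarrow> (\<exists>k\<in>Q. piece_at pen t k))"
proof -
  have even: "pen (- t) = pen t" for t
    using pen by (auto simp: mcp_def scad_def)
  have "\<exists>Q. finite Q \<and> (\<forall>t>0. \<exists>k\<in>Q. piece_at pen t k)"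
    using pen
  proof
    assume "\<gamma> \<ge> 1 \<and> pen = mcp lam \<gamma>"
    then show ?thesis
      using mcp_pieces[OF assms(1), of \<gamma>]
      by (intro exI[of _ "{(0, lam, - 1 / \<gamma>), (\<gamma> * lam\<^sup>2 / 2, 0, 0)}"]) auto
  next
    assume "\<gamma> \<ge> 2 \<and> pen = scad lam \<gamma>"
    then show ?thesis
      using scad_pieces[OF assms(1), of \<gamma>]
      by (intro exI[of _ "{(0, lam, 0), (- lam\<^sup>2 / (2 * (\<gamma> - 1)), \<gamma> * lam / (\<gamma> - 1), - 1 / (\<gamma> - 1)),
            ((\<gamma> + 1) * lam\<^sup>2 / 2, 0, 0)}"]) auto
  qed
  then obtain Q where Q: "finite Q" "\<And>t. t > 0 \<Longrightarrow> \<exists>k\<in>Q. piece_at pen t k" by blast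
  define Q' where "Q' = Q \<union> (\<lambda>(k0, k1, k2). (k0, - k1, k2)) ` Q"
  have "\<exists>k\<in>Q'. piece_at pen t k" if nz: "t \<noteq> 0" for t
  proof (cases "t > 0")
    case True
    then show ?thesis using Q(2) by (auto simp: Q'_def)
  next
    case False
    then obtain k where k: "k \<in> Q" "piece_at pen (- t) k"
      using Q(2)[of "- t"] nz by auto
    obtain k0 k1 k2 where eq: "k = (k0, k1, k2)" by (cases k)
    have "(k0, - k1, k2) \<in> Q'"
      using k(1) unfolding Q'_def eq by (auto intro: image_eqI[of _ _ "(k0, k1, k2)"])
    then show ?thesis
      using piece_at_even[of pen, OF even, of "- t" k0 k1 k2] k(2) by (auto simp: eq)
  qed
  with Q(1) show ?thesis by (intro exI[of _ Q']) (auto simp: Q'_def)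
qed

lemma pen_nonneg:
  assumes "0 < lam" and pen: "(\<gamma> \<ge> 1 \<and> pen = mcp lam \<gamma>) \<or> (\<gamma> \<ge> 2 \<and> pen = scad lam \<gamma>)"
  shows "0 \<le> pen t" "pen 0 = 0"
proof -
  show "pen 0 = 0" using assms by (auto simp: mcp_def scad_def)
  show "0 \<le> pen t"
    using pen
  proof
    assume *: "\<gamma> \<ge> 1 \<and> pen = mcp lam \<gamma>"
    have "0 \<le> lam * \<bar>t\<bar> - t\<^sup>2 / (2 * \<gamma>)" if "\<bar>t\<bar> \<le> \<gamma> * lam"
    proof -
      have "\<bar>t\<bar> * \<bar>t\<bar> \<le> \<gamma> * lam * \<bar>t\<bar>" using that by (intro mult_right_mono) auto
      also have "\<dots> \<le> 2 * (\<gamma> * lam * \<bar>t\<bar>)" using * assms(1) by simp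
      finally show ?thesis using * by (simp add: power2_eq_square pos_divide_le_eq mult_ac)
    qed
    with * show ?thesis by (auto simp: mcp_def)
  next
    assume *: "\<gamma> \<ge> 2 \<and> pen = scad lam \<gamma>"
    have "t\<^sup>2 - 2 * \<gamma> * lam * \<bar>t\<bar> + lam\<^sup>2 \<le> 0" if "lam < \<bar>t\<bar>" "\<bar>t\<bar> \<le> \<gamma> * lam"
    proof -
      have "\<bar>t\<bar> * \<bar>t\<bar> \<le> \<gamma> * lam * \<bar>t\<bar>" using that by (intro mult_right_mono) auto
      moreover have "lam * lam \<le> lam * \<bar>t\<bar>" using that assms(1) by (intro mult_left_mono) auto
      moreover have "1 * (lam * \<bar>t\<bar>) \<le> \<gamma> * (lam * \<bar>t\<bar>)" using * assms(1) by (intro mult_right_mono) auto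
      ultimately show ?thesis by (simp add: power2_eq_square)
    qed
    with * assms(1) show ?thesis by (auto simp: scad_def divide_nonpos_pos)
  qed
qed

section \<open>Smoothed losses and the proximal gradient iteration\<close>

lemma coeff_eq_0_of_local_min:
  fixes A B :: real
  assumes "\<forall>\<^sub>F s in at 0. 0 \<le> s * A + s\<^sup>2 * B"
  shows "A = 0"
proof (rule ccontr)
  assume A: "A \<noteq> 0"
  obtain d where d: "d > 0" "\<And>s. s \<noteq> 0 \<Longrightarrow> \<bar>s\<bar> < d \<Longrightarrow> 0 \<le> s * A + s\<^sup>2 * B"
    using assms unfolding eventually_at by (auto simp: dist_real_def)
  \<comment> \<open>The test point is \<open>s = - r * A\<close>. The first bound on
    \<open>r\<close> keeps it in the neighbourhood, the second makes \<open>r * B\<close> at most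
    1/2, too small for the quadratic term to offset the linear one.\<close>
  define r where "r = min (d / (2 * \<bar>A\<bar>)) (1 / (2 * (\<bar>B\<bar> + 1)))"
  have r: "0 < r" "r \<le> d / (2 * \<bar>A\<bar>)" "r \<le> 1 / (2 * (\<bar>B\<bar> + 1))"
    using A d(1) by (auto simp: r_def)
  have "r * \<bar>A\<bar> \<le> d / 2" using r(2) A by (simp add: field_simps)
  then have "\<bar>- r * A\<bar> < d" using d(1) r(1) by (simp add: abs_mult)
  then have "0 \<le> (- r * A) * A + (- r * A)\<^sup>2 * B"
    using A r(1) by (intro d(2)) auto
  also have "\<dots> = r * A\<^sup>2 * (r * B - 1)"
    by (simp add: power2_eq_square algebra_simps)
  finally have "0 \<le> r * A\<^sup>2 * (r * B - 1)" .
  moreover have "0 < r * A\<^sup>2" using r(1) A by simp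
  ultimately have "1 \<le> r * B"
    unfolding zero_le_mult_iff by linarith
  also have "r * B \<le> r * (\<bar>B\<bar> + 1)" using r(1) by (intro mult_left_mono) auto
  also have "\<dots> \<le> 1 / 2" using r(3) by (simp add: field_simps)
  finally show False by simp
qed

text \<open>Used in two ways: for each client, where limits of gradients give subgradients of that
  client's loss, and for all samples together, where the iteration takes place.\<close>

locale smoothed_loss =
  fixes I :: "'i set" and X :: "'i \<Rightarrow> 'a::euclidean_space" and y :: "'i \<Rightarrow> real" and \<tau> :: real
  assumes I: "finite I" and \<tau>: "0 < \<tau>" "\<tau> < 1"
begin

definition res :: "'i \<Rightarrow> 'a \<Rightarrow> real" where "res i v = y i - X i \<bullet> v"

definition loss :: "'a \<Rightarrow> real \<Rightarrow> real" where
  "loss v \<nu> = (\<Sum>i\<in>I. fsmooth (res i v) \<nu> / 2 + (\<tau> - 1/2) * res i v)"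

definition exact_loss :: "'a \<Rightarrow> real" where
  "exact_loss v = (\<Sum>i\<in>I. \<bar>res i v\<bar> / 2 + (\<tau> - 1/2) * res i v)"

definition gradient :: "'a \<Rightarrow> real \<Rightarrow> 'a" where
  "gradient v \<nu> = - (\<Sum>i\<in>I. (clip (res i v) \<nu> / 2 + (\<tau> - 1/2)) *\<^sub>R X i)"

lemma res_diff: "res i v' - res i v = - (X i \<bullet> (v' - v))"
  by (simp add: res_def inner_diff_right)

lemma gradient_inner: "gradient v \<nu> \<bullet> h = (\<Sum>i\<in>I. - (clip (res i v) \<nu> / 2 + (\<tau> - 1/2)) * (X i \<bullet> h))"
  by (simp only: gradient_def inner_minus_left inner_sum_left inner_scaleR_left sum_negf[symmetric] mult_minus_left)

lemma loss_tangent_le: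
  assumes "0 < \<nu>"
  shows "loss v \<nu> + gradient v \<nu> \<bullet> (v' - v) \<le> loss v' \<nu>"
proof -
  have "loss v \<nu> + gradient v \<nu> \<bullet> (v' - v)
    = (\<Sum>i\<in>I. (fsmooth (res i v) \<nu> + clip (res i v) \<nu> * (res i v' - res i v)) / 2 + (\<tau> - 1/2) * res i v')"
    unfolding loss_def gradient_inner sum.distrib[symmetric]
  proof (intro sum.cong refl)
    fix i
    have X: "X i \<bullet> (v' - v) = res i v - res i v'" using res_diff[of i v' v] by simp
    show "fsmooth (res i v) \<nu> / 2 + (\<tau> - 1/2) * res i v + - (clip (res i v) \<nu> / 2 + (\<tau> - 1/2)) * (X i \<bullet> (v' - v))
      = (fsmooth (res i v) \<nu> + clip (res i v) \<nu> * (res i v' - res i v)) / 2 + (\<tau> - 1/2) * res i v'"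
      unfolding X by (simp add: field_simps)
  qed
  also have "\<dots> \<le> loss v' \<nu>"
    unfolding loss_def by (intro sum_mono add_right_mono divide_right_mono fsmooth_tangent_le assms) auto
  finally show ?thesis .
qed

lemma loss_le_quadratic:
  assumes "0 < \<nu>"
  shows "loss v' \<nu> \<le> loss v \<nu> + gradient v \<nu> \<bullet> (v' - v) + (\<Sum>i\<in>I. (X i \<bullet> (v' - v))\<^sup>2) / (4 * \<nu>)"
proof -
  have "loss v' \<nu> \<le> (\<Sum>i\<in>I. (fsmooth (res i v) \<nu> + clip (res i v) \<nu> * (res i v' - res i v)
      + (res i v' - res i v)\<^sup>2 / (2 * \<nu>)) / 2 + (\<tau> - 1/2) * res i v')"
    unfolding loss_def by (intro sum_mono add_right_mono divide_right_mono fsmooth_le_quadratic assms) auto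
  also have "\<dots> = loss v \<nu> + gradient v \<nu> \<bullet> (v' - v) + (\<Sum>i\<in>I. (X i \<bullet> (v' - v))\<^sup>2) / (4 * \<nu>)"
    unfolding loss_def gradient_inner sum_divide_distrib sum.distrib[symmetric]
  proof (intro sum.cong refl)
    fix i
    have X: "X i \<bullet> (v' - v) = res i v - res i v'" using res_diff[of i v' v] by simp
    show "(fsmooth (res i v) \<nu> + clip (res i v) \<nu> * (res i v' - res i v)
      + (res i v' - res i v)\<^sup>2 / (2 * \<nu>)) / 2 + (\<tau> - 1/2) * res i v'
     = fsmooth (res i v) \<nu> / 2 + (\<tau> - 1/2) * res i v + - (clip (res i v) \<nu> / 2 + (\<tau> - 1/2)) * (X i \<bullet> (v' - v))
        + (X i \<bullet> (v' - v))\<^sup>2 / (4 * \<nu>)"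
      unfolding X using assms by (simp add: power2_commute[of "res i v"] field_simps)
  qed
  finally show ?thesis .
qed

lemma loss_mono: "0 < \<nu>' \<Longrightarrow> \<nu>' \<le> \<nu> \<Longrightarrow> loss v \<nu>' \<le> loss v \<nu>"
  unfolding loss_def by (intro sum_mono add_right_mono divide_right_mono fsmooth_mono) auto

lemma loss_nonneg: "0 < \<nu> \<Longrightarrow> 0 \<le> loss v \<nu>"
  unfolding loss_def
proof (rule sum_nonneg)
  fix i assume \<nu>: "0 < \<nu>"
  have "\<bar>(\<tau> - 1/2) * res i v\<bar> \<le> (1/2) * \<bar>res i v\<bar>"
    unfolding abs_mult using \<tau> by (intro mult_right_mono abs_leI) auto
  then show "0 \<le> fsmooth (res i v) \<nu> / 2 + (\<tau> - 1/2) * res i v"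
    using abs_le_fsmooth[OF \<nu>, of "res i v"] by linarith
qed

text \<open>A crude constant is enough, as it only scales the bound on the gradient after a step;
  the descent estimate relies on the exact quadratic form in
  \<open>loss_le_quadratic\<close>.\<close>

lemma gradient_lipschitz:
  assumes "0 < \<nu>"
  shows "norm (gradient v' \<nu> - gradient v \<nu>) \<le> (\<Sum>i\<in>I. (norm (X i))\<^sup>2) / (2 * \<nu>) * norm (v' - v)"
proof -
  have "gradient v' \<nu> - gradient v \<nu> = (\<Sum>i\<in>I. ((clip (res i v) \<nu> - clip (res i v') \<nu>) / 2) *\<^sub>R X i)"
    unfolding gradient_def minus_diff_minus sum_subtractf[symmetric] sum_negf[symmetric]
    by (intro sum.cong refl) (simp add: scaleR_left_diff_distrib[symmetric] scaleR_minus_left[symmetric]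
        diff_divide_distrib del: scaleR_minus_left)
  also have "norm \<dots> \<le> (\<Sum>i\<in>I. (norm (X i))\<^sup>2 / (2 * \<nu>) * norm (v' - v))"
  proof (rule sum_norm_le)
    fix i
    have "\<bar>clip (res i v) \<nu> - clip (res i v') \<nu>\<bar> \<le> \<bar>X i \<bullet> (v' - v)\<bar> / \<nu>"
      using clip_lipschitz[OF assms, of "res i v" "res i v'"]
      by (metis abs_minus_cancel abs_minus_commute res_diff)
    also have "\<dots> \<le> norm (X i) * norm (v' - v) / \<nu>"
      using assms by (intro divide_right_mono Cauchy_Schwarz_ineq2) auto
    finally have "\<bar>clip (res i v) \<nu> - clip (res i v') \<nu>\<bar> / 2 * norm (X i)
        \<le> norm (X i) * norm (v' - v) / \<nu> / 2 * norm (X i)"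
      by (intro mult_right_mono divide_right_mono) auto
    then show "norm (((clip (res i v) \<nu> - clip (res i v') \<nu>) / 2) *\<^sub>R X i) \<le> (norm (X i))\<^sup>2 / (2 * \<nu>) * norm (v' - v)"
      by (simp add: power2_eq_square mult_ac)
  qed
  finally show ?thesis
    by (simp add: sum_distrib_right sum_divide_distrib)
qed

lemma loss_has_derivative:
  assumes "0 < \<nu>"
  shows "((\<lambda>v. loss v \<nu>) has_derivative (\<lambda>h. gradient v \<nu> \<bullet> h)) (at v)"
proof (rule has_derivative_of_quadratic_bound)
  fix v'
  have "(\<Sum>i\<in>I. (X i \<bullet> (v' - v))\<^sup>2) / (4 * \<nu>) \<le> (\<Sum>i\<in>I. (norm (X i))\<^sup>2 * (norm (v' - v))\<^sup>2) / (4 * \<nu>)"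
  proof (intro divide_right_mono sum_mono)
    fix i
    have "\<bar>X i \<bullet> (v' - v)\<bar>\<^sup>2 \<le> (norm (X i) * norm (v' - v))\<^sup>2"
      by (intro power_mono Cauchy_Schwarz_ineq2) auto
    then show "(X i \<bullet> (v' - v))\<^sup>2 \<le> (norm (X i))\<^sup>2 * (norm (v' - v))\<^sup>2"
      by (simp add: power_mult_distrib)
  qed (use assms in simp)
  also have "\<dots> = (\<Sum>i\<in>I. (norm (X i))\<^sup>2) / (4 * \<nu>) * (norm (v' - v))\<^sup>2"
    by (simp add: sum_distrib_right)
  finally show "\<bar>loss v' \<nu> - loss v \<nu> - gradient v \<nu> \<bullet> (v' - v)\<bar>
      \<le> (\<Sum>i\<in>I. (norm (X i))\<^sup>2) / (4 * \<nu>) * (norm (v' - v))\<^sup>2"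
    using loss_tangent_le[OF assms, of v v'] loss_le_quadratic[OF assms, of v' v] by linarith
qed

lemma norm_gradient_le: "norm (gradient v \<nu>) \<le> (\<Sum>i\<in>I. norm (X i))"
proof -
  have "norm (\<Sum>i\<in>I. (clip (res i v) \<nu> / 2 + (\<tau> - 1/2)) *\<^sub>R X i) \<le> (\<Sum>i\<in>I. norm (X i))"
  proof (rule sum_norm_le)
    fix i
    have "\<bar>clip (res i v) \<nu> / 2 + (\<tau> - 1/2)\<bar> \<le> 1"
      using abs_clip_le_1[of "res i v" \<nu>] \<tau> by linarith
    then show "norm ((clip (res i v) \<nu> / 2 + (\<tau> - 1/2)) *\<^sub>R X i) \<le> norm (X i)"
      by (simp add: mult_left_le_one_le)
  qed
  then show ?thesis by (simp add: gradient_def)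
qed

lemma loss_near_exact:
  fixes \<nu> :: real
  assumes "0 < \<nu>"
  shows "exact_loss v \<le> loss v \<nu>" "loss v \<nu> \<le> exact_loss v + card I * \<nu> / 4"
proof -
  show "exact_loss v \<le> loss v \<nu>"
    unfolding exact_loss_def loss_def
    by (intro sum_mono add_right_mono divide_right_mono abs_le_fsmooth assms) auto
  have "loss v \<nu> \<le> (\<Sum>i\<in>I. (\<bar>res i v\<bar> / 2 + (\<tau> - 1/2) * res i v) + \<nu> / 4)"
    unfolding loss_def
  proof (rule sum_mono)
    fix i
    show "fsmooth (res i v) \<nu> / 2 + (\<tau> - 1/2) * res i v \<le> (\<bar>res i v\<bar> / 2 + (\<tau> - 1/2) * res i v) + \<nu> / 4"
      using fsmooth_le_abs[OF assms, of "res i v"] by linarith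
  qed
  then show "loss v \<nu> \<le> exact_loss v + card I * \<nu> / 4"
    by (simp add: exact_loss_def sum.distrib)
qed

text \<open>The tangent inequality of the smoothed loss passes to the limit, because smoothing
  raises the loss by at most \<open>card I * \<nu> / 4\<close>.\<close>

lemma limit_in_convex_subdiff:
  assumes \<nu>: "\<And>k. 0 < \<nu> k" "\<nu> \<longlonglongrightarrow> 0" and v: "v \<longlonglongrightarrow> v'"
    and G: "(\<lambda>k. gradient (v k) (\<nu> k)) \<longlonglongrightarrow> G"
  shows "G \<in> convex_subdiff exact_loss v'"
  unfolding convex_subdiff_def mem_Collect_eq
proof
  fix z
  have le: "exact_loss (v k) + gradient (v k) (\<nu> k) \<bullet> (z - v k) \<le> exact_loss z + card I * \<nu> k / 4" for k
    using loss_tangent_le[OF \<nu>(1)[of k], of "v k" z] loss_near_exact[OF \<nu>(1)[of k]] by (meson add_right_mono order_trans)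
  have "(\<lambda>k. exact_loss (v k)) \<longlonglongrightarrow> exact_loss v'"
    unfolding exact_loss_def res_def by (intro tendsto_intros v) auto
  then have "(\<lambda>k. exact_loss (v k) + gradient (v k) (\<nu> k) \<bullet> (z - v k)) \<longlonglongrightarrow> exact_loss v' + G \<bullet> (z - v')"
    by (intro tendsto_intros G v)
  moreover have "(\<lambda>k. exact_loss z + card I * \<nu> k / 4) \<longlonglongrightarrow> exact_loss z + real (card I) * 0 / 4"
    by (intro tendsto_add tendsto_divide tendsto_mult tendsto_const \<nu>(2)) simp
  ultimately have "exact_loss v' + G \<bullet> (z - v') \<le> exact_loss z + real (card I) * 0 / 4"
    using le by (intro LIMSEQ_le) auto
  then show "exact_loss v' + G \<bullet> (z - v') \<le> exact_loss z" by simp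
qed

end

text \<open>The paper's \<open>\<sigma>\<^sup>(k + 1)\<close> and \<open>\<mu>\<^sup>(k + 1)\<close> are \<open>a k\<close> and \<open>\<mu> k\<close> here, and its \<open>n\<close> is \<open>N\<close>.\<close>

locale smoothed_proximal_gradient = smoothed_loss I X y \<tau>
  for I :: "'i set" and X :: "'i \<Rightarrow> 'a::euclidean_space" and y :: "'i \<Rightarrow> real" and \<tau> :: real +
  fixes J :: "'j set" and E :: "'j \<Rightarrow> 'a" and pen :: "real \<Rightarrow> real" and Q :: "(real \<times> real \<times> real) set"
    and N c \<beta> d \<rho> :: real and w :: "nat \<Rightarrow> 'a" and a \<mu> :: "nat \<Rightarrow> real"
  assumes J: "finite J" and N: "0 \<le> N"
    and Q: "finite Q" "\<And>t. t \<noteq> 0 \<Longrightarrow> \<exists>k\<in>Q. piece_at pen t k"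
    and pen: "\<And>t. 0 \<le> pen t" "pen 0 = 0"
    and params: "0 < c" "0 < \<beta>" "0 < d" "d < 1"
    and a_def: "\<And>k. a k = c * real (Suc k) powr d" and \<mu>_def: "\<And>k. \<mu> k = \<beta> / real (Suc k) powr d"
    and rayleigh: "\<And>h. (\<Sum>i\<in>I. (X i \<bullet> h)\<^sup>2) \<le> 2 * (c * \<beta>) * (norm h)\<^sup>2"
    and weak: "convex_on UNIV (\<lambda>v. (\<Sum>j\<in>J. pen (E j \<bullet> v)) + \<rho> / 2 * (norm v)\<^sup>2)"
    and iter: "\<And>k v. gradient (w k) (\<mu> k) \<bullet> (w (Suc k) - w k)
        + N * (\<Sum>j\<in>J. pen (E j \<bullet> w (Suc k))) + a k / 2 * (norm (w (Suc k) - w k))\<^sup>2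
      \<le> gradient (w k) (\<mu> k) \<bullet> (v - w k) + N * (\<Sum>j\<in>J. pen (E j \<bullet> v)) + a k / 2 * (norm (v - w k))\<^sup>2"
begin

definition reg :: "'a \<Rightarrow> real" where "reg v = (\<Sum>j\<in>J. pen (E j \<bullet> v))"

definition obj :: "'a \<Rightarrow> real \<Rightarrow> real" where "obj v \<nu> = loss v \<nu> + N * reg v"

lemma iterate_min:
  "gradient (w k) (\<mu> k) \<bullet> (w (Suc k) - w k) + N * reg (w (Suc k)) + a k / 2 * (norm (w (Suc k) - w k))\<^sup>2
    \<le> gradient (w k) (\<mu> k) \<bullet> (v - w k) + N * reg v + a k / 2 * (norm (v - w k))\<^sup>2"
  using iter[of k v] by (simp add: reg_def)

lemma reg_nonneg: "0 \<le> reg v"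
  unfolding reg_def by (intro sum_nonneg pen)

lemma a_pos: "0 < a k" "c \<le> a k" and \<mu>_pos: "0 < \<mu> k" and a_mult_\<mu>: "a k * \<mu> k = c * \<beta>"
proof -
  have "1 \<le> real (Suc k) powr d" using params by (intro ge_one_powr_ge_zero) auto
  then show "c \<le> a k" using params by (simp add: a_def)
  then show "0 < a k" using params by simp
  show "0 < \<mu> k" using params by (simp add: \<mu>_def)
  show "a k * \<mu> k = c * \<beta>" by (simp add: a_def \<mu>_def)
qed

text \<open>Because \<open>d < 1\<close>, the relative drop of \<open>\<mu>\<close> is no larger
  than that of the sequence \<open>1 / (k + 1)\<close>. The last bound fixes the scale used in the
  Lyapunov function, and the middle one keeps each update within the range of
  \<open>relative_variation\<close>.\<close>

lemma \<mu>_Suc: "\<mu> (Suc k) \<le> \<mu> k" "\<mu> k / 2 \<le> \<mu> (Suc k)" "\<mu> k - \<mu> (Suc k) \<le> 1 / real (Suc k) * \<mu> k"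
proof -
  define q where "q = real (Suc k) / real (Suc (Suc k))"
  have q: "0 < q" "q \<le> 1" "1 / 2 \<le> q" "1 - q \<le> 1 / real (Suc k)"
    by (auto simp: q_def field_simps)
  have eq: "\<mu> (Suc k) = q powr d * \<mu> k"
    by (simp add: \<mu>_def q_def powr_divide)
  have qd: "q \<le> q powr d"
    using powr_mono'[of d 1 q] q params by simp
  have "q powr d \<le> 1" using q params by (intro powr_le1) auto
  then show "\<mu> (Suc k) \<le> \<mu> k"
    using \<mu>_pos[of k] by (simp add: eq mult_left_le_one_le)
  show "\<mu> k / 2 \<le> \<mu> (Suc k)"
    using mult_right_mono[of "1/2" "q powr d" "\<mu> k"] q qd \<mu>_pos[of k] by (simp add: eq)
  have "\<mu> k - \<mu> (Suc k) = (1 - q powr d) * \<mu> k" by (simp add: eq algebra_simps)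
  also have "\<dots> \<le> 1 / real (Suc k) * \<mu> k"
    using q qd \<mu>_pos[of k] by (intro mult_right_mono) auto
  finally show "\<mu> k - \<mu> (Suc k) \<le> 1 / real (Suc k) * \<mu> k" .
qed

lemma filterlim_real_Suc: "filterlim (\<lambda>k. real (Suc k)) at_top sequentially"
  by (rule filterlim_compose[OF filterlim_real_sequentially filterlim_Suc])

lemma \<mu>_tendsto_0: "\<mu> \<longlonglongrightarrow> 0"
proof -
  have "(\<lambda>k. \<beta> * real (Suc k) powr (- d)) \<longlonglongrightarrow> \<beta> * 0"
    using params by (intro tendsto_mult tendsto_const tendsto_neg_powr filterlim_real_Suc) auto
  then show ?thesis by (simp add: \<mu>_def[abs_def] powr_minus_divide)
qed

lemma a_at_top: "filterlim a at_top sequentially"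
proof -
  have "filterlim (\<lambda>k. inverse (\<mu> k)) at_top sequentially"
    using \<mu>_pos by (intro filterlim_inverse_at_top[OF \<mu>_tendsto_0]) auto
  then have "filterlim (\<lambda>k. c * \<beta> * inverse (\<mu> k)) at_top sequentially"
    using params by (intro filterlim_tendsto_pos_mult_at_top[OF tendsto_const]) auto
  moreover have "a k = c * \<beta> * inverse (\<mu> k)" for k
    using a_mult_\<mu>[of k] \<mu>_pos[of k] by (simp add: field_simps)
  ultimately show ?thesis by presburger
qed

text \<open>In units of the squared step, the quadratic upper bound of the loss may cost
  \<open>a k / 2\<close>, all that minimality against \<open>w k\<close> would gain. Against the
  midpoint, weak convexity of the penalty gives a gain of
  \<open>3/4 * a k - 1/4 * (N * \<rho>)\<close>. Eventually \<open>2 * N * \<rho> \<le> a k\<close>,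
  as \<open>a\<close> tends to infinity, and \<open>a k / 8\<close> remains.\<close>

lemma sufficient_decrease:
  "\<forall>\<^sub>F k in sequentially. obj (w (Suc k)) (\<mu> k) \<le> obj (w k) (\<mu> k) - 1/8 * (a k * norm (w (Suc k) - w k))\<^sup>2 / a k"
proof -
  have "\<forall>\<^sub>F k in sequentially. 2 * N * \<rho> \<le> a k"
    using a_at_top by (simp add: filterlim_at_top)
  then show ?thesis
  proof eventually_elim
    case (elim k)
    define \<Delta> where "\<Delta> = w (Suc k) - w k"
    define v where "v = (1/2) *\<^sub>R w (Suc k) + (1/2) *\<^sub>R w k"
    have half: "(1/2) *\<^sub>R w k + (1/2) *\<^sub>R w k = w k" by (simp flip: scaleR_add_left)
    have "v - ((1/2) *\<^sub>R w k + (1/2) *\<^sub>R w k) = (1/2) *\<^sub>R \<Delta>"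
      by (simp add: v_def \<Delta>_def scaleR_diff_right)
    then have v: "v - w k = (1/2) *\<^sub>R \<Delta>" unfolding half .
    have "reg v + \<rho> / 2 * (norm v)\<^sup>2
      \<le> 1/2 * (reg (w (Suc k)) + \<rho> / 2 * (norm (w (Suc k)))\<^sup>2) + 1/2 * (reg (w k) + \<rho> / 2 * (norm (w k))\<^sup>2)"
      using convex_onD[OF weak, of "1/2" "w (Suc k)" "w k"] by (simp add: v_def reg_def)
    moreover have "(norm v)\<^sup>2 = 1/2 * (norm (w (Suc k)))\<^sup>2 + 1/2 * (norm (w k))\<^sup>2 - 1/4 * (norm \<Delta>)\<^sup>2"
      unfolding power2_norm_eq_inner v_def \<Delta>_def
      by (simp add: inner_add_left inner_add_right inner_diff_left inner_diff_right inner_commute field_simps)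
    ultimately have "reg v \<le> 1/2 * reg (w (Suc k)) + 1/2 * reg (w k) + \<rho> / 8 * (norm \<Delta>)\<^sup>2"
      by (simp add: algebra_simps)
    from mult_left_mono[OF this N]
    have reg_v: "N * reg v \<le> 1/2 * (N * reg (w (Suc k))) + 1/2 * (N * reg (w k)) + N * \<rho> / 8 * (norm \<Delta>)\<^sup>2"
      by (simp add: algebra_simps)
    have "gradient (w k) (\<mu> k) \<bullet> \<Delta> + N * reg (w (Suc k)) + a k / 2 * (norm \<Delta>)\<^sup>2
        \<le> 1/2 * (gradient (w k) (\<mu> k) \<bullet> \<Delta>) + N * reg v + a k / 8 * (norm \<Delta>)\<^sup>2"
      using iterate_min[of k v] unfolding v \<Delta>_def[symmetric] by (simp add: power2_eq_square)
    with reg_v have 1: "gradient (w k) (\<mu> k) \<bullet> \<Delta> + N * reg (w (Suc k))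
        \<le> N * reg (w k) - 3/4 * (a k * (norm \<Delta>)\<^sup>2) + 1/4 * (N * \<rho> * (norm \<Delta>)\<^sup>2)"
      by (simp add: field_simps)
    have "(\<Sum>i\<in>I. (X i \<bullet> \<Delta>)\<^sup>2) / (4 * \<mu> k) \<le> 2 * (c * \<beta>) * (norm \<Delta>)\<^sup>2 / (4 * \<mu> k)"
      using rayleigh \<mu>_pos[of k] by (intro divide_right_mono) auto
    also have "\<dots> = 1/2 * (a k * (norm \<Delta>)\<^sup>2)"
      using \<mu>_pos[of k] by (simp add: a_mult_\<mu>[of k, symmetric])
    finally have 2: "loss (w (Suc k)) (\<mu> k) \<le> loss (w k) (\<mu> k) + gradient (w k) (\<mu> k) \<bullet> \<Delta> + 1/2 * (a k * (norm \<Delta>)\<^sup>2)"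
      using loss_le_quadratic[OF \<mu>_pos[of k], of "w (Suc k)" "w k"] unfolding \<Delta>_def by linarith
    have 3: "2 * N * \<rho> * (norm \<Delta>)\<^sup>2 \<le> a k * (norm \<Delta>)\<^sup>2"
      using elim by (intro mult_right_mono) auto
    have "obj (w (Suc k)) (\<mu> k) \<le> obj (w k) (\<mu> k) - 1/8 * (a k * (norm \<Delta>)\<^sup>2)"
      using 1 2 3 unfolding obj_def by linarith
    then show ?case
      using a_pos(1)[of k] by (simp add: \<Delta>_def power2_eq_square mult_ac)
  qed
qed

text \<open>Directions that keep the zero coordinates at zero avoid the kinks. Along them the
  supergradients bound the subproblem from above by a quadratic that touches it at the minimizer;
  both signs of the displacement are allowed, so the linear coefficient vanishes.\<close>

lemma first_order_optimality:
  assumes slope: "\<And>j. j \<in> J \<Longrightarrow> E j \<bullet> w (Suc k) \<noteq> 0 \<Longrightarrow>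
      \<exists>\<delta>>0. \<forall>s. \<bar>s - E j \<bullet> w (Suc k)\<bar> < \<delta> \<longrightarrow> pen s \<le> pen (E j \<bullet> w (Suc k)) + g j * (s - E j \<bullet> w (Suc k))"
    and h: "\<And>j. j \<in> J \<Longrightarrow> E j \<bullet> w (Suc k) = 0 \<Longrightarrow> E j \<bullet> h = 0"
  shows "gradient (w k) (\<mu> k) \<bullet> h + a k * ((w (Suc k) - w k) \<bullet> h)
     + N * (\<Sum>j\<in>J. if E j \<bullet> w (Suc k) = 0 then 0 else g j * (E j \<bullet> h)) = 0"
proof -
  let ?w = "w (Suc k)"
  define S where "S = (\<Sum>j\<in>J. if E j \<bullet> ?w = 0 then 0 else g j * (E j \<bullet> h))"
  have "\<forall>\<^sub>F s in at 0. pen (E j \<bullet> (?w + s *\<^sub>R h)) \<le> pen (E j \<bullet> ?w) + s * (if E j \<bullet> ?w = 0 then 0 else g j * (E j \<bullet> h))"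
    if j: "j \<in> J" for j
  proof (cases "E j \<bullet> ?w = 0")
    case True
    then show ?thesis using h[OF j] by (simp add: inner_add_right)
  next
    case False
    obtain \<delta> where \<delta>: "\<delta> > 0" "\<And>s. \<bar>s - E j \<bullet> ?w\<bar> < \<delta> \<Longrightarrow> pen s \<le> pen (E j \<bullet> ?w) + g j * (s - E j \<bullet> ?w)"
      using slope[OF j False] by blast
    have "((\<lambda>s. E j \<bullet> (?w + s *\<^sub>R h)) \<longlongrightarrow> E j \<bullet> (?w + 0 *\<^sub>R h)) (at 0)"
      by (intro tendsto_intros)
    then have "\<forall>\<^sub>F s in at 0. dist (E j \<bullet> (?w + s *\<^sub>R h)) (E j \<bullet> (?w + 0 *\<^sub>R h)) < \<delta>"
      using \<delta>(1) by (rule tendstoD)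
    then show ?thesis
    proof eventually_elim
      case (elim s)
      then show ?case
        using \<delta>(2)[of "E j \<bullet> (?w + s *\<^sub>R h)"] False by (simp add: dist_real_def inner_add_right mult_ac)
    qed
  qed
  then have "\<forall>\<^sub>F s in at 0. \<forall>j\<in>J. pen (E j \<bullet> (?w + s *\<^sub>R h))
      \<le> pen (E j \<bullet> ?w) + s * (if E j \<bullet> ?w = 0 then 0 else g j * (E j \<bullet> h))"
    using J by (intro eventually_ball_finite) auto
  then have "\<forall>\<^sub>F s in at 0. 0 \<le> s * (gradient (w k) (\<mu> k) \<bullet> h + a k * ((?w - w k) \<bullet> h) + N * S)
      + s\<^sup>2 * (a k / 2 * (norm h)\<^sup>2)"
  proof eventually_elim
    case (elim s)
    have "reg (?w + s *\<^sub>R h) \<le> reg ?w + s * S"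
      unfolding reg_def S_def sum_distrib_left sum.distrib[symmetric] using elim by (intro sum_mono) blast
    from mult_left_mono[OF this N]
    have "N * reg (?w + s *\<^sub>R h) \<le> N * reg ?w + s * (N * S)" by (simp add: algebra_simps)
    moreover have sq: "(norm (?w + s *\<^sub>R h - w k))\<^sup>2 = (norm (?w - w k))\<^sup>2 + 2 * s * ((?w - w k) \<bullet> h) + s\<^sup>2 * (norm h)\<^sup>2"
      unfolding power2_norm_eq_inner
      by (simp add: inner_add_left inner_add_right inner_diff_left inner_diff_right inner_commute
          power2_eq_square algebra_simps)
    moreover have "gradient (w k) (\<mu> k) \<bullet> (?w + s *\<^sub>R h - w k)
        = gradient (w k) (\<mu> k) \<bullet> (?w - w k) + s * (gradient (w k) (\<mu> k) \<bullet> h)"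
      by (simp add: inner_add_right inner_diff_right)
    moreover have "a k / 2 * (norm (?w + s *\<^sub>R h - w k))\<^sup>2
        = a k / 2 * (norm (?w - w k))\<^sup>2 + s * (a k * ((?w - w k) \<bullet> h)) + s\<^sup>2 * (a k / 2 * (norm h)\<^sup>2)"
      unfolding sq by (simp add: ring_distribs)
    ultimately show ?case
      using iterate_min[of k "?w + s *\<^sub>R h"] unfolding distrib_left by linarith
  qed
  then show ?thesis
    unfolding S_def by (rule coeff_eq_0_of_local_min)
qed

end

section \<open>Quadratic pieces of the objective\<close>

context smoothed_proximal_gradient
begin

text \<open>A piece is given by the residuals \<open>S\<close> inside the smoothing band, the nonnegative residuals \<open>T\<close>,
  the coordinates \<open>Z\<close> at the kink of the penalty, and the quadratic \<open>\<kappa> j\<close> describing the penalty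
  at the coordinate \<open>j \<notin> Z\<close>.\<close>

definition piece :: "'i set \<Rightarrow> 'i set \<Rightarrow> 'j set \<Rightarrow> ('j \<Rightarrow> real \<times> real \<times> real) \<Rightarrow> 'a \<Rightarrow> real \<Rightarrow> real" where
  "piece S T Z \<kappa> v \<nu> =
     (\<Sum>i\<in>I. (if i \<in> S then (res i v)\<^sup>2 / (2 * \<nu>) + \<nu> / 2 else (if i \<in> T then 1 else - 1) * res i v) / 2
        + (\<tau> - 1/2) * res i v)
     + N * (\<Sum>j\<in>J. if j \<in> Z then 0
         else fst (\<kappa> j) + fst (snd (\<kappa> j)) * (E j \<bullet> v) + snd (snd (\<kappa> j)) * (E j \<bullet> v)\<^sup>2 / 2)"

definition piece_deriv :: "'i set \<Rightarrow> 'i set \<Rightarrow> 'j set \<Rightarrow> ('j \<Rightarrow> real \<times> real \<times> real) \<Rightarrow> 'a \<Rightarrow> real \<Rightarrow> 'a \<Rightarrow> real" where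
  "piece_deriv S T Z \<kappa> v \<nu> h =
     (\<Sum>i\<in>I. - ((if i \<in> S then res i v / \<nu> else if i \<in> T then 1 else - 1) / 2 + (\<tau> - 1/2)) * (X i \<bullet> h))
     + N * (\<Sum>j\<in>J. if j \<in> Z then 0 else (fst (snd (\<kappa> j)) + snd (snd (\<kappa> j)) * (E j \<bullet> v)) * (E j \<bullet> h))"

text \<open>The smoothing parameter 1 at the base point \<open>w0\<close> is arbitrary, since the residuals in \<open>S\<close> vanish there.\<close>

lemma piece_expansion:
  fixes S T :: "'i set" and Z :: "'j set" and \<kappa> :: "'j \<Rightarrow> real \<times> real \<times> real"
  assumes w0: "\<And>i. i \<in> S \<Longrightarrow> res i w0 = 0"
  defines "a' \<equiv> \<lambda>g h. \<Sum>i\<in>I. (if i \<in> S then 1/2 else 0) * (X i \<bullet> g) * (X i \<bullet> h)"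
    and "b' \<equiv> \<lambda>g h. \<Sum>j\<in>J. (if j \<in> Z then 0 else - N * snd (snd (\<kappa> j))) * (E j \<bullet> g) * (E j \<bullet> h)"
    and "l' \<equiv> piece_deriv S T Z \<kappa> w0 1"
  shows "piece S T Z \<kappa> (w0 + z) \<nu> = (a' z z / \<nu> - b' z z) / 2 + l' z
      + piece {} T Z \<kappa> w0 1
      + (\<Sum>i\<in>I. if i \<in> S then 1/4 else 0) * \<nu>"
    and "piece_deriv S T Z \<kappa> (w0 + z) \<nu> h = a' z h / \<nu> - b' z h + l' h"
proof -
  have res: "res i (w0 + z) = res i w0 - X i \<bullet> z" for i
    by (simp add: res_def inner_add_right)
  \<comment> \<open>The residuals in \<open>S\<close> vanish at \<open>w0\<close> and so drop out of
    the constant term, which is therefore written with \<open>{}\<close>; each of them leaves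
    \<open>\<nu> / 4\<close> from the smoothing.\<close>
  have 1: "(\<Sum>i\<in>I. (if i \<in> S then (res i (w0 + z))\<^sup>2 / (2 * \<nu>) + \<nu> / 2 else (if i \<in> T then 1 else - 1) * res i (w0 + z)) / 2
        + (\<tau> - 1/2) * res i (w0 + z))
    = a' z z / \<nu> / 2 + (\<Sum>i\<in>I. - ((if i \<in> S then res i w0 / 1 else if i \<in> T then 1 else - 1) / 2 + (\<tau> - 1/2)) * (X i \<bullet> z))
      + (\<Sum>i\<in>I. (if i \<in> {} then (res i w0)\<^sup>2 / (2 * 1) + 1 / 2 else (if i \<in> T then 1 else - 1) * res i w0) / 2
        + (\<tau> - 1/2) * res i w0)
      + (\<Sum>i\<in>I. if i \<in> S then 1/4 else 0) * \<nu>"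
    unfolding a'_def sum_divide_distrib sum_distrib_right sum.distrib[symmetric]
  proof (intro sum.cong refl)
    fix i
    show "(if i \<in> S then (res i (w0 + z))\<^sup>2 / (2 * \<nu>) + \<nu> / 2 else (if i \<in> T then 1 else - 1) * res i (w0 + z)) / 2
        + (\<tau> - 1/2) * res i (w0 + z)
      = (if i \<in> S then 1/2 else 0) * (X i \<bullet> z) * (X i \<bullet> z) / \<nu> / 2
        + - ((if i \<in> S then res i w0 / 1 else if i \<in> T then 1 else - 1) / 2 + (\<tau> - 1/2)) * (X i \<bullet> z)
        + ((if i \<in> {} then (res i w0)\<^sup>2 / (2 * 1) + 1 / 2 else (if i \<in> T then 1 else - 1) * res i w0) / 2
          + (\<tau> - 1/2) * res i w0)
        + (if i \<in> S then 1/4 else 0) * \<nu>"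
      by (cases "i \<in> S"; cases "i \<in> T")
         (simp_all add: w0 res power2_eq_square algebra_simps add_divide_distrib diff_divide_distrib)
  qed
  have 2: "N * (\<Sum>j\<in>J. if j \<in> Z then 0
         else fst (\<kappa> j) + fst (snd (\<kappa> j)) * (E j \<bullet> (w0 + z)) + snd (snd (\<kappa> j)) * (E j \<bullet> (w0 + z))\<^sup>2 / 2)
    = - b' z z / 2 + N * (\<Sum>j\<in>J. if j \<in> Z then 0 else (fst (snd (\<kappa> j)) + snd (snd (\<kappa> j)) * (E j \<bullet> w0)) * (E j \<bullet> z))
      + N * (\<Sum>j\<in>J. if j \<in> Z then 0
         else fst (\<kappa> j) + fst (snd (\<kappa> j)) * (E j \<bullet> w0) + snd (snd (\<kappa> j)) * (E j \<bullet> w0)\<^sup>2 / 2)"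
    unfolding b'_def sum_divide_distrib sum_negf[symmetric] sum_distrib_left sum.distrib[symmetric]
    by (intro sum.cong refl) (simp add: inner_add_right power2_eq_square field_simps)
  show "piece S T Z \<kappa> (w0 + z) \<nu> = (a' z z / \<nu> - b' z z) / 2 + l' z
      + piece {} T Z \<kappa> w0 1
      + (\<Sum>i\<in>I. if i \<in> S then 1/4 else 0) * \<nu>"
    unfolding piece_def piece_deriv_def l'_def 1 2 by (simp add: diff_divide_distrib)
  have 3: "(\<Sum>i\<in>I. - ((if i \<in> S then res i (w0 + z) / \<nu> else if i \<in> T then 1 else - 1) / 2 + (\<tau> - 1/2)) * (X i \<bullet> h))
    = a' z h / \<nu> + (\<Sum>i\<in>I. - ((if i \<in> S then res i w0 / 1 else if i \<in> T then 1 else - 1) / 2 + (\<tau> - 1/2)) * (X i \<bullet> h))"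
    unfolding a'_def sum_divide_distrib sum.distrib[symmetric]
  proof (intro sum.cong refl)
    fix i
    show "- ((if i \<in> S then res i (w0 + z) / \<nu> else if i \<in> T then 1 else - 1) / 2 + (\<tau> - 1/2)) * (X i \<bullet> h)
      = (if i \<in> S then 1/2 else 0) * (X i \<bullet> z) * (X i \<bullet> h) / \<nu>
       + - ((if i \<in> S then res i w0 / 1 else if i \<in> T then 1 else - 1) / 2 + (\<tau> - 1/2)) * (X i \<bullet> h)"
      by (cases "i \<in> S") (simp_all add: w0 res algebra_simps)
  qed
  have 4: "N * (\<Sum>j\<in>J. if j \<in> Z then 0 else (fst (snd (\<kappa> j)) + snd (snd (\<kappa> j)) * (E j \<bullet> (w0 + z))) * (E j \<bullet> h))
    = - b' z h + N * (\<Sum>j\<in>J. if j \<in> Z then 0 else (fst (snd (\<kappa> j)) + snd (snd (\<kappa> j)) * (E j \<bullet> w0)) * (E j \<bullet> h))"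
    unfolding b'_def sum_negf[symmetric] sum_distrib_left sum.distrib[symmetric]
    by (intro sum.cong refl) (simp add: inner_add_right algebra_simps)
  show "piece_deriv S T Z \<kappa> (w0 + z) \<nu> h = a' z h / \<nu> - b' z h + l' h"
    unfolding piece_deriv_def l'_def 3 4 by simp
qed

text \<open>The vector \<open>g\<close> represents the derivative of the piece only along directions
  that preserve the zero coordinates; its remaining components can only enlarge its norm.\<close>

definition piece_kl_at :: "'i set \<Rightarrow> 'i set \<Rightarrow> 'j set \<Rightarrow> ('j \<Rightarrow> real \<times> real \<times> real) \<Rightarrow> (real \<Rightarrow> real) \<Rightarrow> real \<Rightarrow> real \<Rightarrow> bool" where
  "piece_kl_at S T Z \<kappa> p \<epsilon> C \<longleftrightarrow>
    (\<forall>\<nu> v g. 0 < \<nu> \<longrightarrow> \<nu> < \<epsilon> \<longrightarrow> (\<forall>j\<in>Z. E j \<bullet> v = 0) \<longrightarrow> (\<forall>i\<in>S. \<bar>res i v\<bar> < \<nu>) \<longrightarrow>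
      (\<forall>h. (\<forall>j\<in>Z. E j \<bullet> h = 0) \<longrightarrow> g \<bullet> h = piece_deriv S T Z \<kappa> v \<nu> h) \<longrightarrow> norm g \<le> \<epsilon> \<longrightarrow>
      moving_kl (piece S T Z \<kappa> v) p C \<nu> (norm g))"

text \<open>Around a point where all residuals in \<open>S\<close> vanish the expansion has no
  linear term of order \<open>1 / \<nu>\<close>, so the linear part is fixed and
  \<open>quadratic_family_kl\<close> applies. If no such point exists, these residuals cannot all
  lie in a narrow band.\<close>

lemma piece_kl:
  assumes S: "S \<subseteq> I" and \<kappa>: "\<And>j. j \<in> J \<Longrightarrow> j \<notin> Z \<Longrightarrow> snd (snd (\<kappa> j)) \<le> 0"
  shows "\<exists>p \<epsilon> C. rational_near_0 p \<and> 0 < \<epsilon> \<and> 0 \<le> C \<and> piece_kl_at S T Z \<kappa> p \<epsilon> C"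
proof -
  define V where "V = {h. \<forall>j\<in>Z. E j \<bullet> h = 0}"
  have V: "subspace V"
    unfolding V_def subspace_def by (auto simp: inner_add_right)
  have "finite S" using S I finite_subset by blast
  from least_squares_dichotomy[OF this V, of X y] show ?thesis
  proof
    assume "\<exists>\<epsilon>>0. \<forall>v\<in>V. \<exists>i\<in>S. \<epsilon> \<le> \<bar>y i - X i \<bullet> v\<bar>"
    then obtain \<epsilon> where \<epsilon>: "0 < \<epsilon>" "\<And>v. v \<in> V \<Longrightarrow> \<exists>i\<in>S. \<epsilon> \<le> \<bar>res i v\<bar>"
      by (auto simp: res_def)
    have "False" if "\<nu> < \<epsilon>" "\<forall>j\<in>Z. E j \<bullet> v = 0" "\<forall>i\<in>S. \<bar>res i v\<bar> < \<nu>" for \<nu> v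
      using \<epsilon>(2)[of v] that by (force simp: V_def)
    with \<epsilon>(1) rational_near_0_const[of 0] show ?thesis
      by (intro exI[of _ "\<lambda>_. 0"] exI[of _ \<epsilon>] exI[of _ 0]) (auto simp: piece_kl_at_def)
  next
    assume "\<exists>w0\<in>V. \<forall>i\<in>S. X i \<bullet> w0 = y i"
    then obtain w0 where w0: "w0 \<in> V" "\<And>i. i \<in> S \<Longrightarrow> res i w0 = 0"
      by (auto simp: res_def)
    define a' where "a' g h = (\<Sum>i\<in>I. (if i \<in> S then 1/2 else 0) * (X i \<bullet> g) * (X i \<bullet> h))" for g h
    define b' where "b' g h = (\<Sum>j\<in>J. (if j \<in> Z then 0 else - N * snd (snd (\<kappa> j))) * (E j \<bullet> g) * (E j \<bullet> h))" for g h
    define l' where "l' = piece_deriv S T Z \<kappa> w0 1"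
    define K0 where "K0 = piece {} T Z \<kappa> w0 1"
    define K1 where "K1 = (\<Sum>i\<in>I. if i \<in> S then 1/4 else 0 :: real)"
    have piece_eq: "piece S T Z \<kappa> (w0 + z) \<nu> = (a' z z / \<nu> - b' z z) / 2 + l' z + K0 + K1 * \<nu>"
      and deriv_eq: "piece_deriv S T Z \<kappa> (w0 + z) \<nu> h = a' z h / \<nu> - b' z h + l' h" for z \<nu> h
      using piece_expansion[OF w0(2)] unfolding a'_def b'_def l'_def K0_def K1_def by auto
    have bil: "bilinear a'" "bilinear b'"
      unfolding a'_def b'_def by (rule bilinear_sum_of_squares)+
    have sym: "a' g h = a' h g" "b' g h = b' h g" for g h
      by (auto simp: a'_def b'_def mult_ac)
    have psd: "0 \<le> a' h h" "0 \<le> b' h h" for h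
    proof -
      show "0 \<le> a' h h" unfolding a'_def by (intro sum_nonneg) auto
      show "0 \<le> b' h h" unfolding b'_def mult.assoc
        using \<kappa> N by (intro sum_nonneg mult_nonneg_nonneg[OF _ zero_le_square]) (auto simp: mult_nonneg_nonpos)
    qed
    have lin: "linear l'"
    proof -
      define G where "G = (\<Sum>i\<in>I. (- ((if i \<in> S then res i w0 / 1 else if i \<in> T then 1 else - 1) / 2 + (\<tau> - 1/2))) *\<^sub>R X i)
        + N *\<^sub>R (\<Sum>j\<in>J. (if j \<in> Z then 0 else fst (snd (\<kappa> j)) + snd (snd (\<kappa> j)) * (E j \<bullet> w0)) *\<^sub>R E j)"
      have "l' = (\<lambda>h. G \<bullet> h)"
        unfolding l'_def piece_deriv_def G_def inner_add_left inner_scaleR_left inner_sum_left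
        by (intro ext arg_cong2[of _ _ _ _ "(+)"] arg_cong2[of _ _ _ _ "(*)"] refl sum.cong) auto
      then show ?thesis
        using bounded_linear.linear[OF bounded_linear_inner_right] by simp
    qed
    obtain p \<epsilon> C where p: "rational_near_0 p" "0 < \<epsilon>" "0 \<le> C" and
      kl: "\<forall>\<mu> z v. 0 < \<mu> \<longrightarrow> \<mu> < \<epsilon> \<longrightarrow> z \<in> V \<longrightarrow> (\<forall>h\<in>V. v \<bullet> h = a' z h / \<mu> - b' z h + l' h) \<longrightarrow>
        norm v \<le> \<epsilon> \<longrightarrow> moving_kl (\<lambda>\<mu>. (a' z z / \<mu> - b' z z) / 2 + l' z) p C \<mu> (norm v)"
      using quadratic_family_kl[OF bil sym psd V lin] by (elim exE conjE) (rule that)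
    define p' where "p' \<nu> = p \<nu> + K0 + K1 * \<nu>" for \<nu>
    have rat: "rational_near_0 p'"
      unfolding p'_def by (intro rational_near_0_add p rational_near_0_const rational_near_0_linear)
    have main: "moving_kl (piece S T Z \<kappa> v) p' C \<nu> (norm g)"
      if "0 < \<nu>" "\<nu> < \<epsilon>" "\<forall>j\<in>Z. E j \<bullet> v = 0" and
        g: "\<forall>h. (\<forall>j\<in>Z. E j \<bullet> h = 0) \<longrightarrow> g \<bullet> h = piece_deriv S T Z \<kappa> v \<nu> h" and "norm g \<le> \<epsilon>" for \<nu> v g
    proof -
      define z where "z = v - w0"
      have v: "v = w0 + z" by (simp add: z_def)
      have "v \<in> V" using that by (simp add: V_def)
      then have "z \<in> V" using w0(1) V by (simp add: z_def subspace_diff)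
      moreover have "\<forall>h\<in>V. g \<bullet> h = a' z h / \<nu> - b' z h + l' h"
        using g by (auto simp: V_def v deriv_eq)
      ultimately have "moving_kl (\<lambda>\<mu>. (a' z z / \<mu> - b' z z) / 2 + l' z) p C \<nu> (norm g)"
        using kl that by blast
      moreover have "A + K0 + K1 * s - (p s + K0 + K1 * s) = A - p s"
        "A + K0 + K1 * s - (B + K0 + K1 * t) - (p s + K0 + K1 * s - (p t + K0 + K1 * t)) = A - B - (p s - p t)" for A B s t
        by auto
      ultimately show ?thesis
        unfolding moving_kl_def v piece_eq p'_def by presburger
    qed
    show ?thesis
      unfolding piece_kl_at_def
      by (rule exI[of _ p'], rule exI[of _ \<epsilon>], rule exI[of _ C], rule conjI[OF rat conjI[OF p(2) conjI[OF p(3)]]],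
          intro allI impI, rule main)
  qed
qed

end

section \<open>Convergence of the iterates\<close>

lemma subsequence_tendsto_0:
  fixes u :: "nat \<Rightarrow> real"
  assumes "\<And>k. 0 \<le> u k" and small: "\<And>\<epsilon> N. 0 < \<epsilon> \<Longrightarrow> \<exists>k\<ge>N. u k < \<epsilon>"
  shows "\<exists>r. strict_mono r \<and> (\<lambda>k. u (r k)) \<longlonglongrightarrow> 0"
proof -
  have "\<exists>r. \<forall>n. u (r n) < 1 / real (Suc n) \<and> r n < r (Suc n)"
  proof (rule dependent_nat_choice)
    show "\<exists>k. u k < 1 / real (Suc 0)" using small[of 1 0] by auto
    show "\<exists>k'. u k' < 1 / real (Suc (Suc n)) \<and> k < k'" if "u k < 1 / real (Suc n)" for k n
      using small[of "1 / real (Suc (Suc n))" "Suc k"] by auto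
  qed
  then obtain r where r: "\<And>n. u (r n) < 1 / real (Suc n)" "\<And>n. r n < r (Suc n)" by blast
  have "(\<lambda>k. u (r k)) \<longlonglongrightarrow> 0"
    by (rule tendsto_sandwich[OF _ _ tendsto_const LIMSEQ_Suc[OF lim_1_over_n]])
       (use assms(1) r(1) in \<open>auto intro!: always_eventually less_imp_le\<close>)
  then show ?thesis
    using r(2) by (auto simp: strict_mono_Suc_iff)
qed

lemma convergent_of_summable_steps:
  fixes w :: "nat \<Rightarrow> 'a::banach"
  assumes "summable (\<lambda>k. norm (w (Suc k) - w k))"
  shows "convergent w"
proof -
  have "summable (\<lambda>k. w (Suc k) - w k)"
    by (rule summable_norm_cancel[OF assms])
  then have "convergent (\<lambda>n. \<Sum>k<n. w (Suc k) - w k)"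
    by (rule summable_iff_convergent[THEN iffD1])
  then have "convergent (\<lambda>n. w 0 + (w n - w 0))"
    by (intro convergent_add convergent_const) (simp add: sum_lessThan_telescope)
  then show ?thesis by simp
qed

context smoothed_proximal_gradient
begin

text \<open>When the parameter shrinks, a residual may leave the band. The piece still bounds the
  objective from above, because the band formula dominates the absolute value everywhere; this is
  why the drift condition in \<open>moving_kl\<close> is one-sided.\<close>

lemma obj_piece:
  assumes \<nu>: "0 < \<nu>"
    and \<kappa>: "\<And>j. j \<in> J \<Longrightarrow> E j \<bullet> v \<noteq> 0 \<Longrightarrow> piece_at pen (E j \<bullet> v) (\<kappa> j)"
  defines "S \<equiv> {i\<in>I. \<bar>res i v\<bar> < \<nu>}" and "T \<equiv> {i\<in>I. 0 \<le> res i v}" and "Z \<equiv> {j\<in>J. E j \<bullet> v = 0}"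
  shows "obj v \<nu> = piece S T Z \<kappa> v \<nu>"
    and "0 < \<nu>' \<Longrightarrow> \<nu>' \<le> \<nu> \<Longrightarrow> obj v \<nu>' \<le> piece S T Z \<kappa> v \<nu>'"
    and "gradient v \<nu> \<bullet> h + N * (\<Sum>j\<in>J. if E j \<bullet> v = 0 then 0
           else (fst (snd (\<kappa> j)) + snd (snd (\<kappa> j)) * (E j \<bullet> v)) * (E j \<bullet> h)) = piece_deriv S T Z \<kappa> v \<nu> h"
proof -
  have reg: "reg v = (\<Sum>j\<in>J. if j \<in> Z then 0
         else fst (\<kappa> j) + fst (snd (\<kappa> j)) * (E j \<bullet> v) + snd (snd (\<kappa> j)) * (E j \<bullet> v)\<^sup>2 / 2)"
    unfolding reg_def
  proof (intro sum.cong refl)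
    fix j assume j: "j \<in> J"
    show "pen (E j \<bullet> v) = (if j \<in> Z then 0
         else fst (\<kappa> j) + fst (snd (\<kappa> j)) * (E j \<bullet> v) + snd (snd (\<kappa> j)) * (E j \<bullet> v)\<^sup>2 / 2)"
      using \<kappa>[OF j] j pen(2) by (auto simp: Z_def piece_at_def split: prod.splits)
  qed
  have "loss v \<nu> = (\<Sum>i\<in>I. (if i \<in> S then (res i v)\<^sup>2 / (2 * \<nu>) + \<nu> / 2 else (if i \<in> T then 1 else - 1) * res i v) / 2
        + (\<tau> - 1/2) * res i v)"
    unfolding loss_def S_def T_def fsmooth_def by (intro sum.cong refl) auto
  then show "obj v \<nu> = piece S T Z \<kappa> v \<nu>"
    unfolding obj_def piece_def reg by simp
  show "obj v \<nu>' \<le> piece S T Z \<kappa> v \<nu>'" if "0 < \<nu>'" "\<nu>' \<le> \<nu>"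
  proof -
    have "loss v \<nu>' \<le> (\<Sum>i\<in>I. (if i \<in> S then (res i v)\<^sup>2 / (2 * \<nu>') + \<nu>' / 2 else (if i \<in> T then 1 else - 1) * res i v) / 2
        + (\<tau> - 1/2) * res i v)"
      unfolding loss_def
    proof (intro sum_mono add_right_mono divide_right_mono)
      fix i assume "i \<in> I"
      then show "fsmooth (res i v) \<nu>' \<le> (if i \<in> S then (res i v)\<^sup>2 / (2 * \<nu>') + \<nu>' / 2 else (if i \<in> T then 1 else - 1) * res i v)"
        using that fsmooth_le_square[OF that(1), of "res i v"] by (auto simp: S_def T_def fsmooth_def)
    qed simp
    then show ?thesis
      unfolding obj_def piece_def reg by simp
  qed
  show "gradient v \<nu> \<bullet> h + N * (\<Sum>j\<in>J. if E j \<bullet> v = 0 then 0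
           else (fst (snd (\<kappa> j)) + snd (snd (\<kappa> j)) * (E j \<bullet> v)) * (E j \<bullet> h)) = piece_deriv S T Z \<kappa> v \<nu> h"
  proof -
    have "gradient v \<nu> \<bullet> h
      = (\<Sum>i\<in>I. - ((if i \<in> S then res i v / \<nu> else if i \<in> T then 1 else - 1) / 2 + (\<tau> - 1/2)) * (X i \<bullet> h))"
      unfolding gradient_inner by (intro sum.cong refl) (auto simp: clip_eq[OF \<nu>] S_def T_def)
    moreover have "(\<Sum>j\<in>J. if E j \<bullet> v = 0 then 0
           else (fst (snd (\<kappa> j)) + snd (snd (\<kappa> j)) * (E j \<bullet> v)) * (E j \<bullet> h))
      = (\<Sum>j\<in>J. if j \<in> Z then 0 else (fst (snd (\<kappa> j)) + snd (snd (\<kappa> j)) * (E j \<bullet> v)) * (E j \<bullet> h))"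
      by (intro sum.cong refl) (auto simp: Z_def)
    ultimately show ?thesis by (simp add: piece_deriv_def)
  qed
qed

text \<open>The triple \<open>(0, 0, 0)\<close> is a placeholder at coordinates in \<open>Z\<close>;
  extensionality of \<open>\<kappa>\<close> makes the set finite.\<close>

definition patterns :: "('i set \<times> 'i set \<times> 'j set \<times> ('j \<Rightarrow> real \<times> real \<times> real)) set" where
  "patterns = {(S, T, Z, \<kappa>). S \<subseteq> I \<and> T \<subseteq> I \<and> Z \<subseteq> J \<and> \<kappa> \<in> J \<rightarrow>\<^sub>E insert (0, 0, 0) Q \<and>
    (\<forall>j\<in>J. j \<notin> Z \<longrightarrow> snd (snd (\<kappa> j)) \<le> 0)}"

lemma finite_patterns: "finite patterns"
proof -
  have "patterns \<subseteq> Pow I \<times> Pow I \<times> Pow J \<times> (J \<rightarrow>\<^sub>E insert (0, 0, 0) Q)"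
    by (auto simp: patterns_def)
  then show ?thesis
    by (rule finite_subset) (intro finite_cartesian_product finite_PiE; use I J Q(1) in simp)
qed

lemma iterate_on_piece:
  obtains S T Z \<kappa> g where "(S, T, Z, \<kappa>) \<in> patterns"
    "\<forall>j\<in>Z. E j \<bullet> w (Suc k) = 0" "\<forall>i\<in>S. \<bar>res i (w (Suc k))\<bar> < \<mu> k"
    "obj (w (Suc k)) (\<mu> k) = piece S T Z \<kappa> (w (Suc k)) (\<mu> k)"
    "obj (w (Suc k)) (\<mu> (Suc k)) \<le> piece S T Z \<kappa> (w (Suc k)) (\<mu> (Suc k))"
    "\<forall>h. (\<forall>j\<in>Z. E j \<bullet> h = 0) \<longrightarrow> g \<bullet> h = piece_deriv S T Z \<kappa> (w (Suc k)) (\<mu> k) h"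
    "norm g \<le> ((\<Sum>i\<in>I. (norm (X i))\<^sup>2) / (2 * (c * \<beta>)) + 1) * (a k * norm (w (Suc k) - w k))"
proof -
  let ?w = "w (Suc k)"
  have "\<forall>j. \<exists>q. E j \<bullet> ?w \<noteq> 0 \<longrightarrow> q \<in> Q \<and> piece_at pen (E j \<bullet> ?w) q"
    using Q(2) by blast
  then obtain \<kappa>0 where \<kappa>0: "\<And>j. E j \<bullet> ?w \<noteq> 0 \<Longrightarrow> \<kappa>0 j \<in> Q \<and> piece_at pen (E j \<bullet> ?w) (\<kappa>0 j)"
    by metis
  define \<kappa> where "\<kappa> = restrict (\<lambda>j. if E j \<bullet> ?w = 0 then (0, 0, 0) else \<kappa>0 j) J"
  have \<kappa>: "piece_at pen (E j \<bullet> ?w) (\<kappa> j)" if "j \<in> J" "E j \<bullet> ?w \<noteq> 0" for j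
    using \<kappa>0[of j] that by (simp add: \<kappa>_def)
  define S where "S = {i\<in>I. \<bar>res i ?w\<bar> < \<mu> k}"
  define T where "T = {i\<in>I. 0 \<le> res i ?w}"
  define Z where "Z = {j\<in>J. E j \<bullet> ?w = 0}"
  \<comment> \<open>By optimality of the step this vector acts as the derivative of the piece along
    directions preserving \<open>Z\<close>. Its norm is at most a multiple of
    \<open>1 / \<mu> k + a k\<close> times the step, and \<open>1 / \<mu> k\<close> is proportional
    to \<open>a k\<close>.\<close>
  define g where "g = gradient ?w (\<mu> k) - gradient (w k) (\<mu> k) - a k *\<^sub>R (?w - w k)"
  note op = obj_piece[OF \<mu>_pos[of k] \<kappa>, folded S_def T_def Z_def]
  have deriv: "\<forall>h. (\<forall>j\<in>Z. E j \<bullet> h = 0) \<longrightarrow> g \<bullet> h = piece_deriv S T Z \<kappa> ?w (\<mu> k) h"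
  proof (intro allI impI)
    fix h assume h: "\<forall>j\<in>Z. E j \<bullet> h = 0"
    have slope: "\<exists>\<delta>>0. \<forall>s. \<bar>s - E j \<bullet> ?w\<bar> < \<delta> \<longrightarrow> pen s \<le> pen (E j \<bullet> ?w)
        + (fst (snd (\<kappa> j)) + snd (snd (\<kappa> j)) * (E j \<bullet> ?w)) * (s - E j \<bullet> ?w)"
      if "j \<in> J" "E j \<bullet> ?w \<noteq> 0" for j
      using \<kappa>[OF that] by (auto simp: piece_at_def split: prod.splits)
    have "gradient (w k) (\<mu> k) \<bullet> h + a k * ((?w - w k) \<bullet> h)
     + N * (\<Sum>j\<in>J. if E j \<bullet> ?w = 0 then 0 else (fst (snd (\<kappa> j)) + snd (snd (\<kappa> j)) * (E j \<bullet> ?w)) * (E j \<bullet> h)) = 0"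
      by (rule first_order_optimality[OF slope]) (use h in \<open>auto simp: Z_def\<close>)
    then have "g \<bullet> h = gradient ?w (\<mu> k) \<bullet> h
     + N * (\<Sum>j\<in>J. if E j \<bullet> ?w = 0 then 0 else (fst (snd (\<kappa> j)) + snd (snd (\<kappa> j)) * (E j \<bullet> ?w)) * (E j \<bullet> h))"
      unfolding g_def inner_diff_left inner_scaleR_left by linarith
    then show "g \<bullet> h = piece_deriv S T Z \<kappa> ?w (\<mu> k) h"
      using op(3) by simp
  qed
  have "norm g \<le> norm (gradient ?w (\<mu> k) - gradient (w k) (\<mu> k)) + norm (a k *\<^sub>R (?w - w k))"
    unfolding g_def by (rule norm_triangle_ineq4)
  also have "\<dots> \<le> (\<Sum>i\<in>I. (norm (X i))\<^sup>2) / (2 * \<mu> k) * norm (?w - w k) + a k * norm (?w - w k)"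
    using gradient_lipschitz[OF \<mu>_pos[of k], of ?w "w k"] a_pos(1)[of k] by simp
  also have "\<dots> = ((\<Sum>i\<in>I. (norm (X i))\<^sup>2) / (2 * (c * \<beta>)) + 1) * (a k * norm (?w - w k))"
  proof -
    have "1 / (2 * \<mu> k) = a k / (2 * (c * \<beta>))"
      using a_mult_\<mu>[of k] a_pos(1)[of k] \<mu>_pos[of k] params by (simp add: field_simps)
    then have "B / (2 * \<mu> k) = B / (2 * (c * \<beta>)) * a k" for B
      by (metis divide_inverse mult.assoc mult.commute mult_1)
    then show ?thesis by (simp add: distrib_right)
  qed
  finally have norm_g: "norm g \<le> ((\<Sum>i\<in>I. (norm (X i))\<^sup>2) / (2 * (c * \<beta>)) + 1) * (a k * norm (?w - w k))" .
  have "\<kappa> \<in> J \<rightarrow>\<^sub>E insert (0, 0, 0) Q"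
    using \<kappa>0 by (auto simp: \<kappa>_def PiE_iff)
  moreover have "snd (snd (\<kappa> j)) \<le> 0" if "j \<in> J" "j \<notin> Z" for j
    using \<kappa>[of j] that by (auto simp: Z_def piece_at_def split: prod.splits)
  ultimately have "(S, T, Z, \<kappa>) \<in> patterns"
    by (auto simp: patterns_def S_def T_def Z_def)
  then show thesis
    by (rule that[OF _ _ _ op(1) op(2)[OF _ _ \<mu>_pos \<mu>_Suc(1)] deriv norm_g]) (auto simp: S_def Z_def)
qed

lemma summable_steps: "summable (\<lambda>k. norm (w (Suc k) - w k))"
proof -
  have "\<forall>q\<in>patterns. \<exists>p \<epsilon> C. rational_near_0 p \<and> 0 < \<epsilon> \<and> 0 \<le> C \<and>
      piece_kl_at (fst q) (fst (snd q)) (fst (snd (snd q))) (snd (snd (snd q))) p \<epsilon> C"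
  proof
    fix q assume "q \<in> patterns"
    then show "\<exists>p \<epsilon> C. rational_near_0 p \<and> 0 < \<epsilon> \<and> 0 \<le> C \<and>
      piece_kl_at (fst q) (fst (snd q)) (fst (snd (snd q))) (snd (snd (snd q))) p \<epsilon> C"
      by (intro piece_kl) (auto simp: patterns_def)
  qed
  then obtain p \<epsilon> C where p: "\<And>q. q \<in> patterns \<Longrightarrow> rational_near_0 (p q)" and \<epsilon>: "\<And>q. q \<in> patterns \<Longrightarrow> 0 < \<epsilon> q"
    and C: "\<And>q. q \<in> patterns \<Longrightarrow> 0 \<le> C q"
    and kl: "\<And>q. q \<in> patterns \<Longrightarrow> piece_kl_at (fst q) (fst (snd q)) (fst (snd (snd q))) (snd (snd (snd q))) (p q) (\<epsilon> q) (C q)"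
    by metis
  \<comment> \<open>One threshold and one constant serve all patterns.\<close>
  define e where "e = Min (insert 1 (\<epsilon> ` patterns))"
  have e: "0 < e" "\<And>q. q \<in> patterns \<Longrightarrow> e \<le> \<epsilon> q"
    using finite_patterns \<epsilon> by (auto simp: e_def)
  define Cs where "Cs = (\<Sum>q\<in>patterns. C q)"
  have Cs: "0 \<le> Cs" "\<And>q. q \<in> patterns \<Longrightarrow> C q \<le> Cs"
    using finite_patterns C by (auto simp: Cs_def sum_nonneg intro: member_le_sum)
  define Cv where "Cv = (\<Sum>i\<in>I. (norm (X i))\<^sup>2) / (2 * (c * \<beta>)) + 1"
  have Cv: "1 \<le> Cv" using params by (simp add: Cv_def sum_nonneg)
  define Ct where "Ct = Cs * Cv\<^sup>2"
  have powr_summable: "summable (\<lambda>k. real (Suc k) powr s)" if "s < - 1" for s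
    using that by (subst summable_Suc_iff) (simp add: summable_real_powr_iff)
  \<comment> \<open>With \<open>m k = 1 / real (Suc k)\<close> the products with
    \<open>1 / a k\<close>, \<open>sqrt (\<mu> k)\<close> and \<open>a k\<close> are multiples of
    the powers with exponents \<open>- 1 - d\<close>, \<open>- 1 - d / 2\<close> and
    \<open>d - 1\<close>. The first two are summable as \<open>d > 0\<close>, the last tends to 0 as
    \<open>d < 1\<close>.\<close>
  show ?thesis
  proof (rule finite_length[where J = patterns and c = p and a = a and \<mu> = \<mu> and ?a0.0 = c and \<Theta> = "c * \<beta>"
        and m = "\<lambda>k. 1 / real (Suc k)" and D = "\<lambda>k. obj (w k) (\<mu> k)" and Mid = "\<lambda>k. obj (w (Suc k)) (\<mu> k)"
        and \<delta> = "1/8" and \<epsilon> = "e / Cv" and C = Ct])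
    show "summable (\<lambda>k. 1 / real (Suc k) / a k)"
    proof -
      have "1 / real (Suc k) / a k = 1 / c * real (Suc k) powr (- 1 - d)" for k
        by (simp add: a_def powr_diff powr_minus_divide)
      then show ?thesis using params by (simp only: summable_mult powr_summable)
    qed
    show "summable (\<lambda>k. 1 / real (Suc k) * sqrt (\<mu> k))"
    proof -
      have "1 / real (Suc k) * sqrt (\<mu> k) = sqrt \<beta> * real (Suc k) powr (- 1 - d / 2)" for k
        by (simp add: \<mu>_def real_sqrt_divide powr_half_sqrt[symmetric] powr_powr powr_diff powr_minus_divide)
      then show ?thesis using params by (simp only: summable_mult powr_summable)
    qed
    show "(\<lambda>k. 1 / real (Suc k) * a k) \<longlonglongrightarrow> 0"
    proof -
      have "1 / real (Suc k) * a k = c * real (Suc k) powr (d - 1)" for k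
        by (simp add: a_def powr_diff)
      moreover have "(\<lambda>k. c * real (Suc k) powr (d - 1)) \<longlonglongrightarrow> c * 0"
        using params by (intro tendsto_mult tendsto_const tendsto_neg_powr filterlim_real_Suc) auto
      ultimately show ?thesis by simp
    qed
    show "\<forall>\<^sub>F k in sequentially. e / Cv \<le> a k * norm (w (Suc k) - w k) \<or>
      (\<exists>q\<in>patterns. \<bar>obj (w (Suc k)) (\<mu> k) - p q (\<mu> k)\<bar> \<le> Ct * (a k * norm (w (Suc k) - w k))\<^sup>2 \<and>
        obj (w (Suc k)) (\<mu> (Suc k)) - obj (w (Suc k)) (\<mu> k) - (p q (\<mu> (Suc k)) - p q (\<mu> k))
          \<le> Ct * (a k * norm (w (Suc k) - w k) * (\<mu> k - \<mu> (Suc k)) + (\<mu> k - \<mu> (Suc k))\<^sup>2 / \<mu> k))"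
      using order_tendstoD(2)[OF \<mu>_tendsto_0 e(1)]
    proof eventually_elim
      case (elim k)
      define u where "u = a k * norm (w (Suc k) - w k)"
      have u: "0 \<le> u" using a_pos(1)[of k] by (simp add: u_def)
      show ?case
      proof (cases "e / Cv \<le> u")
        case False
        obtain S T Z \<kappa> g where pat: "(S, T, Z, \<kappa>) \<in> patterns"
          and zs: "\<forall>j\<in>Z. E j \<bullet> w (Suc k) = 0" "\<forall>i\<in>S. \<bar>res i (w (Suc k))\<bar> < \<mu> k"
          and ob: "obj (w (Suc k)) (\<mu> k) = piece S T Z \<kappa> (w (Suc k)) (\<mu> k)"
            "obj (w (Suc k)) (\<mu> (Suc k)) \<le> piece S T Z \<kappa> (w (Suc k)) (\<mu> (Suc k))"
          and g: "\<forall>h. (\<forall>j\<in>Z. E j \<bullet> h = 0) \<longrightarrow> g \<bullet> h = piece_deriv S T Z \<kappa> (w (Suc k)) (\<mu> k) h"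
            "norm g \<le> Cv * u"
          by (rule iterate_on_piece[where k = k, folded Cv_def u_def]) (rule that)
        define q where "q = (S, T, Z, \<kappa>)"
        have q: "q \<in> patterns" using pat by (simp add: q_def)
        have "Cv * u \<le> e" using False Cv by (simp add: field_simps)
        then have ge: "norm g \<le> \<epsilon> q" and \<mu>e: "\<mu> k < \<epsilon> q" using g(2) e(2)[OF q] elim by auto
        have kl_q: "\<bar>obj (w (Suc k)) (\<mu> k) - p q (\<mu> k)\<bar> \<le> C q * (norm g)\<^sup>2 \<and>
          piece S T Z \<kappa> (w (Suc k)) (\<mu> (Suc k)) - obj (w (Suc k)) (\<mu> k) - (p q (\<mu> (Suc k)) - p q (\<mu> k))
            \<le> C q * (norm g * (\<mu> k - \<mu> (Suc k)) + (\<mu> k - \<mu> (Suc k))\<^sup>2 / \<mu> k)"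
          using kl[OF q] \<mu>_pos[of k] \<mu>e zs g(1) ge \<mu>_Suc(1,2)[of k]
          unfolding piece_kl_at_def moving_kl_def q_def fst_conv snd_conv ob(1) by blast
        have "(norm g)\<^sup>2 \<le> (Cv * u)\<^sup>2" using g(2) by (intro power_mono) auto
        then have "C q * (norm g)\<^sup>2 \<le> Cs * (Cv * u)\<^sup>2"
          using Cs C q by (intro mult_mono) auto
        then have 1: "\<bar>obj (w (Suc k)) (\<mu> k) - p q (\<mu> k)\<bar> \<le> Ct * u\<^sup>2"
          using kl_q by (simp add: Ct_def power_mult_distrib mult_ac)
        define \<Delta> where "\<Delta> = \<mu> k - \<mu> (Suc k)"
        have \<Delta>: "0 \<le> \<Delta>" "0 \<le> \<Delta>\<^sup>2 / \<mu> k" using \<mu>_Suc(1)[of k] \<mu>_pos[of k] by (auto simp: \<Delta>_def)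
        have Cv2: "Cv \<le> Cv\<^sup>2" "1 \<le> Cv\<^sup>2"
          using self_le_power[OF Cv, of 2] one_le_power[OF Cv, of 2] by auto
        have "norm g * \<Delta> \<le> Cv\<^sup>2 * u * \<Delta>"
        proof (rule mult_right_mono[OF _ \<Delta>(1)])
          show "norm g \<le> Cv\<^sup>2 * u"
            using g(2) mult_right_mono[OF Cv2(1) u] by linarith
        qed
        moreover have "\<Delta>\<^sup>2 / \<mu> k \<le> Cv\<^sup>2 * (\<Delta>\<^sup>2 / \<mu> k)"
          using mult_right_mono[OF Cv2(2) \<Delta>(2)] by simp
        ultimately have "norm g * \<Delta> + \<Delta>\<^sup>2 / \<mu> k \<le> Cv\<^sup>2 * (u * \<Delta> + \<Delta>\<^sup>2 / \<mu> k)"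
          unfolding distrib_left mult.assoc by linarith
        then have "C q * (norm g * \<Delta> + \<Delta>\<^sup>2 / \<mu> k) \<le> Cs * (Cv\<^sup>2 * (u * \<Delta> + \<Delta>\<^sup>2 / \<mu> k))"
          using Cs C q \<Delta> by (intro mult_mono add_nonneg_nonneg mult_nonneg_nonneg) auto
        then have 2: "obj (w (Suc k)) (\<mu> (Suc k)) - obj (w (Suc k)) (\<mu> k) - (p q (\<mu> (Suc k)) - p q (\<mu> k))
          \<le> Ct * (u * \<Delta> + \<Delta>\<^sup>2 / \<mu> k)"
          using kl_q ob(2) unfolding Ct_def \<Delta>_def mult.assoc by linarith
        show ?thesis
          using q 1 2 unfolding u_def \<Delta>_def by blast
      qed (simp add: u_def)
    qed
    show "\<forall>\<^sub>F k in sequentially. obj (w (Suc k)) (\<mu> k)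
        \<le> obj (w k) (\<mu> k) - 1/8 * (a k * norm (w (Suc k) - w k))\<^sup>2 / a k"
      by (rule sufficient_decrease)
    show "0 \<le> obj (w k) (\<mu> k)" for k
      unfolding obj_def using N loss_nonneg[OF \<mu>_pos] reg_nonneg by (intro add_nonneg_nonneg mult_nonneg_nonneg)
    show "obj (w (Suc k)) (\<mu> (Suc k)) \<le> obj (w (Suc k)) (\<mu> k)" for k
      unfolding obj_def using loss_mono[OF \<mu>_pos \<mu>_Suc(1)] by (intro add_right_mono)
    show "1 / real (Suc (Suc k)) \<le> 1 / real (Suc k)" for k
      by (simp add: frac_le)
  qed (use finite_patterns p a_pos a_mult_\<mu> \<mu>_pos \<mu>_Suc \<mu>_tendsto_0 params e Cv Cs in \<open>auto simp: Ct_def\<close>)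
qed

lemma critical_subsequence:
  "\<exists>wstar r. w \<longlonglongrightarrow> wstar \<and> strict_mono r \<and> (\<lambda>k. a (r k) * norm (w (Suc (r k)) - w (r k))) \<longlonglongrightarrow> 0"
proof -
  obtain wstar where wstar: "w \<longlonglongrightarrow> wstar"
    using convergent_of_summable_steps[OF summable_steps] by (auto simp: convergent_def)
  have not_summable: "\<not> summable (\<lambda>k. 1 / a k)"
  proof
    assume *: "summable (\<lambda>k. 1 / a k)"
    have "c * (1 / a k) = real (Suc k) powr (- d)" for k
      using params by (simp add: a_def powr_minus_divide)
    then have "summable (\<lambda>k. real (Suc k) powr (- d))"
      using summable_mult[OF *, of c] by simp
    then have "summable (\<lambda>k. real k powr (- d))"
      using summable_Suc_iff[of "\<lambda>k. real k powr (- d)"] by simp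
    then show False using params by (simp add: summable_real_powr_iff)
  qed
  have "\<exists>k\<ge>M. a k * norm (w (Suc k) - w k) < \<epsilon>" if "0 < \<epsilon>" for \<epsilon> M
  proof (rule ccontr)
    assume "\<not> ?thesis"
    then have *: "\<epsilon> \<le> a k * norm (w (Suc k) - w k)" if "k \<ge> M" for k
      using that by (auto simp: not_less)
    \<comment> \<open>Otherwise \<open>1 / a k\<close> would be dominated by the summable step
      lengths.\<close>
    have "norm (1 / a k) \<le> 1 / \<epsilon> * norm (w (Suc k) - w k)" if "k \<ge> M" for k
      using *[OF that] a_pos(1)[of k] \<open>0 < \<epsilon>\<close> by (simp add: field_simps)
    then have "summable (\<lambda>k. 1 / a k)"
      by (rule summable_comparison_test'[where g = "\<lambda>k. 1 / \<epsilon> * norm (w (Suc k) - w k)", OF summable_mult[OF summable_steps]])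
    with not_summable show False ..
  qed
  from subsequence_tendsto_0[OF _ this] wstar show ?thesis
    using a_pos(1) by (metis (no_types, lifting) less_imp_le mult_nonneg_nonneg norm_ge_zero)
qed

text \<open>Minimality read as a quadratic minorant of the penalty at \<open>w (Suc k)\<close>. Its
  modulus \<open>a k\<close> is unbounded, which does no harm: the Frechet condition is checked for
  each \<open>k\<close> separately, before any limit is taken.\<close>

lemma prox_subgradient:
  "N * reg (w (Suc k)) - (gradient (w k) (\<mu> k) + a k *\<^sub>R (w (Suc k) - w k)) \<bullet> (z - w (Suc k))
      - a k / 2 * (norm (z - w (Suc k)))\<^sup>2 \<le> N * reg z"
proof -
  define p where "p = w (Suc k) - w k"
  define q where "q = z - w (Suc k)"
  have zq: "z - w k = q + p" by (simp add: p_def q_def)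
  have sq: "(norm (q + p))\<^sup>2 = (norm p)\<^sup>2 + 2 * (p \<bullet> q) + (norm q)\<^sup>2"
    unfolding power2_norm_eq_inner by (simp add: inner_add_left inner_add_right inner_commute)
  have "gradient (w k) (\<mu> k) \<bullet> p + N * reg (w (Suc k)) + a k / 2 * (norm p)\<^sup>2
    \<le> gradient (w k) (\<mu> k) \<bullet> (q + p) + N * reg z + a k / 2 * (norm (q + p))\<^sup>2"
    using iterate_min[of k z] unfolding zq p_def[symmetric] .
  moreover have "a k / 2 * (norm (q + p))\<^sup>2 = a k / 2 * (norm p)\<^sup>2 + a k * (p \<bullet> q) + a k / 2 * (norm q)\<^sup>2"
    unfolding sq by (simp add: ring_distribs)
  ultimately show ?thesis
    unfolding p_def[symmetric] q_def[symmetric] inner_add_left inner_add_right inner_scaleR_left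
    by linarith
qed

end

section \<open>Stationarity of the limit\<close>

text \<open>Of the client gradients only boundedness is known, while stationarity asks for a
  separate subgradient for each client along one common subsequence.\<close>

lemma common_convergent_subsequence:
  fixes f :: "'l \<Rightarrow> nat \<Rightarrow> 'a::euclidean_space"
  assumes "finite A" "\<And>l. l \<in> A \<Longrightarrow> bounded (range (f l))"
  shows "\<exists>s. strict_mono s \<and> (\<forall>l\<in>A. convergent (\<lambda>k. f l (s k)))"
  using assms
proof (induction rule: finite_induct)
  case empty
  show ?case by (intro exI[of _ id]) (auto simp: strict_mono_def)
next
  case (insert l A)
  then obtain s where s: "strict_mono s" "\<And>l. l \<in> A \<Longrightarrow> convergent (\<lambda>k. f l (s k))" by auto
  have "bounded (range (\<lambda>k. f l (s k)))"
    by (rule bounded_subset[of "range (f l)"]) (use insert.prems in auto)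
  then obtain L r where r: "strict_mono (r :: nat \<Rightarrow> nat)" "((\<lambda>k. f l (s k)) \<circ> r) \<longlonglongrightarrow> L"
    using bounded_imp_convergent_subsequence by blast
  have "convergent (\<lambda>k. f l' (s (r k)))" if "l' \<in> insert l A" for l'
  proof (cases "l' = l")
    case True
    then show ?thesis using r(2) by (auto simp: convergent_def o_def)
  next
    case False
    with that have "convergent (\<lambda>k. f l' (s k))" using s(2) by auto
    then show ?thesis
      using LIMSEQ_subseq_LIMSEQ[OF _ r(1)] by (fastforce simp: convergent_def o_def)
  qed
  then show ?case
    using strict_mono_o[OF s(1) r(1)] by (intro exI[of _ "s \<circ> r"]) (auto simp: o_def)
qed

lemma frechet_subdiff_of_quadratic_minorant:
  assumes "\<And>z. f w + v \<bullet> (z - w) - K * (norm (z - w))\<^sup>2 \<le> f z"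
  shows "v \<in> frechet_subdiff f w"
  unfolding frechet_subdiff_def mem_Collect_eq
proof (intro allI impI)
  fix \<epsilon> :: real assume \<epsilon>: "0 < \<epsilon>"
  have "f w + v \<bullet> (z - w) - \<epsilon> * norm (z - w) \<le> f z" if "norm (z - w) < \<epsilon> / (\<bar>K\<bar> + 1)" for z
  proof -
    have "norm (z - w) * (\<bar>K\<bar> + 1) \<le> \<epsilon>"
      using that by (simp add: pos_less_divide_eq add_nonneg_pos less_imp_le)
    moreover have "K * norm (z - w) \<le> norm (z - w) * (\<bar>K\<bar> + 1)"
      using mult_right_mono[of K "\<bar>K\<bar> + 1" "norm (z - w)"] by (simp add: mult.commute)
    ultimately have "K * norm (z - w) * norm (z - w) \<le> \<epsilon> * norm (z - w)"
      by (intro mult_right_mono) auto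
    then show ?thesis using assms[of z] by (simp add: power2_eq_square)
  qed
  then show "\<exists>\<delta>>0. \<forall>z. norm (z - w) < \<delta> \<longrightarrow> f w + v \<bullet> (z - w) - \<epsilon> * norm (z - w) \<le> f z"
    using \<epsilon> by (intro exI[of _ "\<epsilon> / (\<bar>K\<bar> + 1)"]) auto
qed

lemma limiting_subdiff_of_frechet: "v \<in> frechet_subdiff f w \<Longrightarrow> v \<in> limiting_subdiff f w"
  unfolding limiting_subdiff_def mem_Collect_eq
  by (rule exI[of _ "\<lambda>_. w"], rule exI[of _ "\<lambda>_. v"]) simp

lemma penalty_eq_inner: "penalty g v = (\<Sum>j\<in>UNIV. g ((axis j 1, 0) \<bullet> v))"
  by (simp add: penalty_def inner_prod_def inner_axis')

text \<open>Without samples the penalty has weight 0, but the stationarity condition still asks for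
  some element of its subdifferential. Restriction to a coordinate axis shows that \<open>g\<close>
  itself is weakly convex; its one-variable subgradients are then combined coordinatewise.\<close>

lemma limiting_subdiff_penalty_nonempty:
  fixes w :: "(real^'p) \<times> real"
  assumes weak: "convex_on UNIV (\<lambda>v::(real^'p) \<times> real. penalty g v + \<rho> / 2 * (norm v)\<^sup>2)" and "g 0 = 0"
  shows "\<exists>v. v \<in> limiting_subdiff (penalty g) w"
proof -
  fix p0 :: 'p
  have pen_axis: "penalty g (axis p0 t, 0 :: real) = g t" for t
  proof -
    have "penalty g (axis p0 t, 0 :: real) = (\<Sum>p\<in>UNIV. if p = p0 then g t else 0)"
      unfolding penalty_def using \<open>g 0 = 0\<close> by (intro sum.cong refl) (auto simp: axis_def)
    then show ?thesis by simp
  qed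
  have norm_axis_pair: "(norm (axis p0 t :: real^'p, 0 :: real))\<^sup>2 = t\<^sup>2" for t
    unfolding power2_norm_eq_inner inner_Pair inner_axis_axis by (simp add: power2_eq_square)
  have conv: "convex_on UNIV (\<lambda>t. g t + \<rho> / 2 * t\<^sup>2)"
  proof (rule convex_onI)
    fix t x y :: real assume t: "0 < t" "t < 1"
    have eq: "(1 - t) *\<^sub>R (axis p0 x, 0 :: real) + t *\<^sub>R (axis p0 y, 0) = (axis p0 ((1 - t) *\<^sub>R x + t *\<^sub>R y), 0)"
      by (simp add: axis_def vec_eq_iff)
    show "g ((1 - t) *\<^sub>R x + t *\<^sub>R y) + \<rho> / 2 * ((1 - t) *\<^sub>R x + t *\<^sub>R y)\<^sup>2
      \<le> (1 - t) * (g x + \<rho> / 2 * x\<^sup>2) + t * (g y + \<rho> / 2 * y\<^sup>2)"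
      using convex_onD[OF weak, of t "(axis p0 x, 0)" "(axis p0 y, 0)"] t
      unfolding eq pen_axis norm_axis_pair by simp
  qed simp
  have "\<exists>A. \<forall>s. g t + A * (s - t) - \<rho> / 2 * (s - t)\<^sup>2 \<le> g s" for t
  proof -
    \<comment> \<open>The right derivative at \<open>t\<close> of the convexified function;
      subtracting \<open>\<rho> * t\<close> returns to \<open>g\<close>.\<close>
    define A where "A = Inf ((\<lambda>s. (g t + \<rho> / 2 * t\<^sup>2 - (g s + \<rho> / 2 * s\<^sup>2)) / (t - s)) ` ({t<..} \<inter> UNIV))"
    have "g t + (A - \<rho> * t) * (s - t) - \<rho> / 2 * (s - t)\<^sup>2 \<le> g s" for s
    proof -
      have "g t + \<rho> / 2 * t\<^sup>2 + A * (s - t) \<le> g s + \<rho> / 2 * s\<^sup>2"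
        unfolding A_def using convex_le_Inf_differential[OF conv, of t s] by simp
      then show ?thesis by (simp add: power2_eq_square algebra_simps)
    qed
    then show ?thesis by blast
  qed
  then obtain A where A: "\<And>t s. g t + A t * (s - t) - \<rho> / 2 * (s - t)\<^sup>2 \<le> g s" by metis
  define v :: "(real^'p) \<times> real" where "v = ((\<chi> p. A (fst w $ p)), 0)"
  have "v \<in> frechet_subdiff (penalty g) w"
  proof (rule frechet_subdiff_of_quadratic_minorant[where K = "\<bar>\<rho>\<bar> / 2"])
    fix z :: "(real^'p) \<times> real"
    have vz: "v \<bullet> (z - w) = (\<Sum>p\<in>UNIV. A (fst w $ p) * (fst z $ p - fst w $ p))"
      by (simp add: v_def inner_prod_def inner_vec_def)
    have "(\<Sum>p\<in>UNIV. (fst z $ p - fst w $ p)\<^sup>2) = (norm (fst z - fst w))\<^sup>2"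
      unfolding power2_norm_eq_inner inner_vec_def by (simp add: power2_eq_square)
    also have "\<dots> \<le> (norm (z - w))\<^sup>2"
      using norm_fst_le[of "fst (z - w)" "snd (z - w)"] unfolding prod.collapse by (intro power_mono) auto
    finally have "\<bar>\<rho>\<bar> / 2 * (\<Sum>p\<in>UNIV. (fst z $ p - fst w $ p)\<^sup>2) \<le> \<bar>\<rho>\<bar> / 2 * (norm (z - w))\<^sup>2"
      by (intro mult_left_mono) auto
    moreover have "(\<Sum>p\<in>UNIV. g (fst w $ p) + A (fst w $ p) * (fst z $ p - fst w $ p) - \<bar>\<rho>\<bar> / 2 * (fst z $ p - fst w $ p)\<^sup>2) \<le> penalty g z"
      unfolding penalty_def
    proof (rule sum_mono)
      fix p
      have "\<rho> / 2 * (fst z $ p - fst w $ p)\<^sup>2 \<le> \<bar>\<rho>\<bar> / 2 * (fst z $ p - fst w $ p)\<^sup>2"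
        by (intro mult_right_mono) auto
      then show "g (fst w $ p) + A (fst w $ p) * (fst z $ p - fst w $ p) - \<bar>\<rho>\<bar> / 2 * (fst z $ p - fst w $ p)\<^sup>2 \<le> g (fst z $ p)"
        using A[of "fst w $ p" "fst z $ p"] by linarith
    qed
    ultimately show "penalty g w + v \<bullet> (z - w) - \<bar>\<rho>\<bar> / 2 * (norm (z - w))\<^sup>2 \<le> penalty g z"
      unfolding vz by (simp add: penalty_def sum.distrib sum_subtractf sum_distrib_left)
  qed
  then show ?thesis using limiting_subdiff_of_frechet by blast
qed

section \<open>Assembly over the clients\<close>

lemma finite_samples: "finite (samples L M)"
  and sum_samples: "(\<Sum>s\<in>samples L M. f (fst s) (snd s)) = (\<Sum>l<L. \<Sum>i<M l. f l i)"
proof -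
  have eq: "samples L M = Sigma {..<L} (\<lambda>l. {..<M l})" by (auto simp: samples_def)
  show "finite (samples L M)" unfolding eq by auto
  show "(\<Sum>s\<in>samples L M. f (fst s) (snd s)) = (\<Sum>l<L. \<Sum>i<M l. f l i)"
    unfolding eq by (subst sum.Sigma) (auto simp: case_prod_beta')
qed

theorem theorem3:
  fixes L :: nat and M :: "nat \<Rightarrow> nat"
    and y :: "nat \<Rightarrow> nat \<Rightarrow> real" and x :: "nat \<Rightarrow> nat \<Rightarrow> real^'p"
    and \<tau> lam \<gamma> :: real and pen :: "real \<Rightarrow> real"
    and c \<beta> d \<rho> :: real
    and w :: "nat \<Rightarrow> (real^'p) \<times> real"
    and grad :: "nat \<Rightarrow> nat \<Rightarrow> (real^'p) \<times> real"
  defines "n \<equiv> num_samples L M"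
  defines "\<sigma> \<equiv> (\<lambda>k::nat. c * real k powr d)"
  defines "\<mu> \<equiv> (\<lambda>k::nat. \<beta> / real k powr d)"
  assumes tau: "0 < \<tau>" "\<tau> < 1"
    and lam: "lam > 0"
    and pen: "(\<gamma> \<ge> 1 \<and> pen = mcp lam \<gamma>) \<or> (\<gamma> \<ge> 2 \<and> pen = scad lam \<gamma>)"
    and params: "c > 0" "\<beta> > 0" "0 < d" "d < 1"
    and step: "\<beta> * c \<ge> lambda_max (gram x) (samples L M) / 2"
    and weak: "\<rho> \<ge> 0" "convex_on UNIV (\<lambda>v::(real^'p) \<times> real. penalty pen v + \<rho> / 2 * (norm v)\<^sup>2)"
    and K: "\<exists>K. \<forall>k\<ge>K. \<sigma> (k + 1) \<ge> real n * \<rho>"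
    and grad: "\<And>k l. l < L \<Longrightarrow>
       ((\<lambda>v. sqloss \<tau> M y x l v (\<mu> (k + 1))) has_derivative (\<lambda>h. inner (grad k l) h)) (at (w k))"
    and iter: "\<And>k v.
       (\<Sum>l<L. inner (grad k l) (w (k + 1) - w k)) + real n * penalty pen (w (k + 1))
         + \<sigma> (k + 1) / 2 * (norm (w (k + 1) - w k))\<^sup>2
       \<le> (\<Sum>l<L. inner (grad k l) (v - w k)) + real n * penalty pen v
         + \<sigma> (k + 1) / 2 * (norm (v - w k))\<^sup>2"
  shows "\<exists>wstar. w \<longlonglongrightarrow> wstar \<and>
     (\<exists>vg vp. (\<forall>l<L. vg l \<in> convex_subdiff (qloss \<tau> M y x l) wstar)
        \<and> vp \<in> limiting_subdiff (penalty pen) wstar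
        \<and> (\<Sum>l<L. vg l) + real n *\<^sub>R vp = 0)"
proof -
  \<comment> \<open>The shift by one matches the algorithm and avoids index 0, where the definition
    of \<open>\<mu>\<close> would divide by zero.\<close>
  define nu where "nu k = \<mu> (Suc k)" for k
  define a where "a k = \<sigma> (Suc k)" for k
  have nu_pos: "0 < nu k" for k using params by (simp add: nu_def \<mu>_def)
  interpret client: smoothed_loss "{..<M l}" "xbar x l" "y l" \<tau> for l
    using tau by unfold_locales auto
  have sqloss: "sqloss \<tau> M y x l v \<nu> = client.loss l v \<nu>" for l v \<nu>
    by (simp add: sqloss_def client.loss_def client.res_def sum.distrib sum_distrib_left sum_divide_distrib)
  have qloss: "qloss \<tau> M y x l = client.exact_loss l" for l
    by (rule ext) (simp add: qloss_def client.exact_loss_def client.res_def sum.distrib sum_distrib_left sum_divide_distrib)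
  \<comment> \<open>\<open>grad\<close> is only assumed to represent a derivative; uniqueness
    identifies it with the explicit formula.\<close>
  have grad_eq: "grad k l = client.gradient l (w k) (nu k)" if "l < L" for k l
  proof -
    have "(\<lambda>h. grad k l \<bullet> h) = (\<lambda>h. client.gradient l (w k) (nu k) \<bullet> h)"
      using has_derivative_unique[OF grad[OF that, of k]] client.loss_has_derivative[OF nu_pos[of k], of l "w k"]
      by (simp add: sqloss nu_def)
    then show ?thesis by (metis vector_eq_rdot)
  qed
  define X where "X s = xbar x (fst s) (snd s)" for s
  define ys where "ys s = y (fst s) (snd s)" for s
  \<comment> \<open>Only feature coordinates occur, so the intercept is not penalized.\<close>
  define E where "E j = (axis j 1 :: real^'p, 0 :: real)" for j
  interpret sum: smoothed_loss "samples L M" X ys \<tau>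
    using tau finite_samples by unfold_locales auto
  have sum_grad: "sum.gradient (w k) (nu k) = (\<Sum>l<L. grad k l)" for k
  proof -
    have "sum.gradient (w k) (nu k) = - (\<Sum>l<L. \<Sum>i<M l. (clip (client.res l i (w k)) (nu k) / 2 + (\<tau> - 1/2)) *\<^sub>R xbar x l i)"
      unfolding sum.gradient_def sum_samples[symmetric] by (simp add: sum.res_def client.res_def X_def ys_def)
    also have "\<dots> = (\<Sum>l<L. client.gradient l (w k) (nu k))"
      by (simp add: client.gradient_def sum_negf)
    also have "\<dots> = (\<Sum>l<L. grad k l)"
      by (intro sum.cong) (auto simp: grad_eq)
    finally show ?thesis .
  qed
  have rayleigh: "(\<Sum>s\<in>samples L M. (X s \<bullet> h)\<^sup>2) \<le> 2 * (c * \<beta>) * (norm h)\<^sup>2" for h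
  \<comment> \<open>Without samples \<open>lambda_max\<close> is the \<open>Max\<close> of the empty
    set and says nothing, but then the sum is 0.\<close>
  proof (cases "samples L M = {}")
    case True
    then show ?thesis using params by simp
  next
    case False
    then obtain s where s: "s \<in> samples L M" by blast
    \<comment> \<open>The appended entry 1 makes every column nonzero.\<close>
    have "X s \<noteq> 0" by (simp add: X_def xbar_def zero_prod_def)
    from sum_squares_le_lambda_max[of _ _ X, OF finite_samples s this]
    have "(\<Sum>s\<in>samples L M. (X s \<bullet> h)\<^sup>2) \<le> lambda_max (\<lambda>a b. X a \<bullet> X b) (samples L M) * (norm h)\<^sup>2" .
    also have "(\<lambda>a b. X a \<bullet> X b) = gram x" by (intro ext) (simp add: X_def gram_def)
    also have "lambda_max (gram x) (samples L M) * (norm h)\<^sup>2 \<le> 2 * (c * \<beta>) * (norm h)\<^sup>2"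
      using step by (intro mult_right_mono) (auto simp: mult.commute)
    finally show ?thesis .
  qed
  obtain Q where Q: "finite Q" "\<And>t. t \<noteq> 0 \<Longrightarrow> \<exists>k\<in>Q. piece_at pen t k"
    using penalty_finite_pieces[OF lam pen] by blast
  have pen_eq: "penalty pen v = (\<Sum>j\<in>UNIV. pen (E j \<bullet> v))" for v
    by (simp add: penalty_eq_inner E_def)
  interpret pg: smoothed_proximal_gradient "samples L M" X ys \<tau> UNIV E pen Q "real n" c \<beta> d \<rho> w a nu
  proof unfold_locales
    show "sum.gradient (w k) (nu k) \<bullet> (w (Suc k) - w k) + real n * (\<Sum>j\<in>UNIV. pen (E j \<bullet> w (Suc k)))
        + a k / 2 * (norm (w (Suc k) - w k))\<^sup>2
      \<le> sum.gradient (w k) (nu k) \<bullet> (v - w k) + real n * (\<Sum>j\<in>UNIV. pen (E j \<bullet> v)) + a k / 2 * (norm (v - w k))\<^sup>2" for k v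
      using iter[of k v] unfolding sum_grad pen_eq inner_sum_left a_def by simp
    show "convex_on UNIV (\<lambda>v. (\<Sum>j\<in>UNIV. pen (E j \<bullet> v)) + \<rho> / 2 * (norm v)\<^sup>2)"
      using weak(2) by (simp add: pen_eq)
  qed (use Q pen_nonneg[OF lam pen] params rayleigh in \<open>auto simp: a_def nu_def \<sigma>_def \<mu>_def\<close>)
  have reg_eq: "pg.reg = penalty pen"
    by (rule ext) (simp add: pg.reg_def pen_eq)
  obtain wstar r where wstar: "w \<longlonglongrightarrow> wstar" and r: "strict_mono r"
    and crit: "(\<lambda>k. a (r k) * norm (w (Suc (r k)) - w (r k))) \<longlonglongrightarrow> 0"
    using pg.critical_subsequence by blast
  show ?thesis
  proof (cases "n = 0")
    case True
    then have M0: "M l = 0" if "l < L" for l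
      using that by (simp add: n_def num_samples_def)
    have "0 \<in> convex_subdiff (qloss \<tau> M y x l) wstar" if "l < L" for l
      using M0[OF that] by (simp add: convex_subdiff_def qloss_def)
    moreover obtain vp where "vp \<in> limiting_subdiff (penalty pen) wstar"
      using limiting_subdiff_penalty_nonempty[OF weak(2)] pen_nonneg(2)[OF lam pen] by blast
    ultimately show ?thesis
      using wstar True by (intro exI[of _ wstar] conjI exI[of _ "\<lambda>_. 0"] exI[of _ vp]) auto
  next
    case False
    then have n: "0 < real n" by simp
    have bounded: "bounded (range (\<lambda>k. client.gradient l (w (r k)) (nu (r k))))" for l
      unfolding bounded_iff using client.norm_gradient_le by blast
    obtain s where s: "strict_mono s" "\<And>l. l \<in> {..<L} \<Longrightarrow> convergent (\<lambda>k. client.gradient l (w (r (s k))) (nu (r (s k))))"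
      using common_convergent_subsequence[of "{..<L}" "\<lambda>l k. client.gradient l (w (r k)) (nu (r k))"] bounded
      by auto
    define q where "q k = r (s k)" for k
    have q: "strict_mono q" using r s(1) by (simp add: q_def strict_mono_def)
    obtain vg where vg: "\<And>l. l < L \<Longrightarrow> (\<lambda>k. client.gradient l (w (q k)) (nu (q k))) \<longlonglongrightarrow> vg l"
      using s(2) unfolding convergent_def q_def lessThan_iff by metis
    have wq: "(\<lambda>k. w (q k)) \<longlonglongrightarrow> wstar" and nuq: "(\<lambda>k. nu (q k)) \<longlonglongrightarrow> 0"
      and wSq: "(\<lambda>k. w (Suc (q k))) \<longlonglongrightarrow> wstar"
      using LIMSEQ_subseq_LIMSEQ[OF wstar q] LIMSEQ_subseq_LIMSEQ[OF pg.\<mu>_tendsto_0 q]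
        LIMSEQ_subseq_LIMSEQ[OF LIMSEQ_Suc[OF wstar] q] by (auto simp: o_def)
    have "vg l \<in> convex_subdiff (qloss \<tau> M y x l) wstar" if "l < L" for l
      unfolding qloss by (rule client.limit_in_convex_subdiff[OF nu_pos nuq wq vg[OF that]])
    moreover have "- (1 / real n) *\<^sub>R (\<Sum>l<L. vg l) \<in> limiting_subdiff (penalty pen) wstar"
    proof -
      \<comment> \<open>Dividing the optimality condition of the subproblem by \<open>n\<close>
        gives a subgradient of the penalty at the next iterate \<open>w (Suc (q k))\<close>, which
        has the same limit as \<open>w (q k)\<close>.\<close>
      define v where "v k = - (1 / real n) *\<^sub>R (sum.gradient (w (q k)) (nu (q k)) + a (q k) *\<^sub>R (w (Suc (q k)) - w (q k)))" for k
      have "v k \<in> frechet_subdiff (penalty pen) (w (Suc (q k)))" for k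
      proof (rule frechet_subdiff_of_quadratic_minorant[where K = "a (q k) / (2 * real n)"])
        fix z
        have "real n * (penalty pen (w (Suc (q k))) + v k \<bullet> (z - w (Suc (q k)))
              - a (q k) / (2 * real n) * (norm (z - w (Suc (q k))))\<^sup>2) \<le> real n * penalty pen z"
          using pg.prox_subgradient[of "q k" z] n
          unfolding reg_eq v_def right_diff_distrib distrib_left by simp
        then show "penalty pen (w (Suc (q k))) + v k \<bullet> (z - w (Suc (q k)))
              - a (q k) / (2 * real n) * (norm (z - w (Suc (q k))))\<^sup>2 \<le> penalty pen z"
          using n by simp
      qed
      moreover have "v \<longlonglongrightarrow> - (1 / real n) *\<^sub>R (\<Sum>l<L. vg l)"
      proof -
        have "(\<lambda>k. norm (a (q k) *\<^sub>R (w (Suc (q k)) - w (q k)))) \<longlonglongrightarrow> 0"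
          using LIMSEQ_subseq_LIMSEQ[OF crit s(1)] pg.a_pos(1) by (simp add: o_def q_def abs_of_pos)
        then have "(\<lambda>k. a (q k) *\<^sub>R (w (Suc (q k)) - w (q k))) \<longlonglongrightarrow> 0"
          by (rule tendsto_norm_zero_cancel)
        moreover have "(\<lambda>k. sum.gradient (w (q k)) (nu (q k))) \<longlonglongrightarrow> (\<Sum>l<L. vg l)"
          unfolding sum_grad by (intro tendsto_sum) (use vg in \<open>simp add: grad_eq\<close>)
        ultimately have "v \<longlonglongrightarrow> - (1 / real n) *\<^sub>R ((\<Sum>l<L. vg l) + 0)"
          unfolding v_def by (intro tendsto_intros)
        then show ?thesis by simp
      qed
      moreover have "(\<lambda>k. penalty pen (w (Suc (q k)))) \<longlonglongrightarrow> penalty pen wstar"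
      proof -
        \<comment> \<open>A finite convex function on a finite-dimensional space is continuous;
          removing the quadratic gives the convergence of values that the limiting subdifferential
          demands.\<close>
        have "continuous_on UNIV (\<lambda>v :: (real^'p) \<times> real. penalty pen v + \<rho> / 2 * (norm v)\<^sup>2)"
          by (rule convex_on_continuous[OF open_UNIV weak(2)])
        then have "(\<lambda>k. penalty pen (w (Suc (q k))) + \<rho> / 2 * (norm (w (Suc (q k))))\<^sup>2)
            \<longlonglongrightarrow> penalty pen wstar + \<rho> / 2 * (norm wstar)\<^sup>2"
          using wSq by (rule continuous_on_tendsto_compose) auto
        moreover have "(\<lambda>k. \<rho> / 2 * (norm (w (Suc (q k))))\<^sup>2) \<longlonglongrightarrow> \<rho> / 2 * (norm wstar)\<^sup>2"
          by (intro tendsto_intros wSq)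
        ultimately show ?thesis by (auto dest: tendsto_diff)
      qed
      ultimately show ?thesis
        unfolding limiting_subdiff_def using wSq by blast
    qed
    moreover have "(\<Sum>l<L. vg l) + real n *\<^sub>R (- (1 / real n) *\<^sub>R (\<Sum>l<L. vg l)) = 0"
      using n by simp
    ultimately show ?thesis using wstar by blast
  qed
qed

end
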